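(* Let $0<q<1$ and let $T_q:\mathbb{T}\to\mathbb{T}$ be the map of the circle $\mathbb{T}=\mathbb{R}/\mathbb{Z}$ (parametrized by $[0,1)$) given by $T_q(x)=(1+(2x)^q)x$ for $x\in[0,\frac12]$ and $T_q(x)=2x-1$ for $x\in[\frac12,1)$ (values modulo $1$). For any $\beta>1$ and any $A\in\mathcal{C}^{q+\beta\log}(\mathbb{T})$, the transfer operator $\mathscr{L}_{T_q,A}$ acting on $\mathcal{C}^{(\beta-1)\log}(\mathbb{T})$ satisfies a Ruelle–Perron–Frobenius theorem, and the RPF measure has a polynomial decay of correlations of degree $\beta-1$.
   Context: Function spaces: for a modulus of continuity $\omega$ (continuous, increasing, concave $[0,\infty)\to[0,\infty)$, $\omega(0)=0$), $\mathcal{C}^\omega(\mathbb{T})$ is the Banach space of $f:\mathbb{T}\to\mathbb{R}$ with $|f(x)-f(y)|\le C\omega(d(x,y))$ for some $C$ (least such $C$ denoted $\mathrm{Hol}_\omega(f)$), with norm $\|f\|_\infty+\mathrm{Hol}_\omega(f)$. For $\alpha\in(0,1)$, $\beta\in\mathbb{R}$, or $\alpha=0$, $\beta>0$, $\mathcal{C}^{\alpha+\beta\log}$ corresponds to a modulus $\omega_{\alpha+\beta\log}$ equal to $r^\alpha/(\log\frac{r_0}{r})^\beta$ on $(0,1]$, with $r_0$ (depending on $\alpha,\beta$) large enough to make it increasing and concave on $[0,1]$; when $\alpha=0$ one writes $\mathcal{C}^{\beta\log}$ and $\mathrm{Hol}_{\beta\log}$. Transfer operator: $\mathscr{L}_{T,A}f(x)=\sum_{T(y)=x}e^{A(y)}f(y)$.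 It satisfies a Ruelle–Perron–Frobenius (RPF) theorem on a Banach space $\mathcal{X}$ of functions on which it acts continuously if there exist a positive $h\in\mathcal{X}$, a constant $\rho>0$ and a nonzero positive finite measure $\nu$ with $\mathscr{L}_{T,A}h=\rho h$ and $\mathscr{L}_{T,A}^*\nu=\rho\nu$ (i.e. $\int\mathscr{L}_{T,A}f\,d\nu=\rho\int f\,d\nu$ for all $f\in\mathcal{X}$). The RPF measure is the probability measure $\mu_A$ with $d\mu_A=h\,d\nu$, $h$ suitably scaled. Polynomial decay of correlations of degree $\beta-1$: there is $C$ such that for all $f\in\mathcal{C}^{(\beta-1)\log}(\mathbb{T})$, $g\in L^1(\mu_A)$ and $t\ge1$, $\left|\int f\cdot g\circ T^t\,d\mu_A-\int f\,d\mu_A\int g\,d\mu_A\right|\le C\,\mathrm{Hol}_{(\beta-1)\log}(f)\,\|g\|_{L^1(\mu_A)}/t^{\beta-1}$. *)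

theory Defs
  imports "HOL-Probability.Probability" "HOL-Real_Asymp.Real_Asymp"
begin

subsection \<open>The circle\<close>

text \<open>The circle \<open>\<real>/\<int>\<close>, each class being represented by its element in \<open>[0,1)\<close>.\<close>

typedef circle = "{0..<1::real}"
  morphisms circle_rep Abs_circle
  by (rule exI[of _ 0]) simp

definition circle_of :: "real \<Rightarrow> circle" where
  "circle_of r = Abs_circle (frac r)"

lemma circle_rep_bounds: "0 \<le> circle_rep x" "circle_rep x < 1"
  using circle_rep[of x] by auto

lemma circle_rep_circle_of: "circle_rep (circle_of r) = frac r"
  unfolding circle_of_def by (rule Abs_circle_inverse) (simp add: frac_lt_1)

lemma circle_of_circle_rep: "circle_of (circle_rep x) = x"
  by (metis circle_rep_inverse circle_of_def circle_rep_bounds frac_eq)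

instantiation circle :: metric_space
begin

text \<open>The quotient metric: the infimum of \<open>\<bar>x - y - k\<bar>\<close> over integers \<open>k\<close> is attained
  at some \<open>k \<in> {-1, 0, 1}\<close> for representatives in \<open>[0,1)\<close>.\<close>

definition dist_circle :: "circle \<Rightarrow> circle \<Rightarrow> real" where
  "dist_circle x y =
     min \<bar>circle_rep x - circle_rep y\<bar> (1 - \<bar>circle_rep x - circle_rep y\<bar>)"

definition uniformity_circle :: "(circle \<times> circle) filter" where
  "uniformity_circle = (INF e\<in>{0<..}. principal {(x, y). dist x y < e})"

definition open_circle :: "circle set \<Rightarrow> bool" where
  "open_circle U \<longleftrightarrow> (\<forall>x\<in>U. eventually (\<lambda>(x', y). x' = x \<longrightarrow> y \<in> U) uniformity)"

instance
proof
  fix x y z :: circle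
  show "dist x y = 0 \<longleftrightarrow> x = y"
    using circle_rep_bounds[of x] circle_rep_bounds[of y]
    by (auto simp: dist_circle_def min_def abs_if circle_rep_inject split: if_splits)
  show "dist x y \<le> dist x z + dist y z"
    using circle_rep_bounds[of x] circle_rep_bounds[of y] circle_rep_bounds[of z]
    unfolding dist_circle_def min_def abs_if by auto
qed (simp_all add: uniformity_circle_def open_circle_def)

end

subsection \<open>Generalized Hoelder spaces\<close>

definition modulus_of_continuity :: "(real \<Rightarrow> real) \<Rightarrow> bool" where
  "modulus_of_continuity \<omega> \<longleftrightarrow>
     continuous_on {0..} \<omega> \<and> mono_on {0..} \<omega> \<and> concave_on {0..} \<omega> \<and> \<omega> 0 = 0"

definition holder_space :: "(real \<Rightarrow> real) \<Rightarrow> ('a::metric_space \<Rightarrow> real) set" where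
  "holder_space \<omega> = {f. \<exists>C. \<forall>x y. \<bar>f x - f y\<bar> \<le> C * \<omega> (dist x y)}"

definition holder_const :: "(real \<Rightarrow> real) \<Rightarrow> ('a::metric_space \<Rightarrow> real) \<Rightarrow> real" where
  "holder_const \<omega> f = Inf {C. \<forall>x y. \<bar>f x - f y\<bar> \<le> C * \<omega> (dist x y)}"

definition holder_norm :: "(real \<Rightarrow> real) \<Rightarrow> ('a::metric_space \<Rightarrow> real) \<Rightarrow> real" where
  "holder_norm \<omega> f = (SUP x. \<bar>f x\<bar>) + holder_const \<omega> f"

text \<open>\<open>\<omega>\<close> is a possible choice of the modulus \<open>\<omega>\<^bsub>\<alpha> + \<beta> log\<^esub>\<close>: the constant \<open>r0\<close> is any one
  for which the formula is compatible with \<open>\<omega>\<close> being a modulus of continuity, and \<open>\<omega>\<close>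
  is otherwise arbitrary beyond \<open>1\<close>. On the circle, whose diameter is \<open>1/2\<close>, distinct choices
  give the same space with equivalent norms.\<close>

definition log_modulus :: "real \<Rightarrow> real \<Rightarrow> (real \<Rightarrow> real) \<Rightarrow> bool" where
  "log_modulus \<alpha> \<beta> \<omega> \<longleftrightarrow> modulus_of_continuity \<omega> \<and>
     (\<exists>r0>1. \<forall>r\<in>{0<..1}. \<omega> r = r powr \<alpha> / (ln (r0 / r)) powr \<beta>)"

subsection \<open>Transfer operators and Ruelle--Perron--Frobenius theorems\<close>

text \<open>Meant for finite-to-one maps only: \<open>sum\<close> vanishes on infinite fibres.\<close>

definition transfer_op :: "('a \<Rightarrow> 'a) \<Rightarrow> ('a \<Rightarrow> real) \<Rightarrow> ('a \<Rightarrow> real) \<Rightarrow> 'a \<Rightarrow> real" where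
  "transfer_op T A f x = (\<Sum>y\<in>T -` {x}. exp (A y) * f y)"

text \<open>Continuity of a linear operator \<open>L\<close> on a space \<open>X\<close> of functions with norm \<open>N\<close>.\<close>

definition acts_continuously ::
  "(('a \<Rightarrow> real) \<Rightarrow> 'a \<Rightarrow> real) \<Rightarrow> ('a \<Rightarrow> real) set \<Rightarrow> (('a \<Rightarrow> real) \<Rightarrow> real) \<Rightarrow> bool" where
  "acts_continuously L X N \<longleftrightarrow>
     (\<forall>f\<in>X. L f \<in> X) \<and> (\<exists>K. \<forall>f\<in>X. N (L f) \<le> K * N f)"

definition RPF_data ::
  "('a::topological_space \<Rightarrow> 'a) \<Rightarrow> ('a \<Rightarrow> real) \<Rightarrow> ('a \<Rightarrow> real) set
     \<Rightarrow> ('a \<Rightarrow> real) \<Rightarrow> real \<Rightarrow> 'a measure \<Rightarrow> bool" where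
  "RPF_data T A X h \<rho> \<nu> \<longleftrightarrow>
     h \<in> X \<and> (\<forall>x. 0 < h x) \<and> 0 < \<rho> \<and>
     sets \<nu> = sets borel \<and> finite_measure \<nu> \<and> emeasure \<nu> (space \<nu>) \<noteq> 0 \<and>
     (\<forall>x. transfer_op T A h x = \<rho> * h x) \<and>
     (\<forall>f\<in>X. (\<integral>x. transfer_op T A f x \<partial>\<nu>) = \<rho> * (\<integral>x. f x \<partial>\<nu>))"

definition satisfies_RPF ::
  "('a::topological_space \<Rightarrow> 'a) \<Rightarrow> ('a \<Rightarrow> real) \<Rightarrow> ('a \<Rightarrow> real) set
     \<Rightarrow> (('a \<Rightarrow> real) \<Rightarrow> real) \<Rightarrow> bool" where
  "satisfies_RPF T A X N \<longleftrightarrow>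
     acts_continuously (transfer_op T A) X N \<and> (\<exists>h \<rho> \<nu>. RPF_data T A X h \<rho> \<nu>)"

text \<open>The scaling of \<open>h\<close> is absorbed in \<open>RPF_data\<close>, which is invariant under multiplying \<open>h\<close>
  by a positive constant.\<close>

definition RPF_measure ::
  "('a::topological_space \<Rightarrow> 'a) \<Rightarrow> ('a \<Rightarrow> real) \<Rightarrow> ('a \<Rightarrow> real) set \<Rightarrow> 'a measure \<Rightarrow> bool" where
  "RPF_measure T A X \<mu> \<longleftrightarrow>
     (\<exists>h \<rho> \<nu>. RPF_data T A X h \<rho> \<nu> \<and> \<mu> = density \<nu> (\<lambda>x. ennreal (h x)) \<and> prob_space \<mu>)"

text \<open>Decay of correlations of degree \<open>d\<close> for observables in the space of modulus \<open>\<omega>\<close>.\<close>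

definition polynomial_decay ::
  "('a::metric_space \<Rightarrow> 'a) \<Rightarrow> 'a measure \<Rightarrow> (real \<Rightarrow> real) \<Rightarrow> real \<Rightarrow> bool" where
  "polynomial_decay T \<mu> \<omega> d \<longleftrightarrow>
     (\<exists>C. \<forall>f\<in>holder_space \<omega>. \<forall>g. integrable \<mu> g \<longrightarrow> (\<forall>t::nat. t \<ge> 1 \<longrightarrow>
        \<bar>(\<integral>x. f x * g ((T ^^ t) x) \<partial>\<mu>) - (\<integral>x. f x \<partial>\<mu>) * (\<integral>x. g x \<partial>\<mu>)\<bar>
          \<le> C * holder_const \<omega> f * (\<integral>x. \<bar>g x\<bar> \<partial>\<mu>) / real t powr d))"

subsection \<open>The intermittent map\<close>

definition T_map :: "real \<Rightarrow> circle \<Rightarrow> circle" where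
  "T_map q x = (let r = circle_rep x in
     circle_of (if r \<le> 1/2 then (1 + (2 * r) powr q) * r else 2 * r - 1))"

subsection \<open>Existence of logarithmic moduli\<close>

lemma modulus_of_continuity_extend:
  fixes F :: "real \<Rightarrow> real"
  assumes cont: "continuous_on {0<..1} F" and mono: "mono_on {0<..1} F"
    and conc: "concave_on {0<..1} F" and pos: "\<And>r. r \<in> {0<..1} \<Longrightarrow> 0 \<le> F r"
    and lim: "(F \<longlongrightarrow> 0) (at_right 0)"
  shows "modulus_of_continuity (\<lambda>r. if r = 0 then 0 else F (min r 1))"
proof -
  let ?G = "\<lambda>r. if r = 0 then 0 else F (min r 1)"
  have c1: "continuous (at x within {0..}) ?G" if "x \<in> {0..}" for x
  proof (cases "x = 0")
    case True
    have "\<forall>\<^sub>F r in at_right 0. F r = ?G r"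
      using eventually_at_right_less[of "0::real"] eventually_at_right_real[OF zero_less_one]
      by eventually_elim auto
    then have "(?G \<longlongrightarrow> 0) (at_right 0)"
      using lim by (simp add: tendsto_cong)
    then show ?thesis using True
      by (simp add: continuous_within at_within_Ici_at_right)
  next
    case False
    then have x: "x > 0" using that by auto
    have "continuous_on {0<..} (\<lambda>r. F (min r 1))"
      by (rule continuous_on_compose2[OF cont]) (auto intro!: continuous_intros)
    then have "continuous_on {0<..} ?G"
      by (rule continuous_on_eq) auto
    then have "isCont ?G x"
      using x by (simp add: continuous_on_eq_continuous_at)
    then show ?thesis by (rule continuous_at_imp_continuous_at_within)
  qed
  have cont': "continuous_on {0..} ?G"
    using c1 by (simp add: continuous_on_eq_continuous_within)
  have G0: "0 \<le> ?G r" if "r \<ge> 0" for r using that pos by auto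
  have mono': "mono_on {0..} ?G"
    by (rule mono_onI) (use pos in \<open>auto intro!: mono_onD[OF mono]\<close>)
  have concpos: "?G ((1 - t) * x + t * y) \<ge> (1 - t) * ?G x + t * ?G y"
    if "0 < t" "t < 1" "0 < x" "0 < y" for t x y
  proof -
    have p: "0 < (1 - t) * x + t * y" "0 < (1 - t) * min x 1 + t * min y 1"
      using that by (auto intro!: add_pos_pos)
    have l1: "(1 - t) * min x 1 + t * min y 1 \<le> (1 - t) * x + t * y"
      using that by (intro add_mono mult_left_mono) auto
    have l2: "(1 - t) * min x 1 + t * min y 1 \<le> (1 - t) * 1 + t * 1"
      using that by (intro add_mono mult_left_mono) auto
    have "(1 - t) * F (min x 1) + t * F (min y 1) \<le> F ((1 - t) * min x 1 + t * min y 1)"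
      using concave_onD[OF conc, of t "min x 1" "min y 1"] that by auto
    also have "\<dots> \<le> F (min ((1 - t) * x + t * y) 1)"
      by (rule mono_onD[OF mono]) (use p l1 l2 in auto)
    finally show ?thesis using that p by auto
  qed
  have "concave_on {0..} ?G"
  proof (rule concave_on_linorderI)
    fix t x y :: real
    assume *: "0 < t" "t < 1" "x \<in> {0..}" "y \<in> {0..}" "x < y"
    show "(1 - t) * ?G x + t * ?G y \<le> ?G ((1 - t) *\<^sub>R x + t *\<^sub>R y)"
    proof (cases "x = 0")
      case False
      then show ?thesis using concpos[of t x y] * by auto
    next
      case True
      have y: "0 < y" "0 < t * y" using * True by auto
      have "((\<lambda>e. ?G ((1 - t) * e + t * y)) \<longlongrightarrow> ?G (t * y)) (at_right 0)"
      proof (rule continuous_on_tendsto_compose[OF cont'])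
        have "((\<lambda>e. (1 - t) * e + t * y) \<longlongrightarrow> (1 - t) * 0 + t * y) (at_right 0)"
          by (intro tendsto_intros)
        then show "((\<lambda>e. (1 - t) * e + t * y) \<longlongrightarrow> t * y) (at_right 0)" by simp
        show "\<forall>\<^sub>F e in at_right 0. (1 - t) * e + t * y \<in> {0..}"
          using eventually_at_right_less[of "0::real"]
          by eventually_elim (use * y in auto)
      qed (use y in auto)
      moreover have "\<forall>\<^sub>F e in at_right 0. t * ?G y \<le> ?G ((1 - t) * e + t * y)"
        using eventually_at_right_less[of "0::real"]
      proof eventually_elim
        case (elim e)
        have "0 \<le> (1 - t) * ?G e" using G0[of e] elim * by (intro mult_nonneg_nonneg) auto
        then show ?case using concpos[of t e y] * y elim by linarith
      qed
      ultimately have "t * ?G y \<le> ?G (t * y)"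
        by (rule tendsto_lowerbound) simp
      then show ?thesis using True y * by simp
    qed
  qed simp
  with cont' mono' show ?thesis by (simp add: modulus_of_continuity_def)
qed

lemma log_modulus_exists:
  fixes \<alpha> \<beta> :: real
  assumes "0 < \<alpha> \<and> \<alpha> < 1 \<or> \<alpha> = 0 \<and> 0 < \<beta>"
  shows "\<exists>\<omega>. log_modulus \<alpha> \<beta> \<omega>"
proof -
  obtain M :: real where M: "M \<ge> 1"
    and M1: "\<And>L. L \<ge> M \<Longrightarrow> \<alpha> * L + \<beta> \<ge> 0"
    and M2: "\<And>L. L \<ge> M \<Longrightarrow> \<alpha> * (\<alpha> - 1) * L\<^sup>2 + \<beta> * (2 * \<alpha> - 1) * L + \<beta> * (\<beta> + 1) \<le> 0"
  proof (cases "\<alpha> = 0")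
    case True
    then have b: "\<beta> > 0" using assms by auto
    show thesis
    proof (rule that[of "\<beta> + 1"])
      fix L assume "L \<ge> \<beta> + 1"
      then have "\<beta> * (\<beta> + 1) \<le> \<beta> * L" using b by (intro mult_left_mono) auto
      then show "\<alpha> * (\<alpha> - 1) * L\<^sup>2 + \<beta> * (2 * \<alpha> - 1) * L + \<beta> * (\<beta> + 1) \<le> 0"
        using True by simp
    qed (use True b in auto)
  next
    case False
    then have a: "0 < \<alpha>" "\<alpha> < 1" using assms by auto
    define k where "k = \<alpha> * (1 - \<alpha>)"
    define K where "K = \<bar>\<beta>\<bar> + \<bar>\<beta> * (\<beta> + 1)\<bar>"
    have k: "0 < k" "k \<le> \<alpha>" using a by (auto simp: k_def mult_le_cancel_left1)
    have K: "0 \<le> K" "\<bar>\<beta>\<bar> \<le> K" by (auto simp: K_def)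
    show thesis
    proof (rule that[of "1 + K / k"])
      show "1 \<le> 1 + K / k" using k K by simp
      fix L assume L: "1 + K / k \<le> L"
      then have L1: "1 \<le> L" using k K by (smt (verit) divide_nonneg_pos)
      have "K / k \<le> L" using L by simp
      then have kL: "K \<le> k * L" using k by (simp add: field_simps)
      also have "\<dots> \<le> \<alpha> * L" using k L1 by (intro mult_right_mono) auto
      finally show "\<alpha> * L + \<beta> \<ge> 0" using K by linarith
      have "\<beta> * (2 * \<alpha> - 1) \<le> \<bar>\<beta>\<bar>"
      proof -
        have "\<beta> * (2 * \<alpha> - 1) \<le> \<bar>\<beta>\<bar> * \<bar>2 * \<alpha> - 1\<bar>" by (metis abs_ge_self abs_mult)
        also have "\<dots> \<le> \<bar>\<beta>\<bar> * 1" using a by (intro mult_left_mono) auto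
        finally show ?thesis by simp
      qed
      then have "\<beta> * (2 * \<alpha> - 1) * L \<le> \<bar>\<beta>\<bar> * L" using L1 by (intro mult_right_mono) auto
      moreover have "\<beta> * (\<beta> + 1) \<le> \<bar>\<beta> * (\<beta> + 1)\<bar> * L"
        using mult_left_mono[OF L1 abs_ge_zero[of "\<beta> * (\<beta> + 1)"]] by linarith
      moreover have "K * L \<le> k * L\<^sup>2"
        using mult_right_mono[OF kL, of L] L1 by (simp add: power2_eq_square mult.assoc)
      moreover have "K * L = \<bar>\<beta>\<bar> * L + \<bar>\<beta> * (\<beta> + 1)\<bar> * L"
        by (simp only: K_def distrib_right)
      moreover have "k * L\<^sup>2 = - (\<alpha> * (\<alpha> - 1) * L\<^sup>2)"
        by (simp add: k_def algebra_simps)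
      ultimately show "\<alpha> * (\<alpha> - 1) * L\<^sup>2 + \<beta> * (2 * \<alpha> - 1) * L + \<beta> * (\<beta> + 1) \<le> 0"
        by linarith
    qed
  qed
  define r0 where "r0 = exp M"
  define \<Lambda> where "\<Lambda> r = M - ln r" for r :: real
  have r0: "r0 > 1" using M by (simp add: r0_def)
  have ln_r0: "ln (r0 / r) = \<Lambda> r" if "r > 0" for r
    using that by (simp add: r0_def \<Lambda>_def ln_div)
  have \<Lambda>: "\<Lambda> r \<ge> M" "\<Lambda> r > 0" if "r \<in> {0<..1}" for r
  proof -
    have "ln r \<le> 0" using that by simp
    then show "\<Lambda> r \<ge> M" "\<Lambda> r > 0" using M by (auto simp: \<Lambda>_def)
  qed
  define F where "F r = r powr \<alpha> * \<Lambda> r powr (- \<beta>)" for r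
  define F' where "F' r = \<alpha> * (r powr (\<alpha> - 1) * \<Lambda> r powr (- \<beta>))
      + \<beta> * (r powr (\<alpha> - 1) * \<Lambda> r powr (- \<beta> - 1))" for r
  define F'' where "F'' r = r powr (\<alpha> - 2) * \<Lambda> r powr (- \<beta> - 2) *
      (\<alpha> * (\<alpha> - 1) * (\<Lambda> r)\<^sup>2 + \<beta> * (2 * \<alpha> - 1) * \<Lambda> r + \<beta> * (\<beta> + 1))" for r
  have D: "((\<lambda>r. r powr a * \<Lambda> r powr b) has_real_derivative
       a * (r powr (a - 1) * \<Lambda> r powr b) - b * (r powr (a - 1) * \<Lambda> r powr (b - 1))) (at r)"
    if "r \<in> {0<..1}" for a b r
  proof -
    have p: "r > 0" "M - ln r > 0" using that \<Lambda>(2)[OF that] by (auto simp: \<Lambda>_def)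
    have d1: "((\<lambda>r. r powr a) has_real_derivative a * r powr (a - 1)) (at r)"
      using has_real_derivative_powr[OF p(1)] by simp
    have "((\<lambda>r. M - ln r) has_real_derivative - (1 / r)) (at r)"
      using DERIV_diff[OF DERIV_const DERIV_ln_divide[OF p(1)], of M] by simp
    from DERIV_chain2[OF has_real_derivative_powr[OF p(2)] this]
    have d2: "((\<lambda>r. (M - ln r) powr b) has_real_derivative
        b * (M - ln r) powr (b - 1) * - (1 / r)) (at r)" .
    have "r powr (a - 1) = r powr a / r" using p by (simp add: powr_diff)
    then show ?thesis unfolding \<Lambda>_def
      using DERIV_mult[OF d1 d2] by (simp add: mult_ac)
  qed
  have D1: "(F has_real_derivative F' r) (at r)" if "r \<in> {0<..1}" for r
    using D[OF that, of \<alpha> "- \<beta>"] by (simp add: F_def[abs_def] F'_def)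
  have D2: "(F' has_real_derivative F'' r) (at r)" if "r \<in> {0<..1}" for r
  proof -
    have p: "r > 0" "\<Lambda> r > 0" using that \<Lambda>(2)[OF that] by auto
    define u where "u = r powr (\<alpha> - 2)"
    define v where "v = \<Lambda> r powr (- \<beta> - 2)"
    have v: "\<Lambda> r powr (- \<beta>) = v * (\<Lambda> r)\<^sup>2" "\<Lambda> r powr (- \<beta> - 1) = v * \<Lambda> r"
      "\<Lambda> r powr (- 2 - \<beta>) = v"
      using p by (simp_all add: v_def powr_diff powr_minus power2_eq_square field_simps)
    have "(F' has_real_derivative
        \<alpha> * ((\<alpha> - 1) * (u * (v * (\<Lambda> r)\<^sup>2)) - (- \<beta>) * (u * (v * \<Lambda> r)))
      + \<beta> * ((\<alpha> - 1) * (u * (v * \<Lambda> r)) - (- \<beta> - 1) * (u * v))) (at r)"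
      using DERIV_add[OF DERIV_cmult[OF D[OF that, of "\<alpha> - 1" "- \<beta>"], of \<alpha>]
          DERIV_cmult[OF D[OF that, of "\<alpha> - 1" "- \<beta> - 1"], of \<beta>]]
      by (simp add: F'_def[abs_def] u_def v)
    then show ?thesis
      by (rule DERIV_cong) (simp add: F''_def flip: u_def v_def, algebra)
  qed
  have F_nonneg: "0 \<le> F r" for r
    by (simp add: F_def)
  have "mono_on {0<..1} F"
  proof (rule mono_onI)
    fix r s :: real assume rs: "r \<in> {0<..1}" "s \<in> {0<..1}" "r \<le> s"
    show "F r \<le> F s"
    proof (rule DERIV_nonneg_imp_nondecreasing[OF rs(3)])
      fix x assume "r \<le> x" "x \<le> s"
      then have x: "x \<in> {0<..1}" using rs by auto
      have "F' x = x powr (\<alpha> - 1) * \<Lambda> x powr (- \<beta> - 1) * (\<alpha> * \<Lambda> x + \<beta>)"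
        using \<Lambda>(2)[OF x] x by (simp add: F'_def powr_diff field_simps)
      then have "F' x \<ge> 0" using M1[OF \<Lambda>(1)[OF x]] by simp
      then show "\<exists>y. (F has_real_derivative y) (at x) \<and> 0 \<le> y" using D1[OF x] by blast
    qed
  qed
  moreover have "concave_on {0<..1} F"
    by (rule f''_le0_imp_concave[OF _ D1 D2])
       (use M2 \<Lambda>(1) in \<open>auto simp: F''_def intro!: mult_nonneg_nonpos\<close>)
  moreover have "continuous_on {0<..1} F"
    using D1 by (meson DERIV_isCont continuous_at_imp_continuous_on)
  moreover have "(F \<longlongrightarrow> 0) (at_right 0)"
  proof (cases "\<alpha> = 0")
    case True
    then have "\<beta> > 0" using assms by auto
    then have "((\<lambda>r::real. (M - ln r) powr (- \<beta>)) \<longlongrightarrow> 0) (at_right 0)" by real_asymp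
    then show ?thesis
    proof (rule Lim_transform_eventually)
      show "\<forall>\<^sub>F r in at_right 0. (M - ln r) powr (- \<beta>) = F r"
        using eventually_at_right_less[of "0::real"]
        by eventually_elim (simp add: F_def \<Lambda>_def True)
    qed
  next
    case False
    then have "\<alpha> > 0" using assms by auto
    then show ?thesis unfolding F_def[abs_def] \<Lambda>_def[abs_def] by real_asymp
  qed
  ultimately have "modulus_of_continuity (\<lambda>r. if r = 0 then 0 else F (min r 1))"
    by (intro modulus_of_continuity_extend F_nonneg)
  then have "log_modulus \<alpha> \<beta> (\<lambda>r. if r = 0 then 0 else F (min r 1))"
    unfolding log_modulus_def using r0
    by (auto simp: F_def ln_r0 powr_minus_divide intro!: exI[of _ r0])
  then show ?thesis by blast
qed

end

theory Submission
  imports Defs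
begin

text \<open>
  Write \<open>V\<close> for the modulus \<open>\<omega>'\<close> and read functions on the circle as functions on \<open>[0,1]\<close>. The two
  inverse branches contract \<open>\<bar>x - y\<bar>\<close> at least as much as the neutral branch contracts it towards
  \<open>0\<close>; telescoping \<open>V\<close> along such a backward orbit bounds the variation of Birkhoff sums of \<open>A\<close>
  by a multiple of \<open>V \<bar>x - y\<bar>\<close>. Hence the weights of paired inverse branches of \<open>T\<^sup>n\<close> at \<open>x\<close> and
  \<open>y\<close> are comparable with ratio \<open>exp (O(V \<bar>x - y\<bar>))\<close>, uniformly in \<open>n\<close>, and the positive
  functions whose logarithm is suitably \<open>V\<close>-Hoelder are preserved by the transfer operator \<open>L\<close>.

  For such \<open>u\<close>, the average \<open>L\<^sup>n (u f) / L\<^sup>n u\<close> is a Markov average of \<open>f\<close> over backward orbits.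
  Pairing the orbits of two points, the uniformly expanding branch is chosen with probability
  bounded below, so the mean distance decays like \<open>\<gamma>\<^sup>m\<close>, and by concavity the mean of \<open>V\<close> is at
  most \<open>V (\<gamma>\<^sup>m) = O(m powr (1 - \<beta>))\<close>. This gives polynomial decay of the oscillation of these averages.
  With \<open>u = 1\<close> one obtains \<open>\<nu>\<close> and \<open>h\<close> as limits; with \<open>u = h\<close> one obtains the decay of correlations.
\<close>

subsection \<open>Two-branch transfer operators on the unit interval\<close>

text \<open>The loss of one logarithmic power, from \<open>\<beta>\<close> to
  \<open>\<beta> - 1\<close>, is the price of neutrality. A backward step that leaves a gap
  \<open>d\<close> starts from a gap of at least \<open>expand q d\<close>, which exceeds
  \<open>d\<close> by \<open>d * (2 * d) powr q\<close>. Over this displacement \<open>V\<close>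
  grows by at least a constant times \<open>d powr (1 + q)\<close> times the slope of
  \<open>V\<close> near \<open>d\<close>, and that slope is of order one over \<open>d\<close> times
  the logarithm to the power \<open>\<beta>\<close>. The gain is therefore comparable to the modulus
  of \<open>A\<close> at \<open>d\<close>. Hence the form of the assumption \<open>flat\<close>: the
  variation of the potential over one step is bounded by a difference of values of \<open>V\<close>,
  and such differences sum along an orbit to at most \<open>V\<close> of the initial gap. The
  analysis is done on the closed interval, where each inverse branch is globally defined and pairing
  orbits by branch is unambiguous. The seam of the circle is harmless because the branches at
  \<open>1\<close> and at \<open>0\<close> give the same two circle points, in exchanged
  order.\<close>

locale two_branches =
  fixes br :: "bool \<Rightarrow> real \<Rightarrow> real" and a V :: "real \<Rightarrow> real" and C B :: real
  assumes br_in: "x \<in> {0..1} \<Longrightarrow> br i x \<in> {0..1}"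
    and br_False: "x \<in> {0..1} \<Longrightarrow> y \<in> {0..1} \<Longrightarrow> \<bar>br False x - br False y\<bar> \<le> \<bar>x - y\<bar>"
    and br_True: "x \<in> {0..1} \<Longrightarrow> y \<in> {0..1} \<Longrightarrow> \<bar>br True x - br True y\<bar> \<le> \<bar>x - y\<bar> / 2"
    and C_nonneg: "0 \<le> C"
    and flat: "x \<in> {0..1} \<Longrightarrow> y \<in> {0..1} \<Longrightarrow>
      \<bar>a (br i x) - a (br i y)\<bar> \<le> C * (V (\<bar>x - y\<bar>) - V (\<bar>br i x - br i y\<bar>))"
    and a_bound: "x \<in> {0..1} \<Longrightarrow> \<bar>a x\<bar> \<le> B"
    and V_concave: "concave_on {0..} V"
    and V_mono: "mono_on {0..} V"
    and V_0: "V 0 = 0"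
begin

definition L :: "(real \<Rightarrow> real) \<Rightarrow> real \<Rightarrow> real" where
  "L F x = (\<Sum>i\<in>UNIV. exp (a (br i x)) * F (br i x))"

text \<open>The first point carries the weights, the second one follows it along the same branches.\<close>

definition LL :: "(real \<Rightarrow> real \<Rightarrow> real) \<Rightarrow> real \<Rightarrow> real \<Rightarrow> real" where
  "LL \<Phi> x y = (\<Sum>i\<in>UNIV. exp (a (br i x)) * \<Phi> (br i x) (br i y))"

text \<open>The cone constant is the very \<open>C\<close> of \<open>flat\<close>; the difference
  form of \<open>flat\<close> then makes the cone invariant under \<open>L\<close> with no loss, for
  any number of iterations.\<close>

definition admissible :: "(real \<Rightarrow> real) \<Rightarrow> bool" where
  "admissible u \<longleftrightarrow> (\<forall>x\<in>{0..1}. 0 < u x) \<and>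
     (\<forall>x\<in>{0..1}. \<forall>y\<in>{0..1}. u x \<le> exp (C * V \<bar>x - y\<bar>) * u y)"

lemma V_le: "0 \<le> r \<Longrightarrow> r \<le> s \<Longrightarrow> V r \<le> V s"
  using V_mono by (auto simp: mono_on_def)

lemma V_nonneg: "0 \<le> r \<Longrightarrow> 0 \<le> V r"
  using V_le[of 0 r] V_0 by simp

lemma V_le_1: "x \<in> {0..1} \<Longrightarrow> y \<in> {0..1} \<Longrightarrow> V \<bar>x - y\<bar> \<le> V 1"
  by (rule V_le) auto

lemma br_dist: "x \<in> {0..1} \<Longrightarrow> y \<in> {0..1} \<Longrightarrow> \<bar>br i x - br i y\<bar> \<le> \<bar>x - y\<bar>"
  using order_trans[OF br_True[of x y], of "\<bar>x - y\<bar>"] br_False[of x y] by (cases i) simp_all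

text \<open>\<open>flat\<close> exponentiated. A factor at the base points pays for exchanging the
  weights and leaves a factor of the same kind at the preimages, which is what lets the estimate be
  iterated.\<close>

lemma weight_le:
  assumes "x \<in> {0..1}" "y \<in> {0..1}"
  shows "exp (- (C * V \<bar>x - y\<bar>)) * exp (a (br i x))
    \<le> exp (a (br i y)) * exp (- (C * V \<bar>br i x - br i y\<bar>))"
  using flat[OF assms, of i] by (simp add: algebra_simps flip: exp_add)

lemma L_mono:
  assumes "\<And>x. x \<in> {0..1} \<Longrightarrow> F x \<le> G x" "x \<in> {0..1}"
  shows "(L ^^ n) F x \<le> (L ^^ n) G x"
  using assms(2)
proof (induction n arbitrary: x)
  case (Suc n)
  then show ?case
    by (auto simp: L_def intro!: sum_mono mult_left_mono Suc.IH br_in[simplified])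
qed (use assms in auto)

lemma L_cong:
  assumes "\<And>x. x \<in> {0..1} \<Longrightarrow> F x = G x" "x \<in> {0..1}"
  shows "(L ^^ n) F x = (L ^^ n) G x"
  using assms by (intro antisym L_mono) auto

lemma L_scale: "(L ^^ n) (\<lambda>x. c * F x) x = c * (L ^^ n) F x"
  by (induction n arbitrary: x) (auto simp: L_def sum_distrib_left mult_ac)

lemma L_diff: "(L ^^ n) (\<lambda>x. F x - G x) x = (L ^^ n) F x - (L ^^ n) G x"
  by (induction n arbitrary: x) (auto simp: L_def sum_subtractf right_diff_distrib)

lemma LL_mono:
  assumes "\<And>x y. x \<in> {0..1} \<Longrightarrow> y \<in> {0..1} \<Longrightarrow> \<Phi> x y \<le> \<Psi> x y" "x \<in> {0..1}" "y \<in> {0..1}"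
  shows "(LL ^^ n) \<Phi> x y \<le> (LL ^^ n) \<Psi> x y"
  using assms(2,3)
proof (induction n arbitrary: x y)
  case (Suc n)
  then show ?case
    by (auto simp: LL_def intro!: sum_mono mult_left_mono Suc.IH br_in[simplified])
qed (use assms in auto)

lemma LL_fst: "(LL ^^ n) (\<lambda>x y. F x) x y = (L ^^ n) F x"
  by (induction n arbitrary: x y) (auto simp: L_def LL_def)

lemma LL_scale: "(LL ^^ n) (\<lambda>x y. c * \<Phi> x y) x y = c * (LL ^^ n) \<Phi> x y"
  by (induction n arbitrary: x y) (auto simp: LL_def sum_distrib_left mult_ac)

lemma LL_diff: "(LL ^^ n) (\<lambda>x y. \<Phi> x y - \<Psi> x y) x y = (LL ^^ n) \<Phi> x y - (LL ^^ n) \<Psi> x y"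
  by (induction n arbitrary: x y) (auto simp: LL_def sum_subtractf right_diff_distrib)

lemma admissible_const: "0 < c \<Longrightarrow> admissible (\<lambda>_. c)"
  using C_nonneg V_nonneg by (auto simp: admissible_def)

text \<open>The factor that \<open>weight_le\<close> leaves at the preimages is the inverse of the
  one allowed by admissibility of \<open>u\<close>, so the two cancel branch by branch.\<close>

lemma admissible_step:
  assumes "admissible u"
  shows "admissible (L u)"
  unfolding admissible_def
proof (intro conjI ballI)
  have pos: "0 < u x" if "x \<in> {0..1}" for x
    using assms that by (auto simp: admissible_def)
  show "0 < L u x" if "x \<in> {0..1}" for x
    unfolding L_def by (intro sum_pos mult_pos_pos pos br_in that) auto
  fix x y :: real assume xy: "x \<in> {0..1}" "y \<in> {0..1}"
  have "exp (- (C * V \<bar>x - y\<bar>)) * L u x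
      = (\<Sum>i\<in>UNIV. exp (- (C * V \<bar>x - y\<bar>)) * exp (a (br i x)) * u (br i x))"
    by (simp add: L_def sum_distrib_left mult_ac)
  also have "\<dots> \<le> (\<Sum>i\<in>UNIV. exp (a (br i y)) * u (br i y))"
  proof (rule sum_mono)
    fix i :: bool
    let ?d = "\<bar>br i x - br i y\<bar>"
    have "exp (- (C * V \<bar>x - y\<bar>)) * exp (a (br i x)) * u (br i x)
        \<le> exp (a (br i y)) * exp (- (C * V ?d)) * u (br i x)"
      using weight_le[OF xy, of i] pos[OF br_in[OF xy(1)], of i] by (intro mult_right_mono) auto
    also have "\<dots> \<le> exp (a (br i y)) * exp (- (C * V ?d)) * (exp (C * V ?d) * u (br i y))"
      using assms br_in[OF xy(1), of i] br_in[OF xy(2), of i]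
      by (intro mult_left_mono) (auto simp: admissible_def)
    also have "\<dots> = exp (a (br i y)) * u (br i y)"
      by (simp add: exp_minus)
    finally show "exp (- (C * V \<bar>x - y\<bar>)) * exp (a (br i x)) * u (br i x)
      \<le> exp (a (br i y)) * u (br i y)" .
  qed
  finally have "exp (- (C * V \<bar>x - y\<bar>)) * L u x \<le> L u y" by (simp add: L_def)
  then show "L u x \<le> exp (C * V \<bar>x - y\<bar>) * L u y"
    by (simp add: exp_minus field_simps)
qed

lemma admissible_L: "admissible u \<Longrightarrow> admissible ((L ^^ n) u)"
  by (induction n) (auto intro: admissible_step)

lemma admissible_pos: "admissible u \<Longrightarrow> x \<in> {0..1} \<Longrightarrow> 0 < u x"
  by (auto simp: admissible_def)

lemma admissible_le:
  "admissible u \<Longrightarrow> x \<in> {0..1} \<Longrightarrow> y \<in> {0..1} \<Longrightarrow> u x \<le> exp (C * V \<bar>x - y\<bar>) * u y"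
  by (auto simp: admissible_def)

text \<open>Bounds a true average at \<open>y\<close> from below by one whose weights are those at
  \<open>x\<close>. The factor inside the paired function is what remains after \<open>n\<close>
  uses of \<open>weight_le\<close>; the total cost does not grow with \<open>n\<close>.\<close>

lemma LL_le_L:
  assumes F: "\<And>x. x \<in> {0..1} \<Longrightarrow> 0 \<le> F x" and "x \<in> {0..1}" "y \<in> {0..1}"
  shows "exp (- (C * V \<bar>x - y\<bar>)) * (LL ^^ n) (\<lambda>x y. exp (C * V \<bar>x - y\<bar>) * F y) x y \<le> (L ^^ n) F y"
  using assms(2,3)
proof (induction n arbitrary: x y)
  case 0
  then show ?case by (simp add: mult.assoc[symmetric] flip: exp_add)
next
  case (Suc n)
  let ?\<Phi> = "(LL ^^ n) (\<lambda>x y. exp (C * V \<bar>x - y\<bar>) * F y)"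
  have "exp (- (C * V \<bar>x - y\<bar>)) * LL ?\<Phi> x y
      = (\<Sum>i\<in>UNIV. exp (- (C * V \<bar>x - y\<bar>)) * exp (a (br i x)) * ?\<Phi> (br i x) (br i y))"
    by (simp add: LL_def sum_distrib_left mult_ac)
  also have "\<dots> \<le> (\<Sum>i\<in>UNIV. exp (a (br i y)) * (L ^^ n) F (br i y))"
  proof (rule sum_mono)
    fix i :: bool
    let ?d = "\<bar>br i x - br i y\<bar>"
    have b: "br i x \<in> {0..1}" "br i y \<in> {0..1}" using Suc.prems br_in by auto
    \<comment> \<open>The zero function is written as a product so that \<open>LL_scale\<close>
      extracts the factor \<open>0\<close>.\<close>
    have "(LL ^^ n) (\<lambda>x y. 0 * 0) (br i x) (br i y) \<le> ?\<Phi> (br i x) (br i y)"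
      using b F by (intro LL_mono) auto
    then have "0 \<le> ?\<Phi> (br i x) (br i y)" unfolding LL_scale by simp
    then have "exp (- (C * V \<bar>x - y\<bar>)) * exp (a (br i x)) * ?\<Phi> (br i x) (br i y)
        \<le> exp (a (br i y)) * exp (- (C * V ?d)) * ?\<Phi> (br i x) (br i y)"
      using weight_le[OF Suc.prems, of i] by (intro mult_right_mono) auto
    also have "\<dots> \<le> exp (a (br i y)) * (L ^^ n) F (br i y)"
      using Suc.IH[OF b] by (simp add: mult.assoc)
    finally show "exp (- (C * V \<bar>x - y\<bar>)) * exp (a (br i x)) * ?\<Phi> (br i x) (br i y)
        \<le> exp (a (br i y)) * (L ^^ n) F (br i y)" .
  qed
  finally show ?case by (simp add: L_def[of "(L ^^ n) F"])
qed

section \<open>Mean contraction along paired backward orbits\<close>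

text \<open>If the halving branch has probability at least \<open>p\<close>, the mean distance is
  multiplied by at most \<open>1 - p / 2\<close> per step. Here
  \<open>p = 1 / (1 + exp (2 * B + C * V 1))\<close>: the weights of the two branches differ at most
  by the factor \<open>exp (2 * B)\<close>, and an admissible function at the two preimages by
  \<open>exp (C * V 1)\<close>.\<close>

definition \<gamma> :: real where "\<gamma> = 1 - 1 / (2 * (1 + exp (2 * B + C * V 1)))"

lemma \<gamma>: "1/2 < \<gamma>" "\<gamma> < 1"
proof -
  define E where "E = exp (2 * B + C * V 1)"
  have "0 < E" by (simp add: E_def)
  then show "1/2 < \<gamma>" "\<gamma> < 1" unfolding \<gamma>_def E_def[symmetric] by (simp_all add: field_simps)
qed

lemma V_Jensen:
  assumes "0 < w" "0 < w'" "0 \<le> s" "0 \<le> s'"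
  shows "w * V s + w' * V s' \<le> (w + w') * V ((w * s + w' * s') / (w + w'))"
proof -
  have "(1 - w' / (w + w')) * V s + w' / (w + w') * V s'
     \<le> V ((1 - w' / (w + w')) *\<^sub>R s + (w' / (w + w')) *\<^sub>R s')"
    using assms by (intro concave_onD[OF V_concave]) (auto simp: field_simps)
  also have 1: "1 - w' / (w + w') = w / (w + w')" using assms by (simp add: field_simps)
  also have "(w / (w + w')) *\<^sub>R s + (w' / (w + w')) *\<^sub>R s' = (w * s + w' * s') / (w + w')"
    by (simp add: add_divide_distrib)
  finally have "(w * V s + w' * V s') / (w + w') \<le> V ((w * s + w' * s') / (w + w'))"
    by (simp add: add_divide_distrib)
  then show ?thesis using assms by (simp add: field_simps)
qed

text \<open>The branch \<open>True\<close> halves distances and is taken with probability bounded below, so that the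
  expected distance decays exponentially; concavity transfers this to \<open>V\<close>.\<close>

lemma LL_V_le:
  assumes u: "admissible u" and "x \<in> {0..1}" "y \<in> {0..1}"
  shows "(LL ^^ n) (\<lambda>x y. u x * V \<bar>x - y\<bar>) x y \<le> (L ^^ n) u x * V (\<gamma> ^ n * \<bar>x - y\<bar>)"
  using assms(2,3)
proof (induction n arbitrary: x y)
  case (Suc n)
  define v where "v = (L ^^ n) u"
  define w where "w i = exp (a (br i x)) * v (br i x)" for i
  define s where "s i = \<bar>br i x - br i y\<bar>" for i
  have b: "br i x \<in> {0..1}" "br i y \<in> {0..1}" for i using Suc.prems br_in by auto
  have v: "admissible v" unfolding v_def by (intro admissible_L u)
  have w: "0 < w i" for i using admissible_pos[OF v b(1)] by (simp add: w_def)
  have s: "0 \<le> s i" for i by (simp add: s_def)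
  have sT: "s True \<le> \<bar>x - y\<bar> / 2" and sF: "s False \<le> \<bar>x - y\<bar>"
    using br_True br_False Suc.prems by (auto simp: s_def)
  have W: "L v x = w True + w False" by (simp add: L_def w_def UNIV_bool add.commute)
  have g: "0 \<le> \<gamma> ^ n" using \<gamma> by simp
  \<comment> \<open>The odds are bounded uniformly in \<open>n\<close>, because the iterate
    \<open>v\<close> is admissible with the same constant.\<close>
  have "w False \<le> exp (2 * B + C * V 1) * w True"
  proof -
    have "v (br False x) \<le> exp (C * V \<bar>br False x - br True x\<bar>) * v (br True x)"
      by (intro admissible_le v b)
    also have "\<dots> \<le> exp (C * V 1) * v (br True x)"
      using V_le_1[OF b(1) b(1), of False True] admissible_pos[OF v b(1)[of True]] C_nonneg
      by (intro mult_right_mono) (auto intro: mult_left_mono)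
    finally have 1: "v (br False x) \<le> exp (C * V 1) * v (br True x)" .
    have 2: "exp (a (br False x)) \<le> exp (2 * B) * exp (a (br True x))"
      using a_bound[OF b(1)[of True]] a_bound[OF b(1)[of False]] by (simp flip: exp_add)
    have "w False \<le> (exp (2 * B) * exp (a (br True x))) * (exp (C * V 1) * v (br True x))"
      unfolding w_def using 1 2 admissible_pos[OF v b(1)] by (intro mult_mono) (auto simp: less_imp_le)
    also have "\<dots> = exp (2 * B + C * V 1) * w True" by (simp add: w_def exp_add)
    finally show ?thesis .
  qed
  then have "w True + w False \<le> (1 + exp (2 * B + C * V 1)) * w True"
    by (simp add: algebra_simps)
  moreover have "0 < 1 + exp (2 * B + C * V 1)" by (simp add: add_pos_pos)
  ultimately have "(1 - \<gamma>) * (w True + w False) \<le> w True / 2"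
    by (simp add: \<gamma>_def field_simps)
  then have "w True / 2 + w False \<le> \<gamma> * (w True + w False)" by (simp add: algebra_simps)
  then have "(w True / 2 + w False) * \<bar>x - y\<bar> \<le> \<gamma> * (w True + w False) * \<bar>x - y\<bar>"
    by (intro mult_right_mono) auto
  moreover have "w True * s True + w False * s False \<le> w True * (\<bar>x - y\<bar> / 2) + w False * \<bar>x - y\<bar>"
    using w sT sF by (intro add_mono mult_left_mono) (auto simp: less_imp_le)
  ultimately have "w True * s True + w False * s False \<le> \<gamma> * (w True + w False) * \<bar>x - y\<bar>"
    by (simp add: algebra_simps)
  then have "\<gamma> ^ n * (w True * s True + w False * s False) \<le> \<gamma> ^ n * (\<gamma> * (w True + w False) * \<bar>x - y\<bar>)"
    using g by (intro mult_left_mono)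
  \<comment> \<open>The induction hypothesis has put the contraction of the other \<open>n\<close>
    steps inside \<open>V\<close>; the mean over the current branch adds one more factor
    \<open>\<gamma>\<close>.\<close>
  then have le: "(w True * (\<gamma> ^ n * s True) + w False * (\<gamma> ^ n * s False)) / (w True + w False)
      \<le> \<gamma> ^ Suc n * \<bar>x - y\<bar>"
    using w[of True] w[of False] by (simp add: divide_le_eq algebra_simps add_pos_pos)
  have "(LL ^^ Suc n) (\<lambda>x y. u x * V \<bar>x - y\<bar>) x y
    = (\<Sum>i\<in>UNIV. exp (a (br i x)) * (LL ^^ n) (\<lambda>x y. u x * V \<bar>x - y\<bar>) (br i x) (br i y))"
    by (simp add: LL_def)
  also have "\<dots> \<le> (\<Sum>i\<in>UNIV. exp (a (br i x)) * (v (br i x) * V (\<gamma> ^ n * s i)))"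
    unfolding v_def s_def using b by (intro sum_mono mult_left_mono Suc.IH) auto
  also have "\<dots> = w True * V (\<gamma> ^ n * s True) + w False * V (\<gamma> ^ n * s False)"
    by (simp add: UNIV_bool w_def mult.assoc)
  also have "\<dots> \<le> (w True + w False) *
      V ((w True * (\<gamma> ^ n * s True) + w False * (\<gamma> ^ n * s False)) / (w True + w False))"
    using w s g by (intro V_Jensen) auto
  also have "\<dots> \<le> (w True + w False) * V (\<gamma> ^ Suc n * \<bar>x - y\<bar>)"
    using w[of True] w[of False] s g le
    by (intro mult_left_mono V_le) (auto intro!: divide_nonneg_nonneg add_nonneg_nonneg mult_nonneg_nonneg simp: less_imp_le)
  finally show ?case using W by (simp add: v_def)
qed auto

text \<open>Pairing compares \<open>P y\<close> with the average of \<open>G\<close> at the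
  follower's position. Exchanging weights costs one exponential factor in the numerator and one in
  the denominator, whence \<open>2 * C\<close>; the loss is charged to \<open>M\<close>. The
  difference of \<open>G\<close> along paired orbits is averaged by \<open>LL_V_le\<close>. The
  bound is one-sided; exchanging the points gives the other side.\<close>

lemma normalized_diff_le:
  assumes u: "admissible u"
    and G: "\<And>x. x \<in> {0..1} \<Longrightarrow> 0 \<le> G x" "\<And>x. x \<in> {0..1} \<Longrightarrow> G x \<le> M"
    and H: "\<And>x y. x \<in> {0..1} \<Longrightarrow> y \<in> {0..1} \<Longrightarrow> \<bar>G x - G y\<bar> \<le> H * V \<bar>x - y\<bar>"
    and H0: "0 \<le> H"
    and xy: "x \<in> {0..1}" "y \<in> {0..1}"
  fixes n :: nat
  defines "P \<equiv> \<lambda>x. (L ^^ n) (\<lambda>x. u x * G x) x / (L ^^ n) u x"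
  shows "P x - P y \<le> (1 - exp (- (2 * C * V \<bar>x - y\<bar>))) * M + H * V (\<gamma> ^ n * \<bar>x - y\<bar>)"
proof -
  define E where "E = exp (- (C * V \<bar>x - y\<bar>))"
  have up: "0 < u x" if "x \<in> {0..1}" for x using admissible_pos[OF u that] .
  have pos: "0 < (L ^^ n) u x" "0 < (L ^^ n) u y"
    using admissible_pos[OF admissible_L[OF u]] xy by auto
  have E: "0 < E" "E \<le> 1" using C_nonneg V_nonneg by (auto simp: E_def)
  let ?Q = "(LL ^^ n) (\<lambda>x y. u x * G y) x y"
  \<comment> \<open>Admissibility moves \<open>u\<close> from the leading point to the follower; the
    factor this costs is exactly the one built into \<open>LL_le_L\<close>.\<close>
  have "E * ?Q \<le> E * (LL ^^ n) (\<lambda>x y. exp (C * V \<bar>x - y\<bar>) * (u y * G y)) x y"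
    using E xy admissible_le[OF u] G
    by (intro mult_left_mono LL_mono) (auto simp: mult.assoc[symmetric] intro!: mult_right_mono)
  also have "\<dots> \<le> (L ^^ n) (\<lambda>x. u x * G x) y"
    unfolding E_def by (rule LL_le_L) (use xy G up in \<open>auto simp: less_imp_le\<close>)
  finally have 1: "E * ?Q \<le> (L ^^ n) (\<lambda>x. u x * G x) y" .
  have "(L ^^ n) (\<lambda>x. u x * G x) x - ?Q = (LL ^^ n) (\<lambda>x y. u x * G x - u x * G y) x y"
    by (simp add: LL_diff LL_fst)
  also have "\<dots> \<le> (LL ^^ n) (\<lambda>x y. H * (u x * V \<bar>x - y\<bar>)) x y"
  proof (rule LL_mono)
    fix x y :: real assume *: "x \<in> {0..1}" "y \<in> {0..1}"
    have "u x * (G x - G y) \<le> u x * (H * V \<bar>x - y\<bar>)"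
      using up[of x] H[of x y] * by (intro mult_left_mono) auto
    then show "u x * G x - u x * G y \<le> H * (u x * V \<bar>x - y\<bar>)" by (simp add: algebra_simps)
  qed (use xy in auto)
  also have "\<dots> \<le> H * ((L ^^ n) u x * V (\<gamma> ^ n * \<bar>x - y\<bar>))"
    unfolding LL_scale using LL_V_le[OF u xy] H0 by (intro mult_left_mono)
  finally have 2: "(L ^^ n) (\<lambda>x. u x * G x) x - H * ((L ^^ n) u x * V (\<gamma> ^ n * \<bar>x - y\<bar>)) \<le> ?Q"
    by simp
  have 2: "P x - H * V (\<gamma> ^ n * \<bar>x - y\<bar>) \<le> ?Q / (L ^^ n) u x"
    using divide_right_mono[OF 2, of "(L ^^ n) u x"] pos by (simp add: P_def diff_divide_distrib)
  have "(LL ^^ n) (\<lambda>x y. 0 * 0) x y \<le> ?Q"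
    using xy up G by (intro LL_mono) (auto simp: less_imp_le)
  then have Q0: "0 \<le> ?Q" by (simp only: LL_scale)
  have "(L ^^ n) u y \<le> exp (C * V \<bar>y - x\<bar>) * (L ^^ n) u x"
    by (intro admissible_le admissible_L u xy)
  then have 3: "E * (L ^^ n) u y \<le> (L ^^ n) u x"
    by (simp add: E_def exp_minus field_simps abs_minus_commute)
  have "E * E * (?Q / (L ^^ n) u x) \<le> E * ?Q / (L ^^ n) u y"
    using mult_right_mono[OF 3, of "E * ?Q"] pos E Q0 by (simp add: field_simps)
  also have "\<dots> \<le> P y" unfolding P_def using 1 pos by (intro divide_right_mono) auto
  finally have 4: "E * E * (?Q / (L ^^ n) u x) \<le> P y" .
  have "E * E * (P x - H * V (\<gamma> ^ n * \<bar>x - y\<bar>)) \<le> P y"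
    using mult_left_mono[OF 2, of "E * E"] 4 E by auto
  then have "P x - P y \<le> (1 - E * E) * P x + E * E * (H * V (\<gamma> ^ n * \<bar>x - y\<bar>))"
    by (simp add: algebra_simps)
  also have "\<dots> \<le> (1 - E * E) * M + 1 * (H * V (\<gamma> ^ n * \<bar>x - y\<bar>))"
  proof (intro add_mono mult_left_mono mult_right_mono)
    have "(L ^^ n) (\<lambda>x. u x * G x) x \<le> (L ^^ n) (\<lambda>x. M * u x) x"
      using xy up G by (intro L_mono) (auto simp: less_imp_le mult.commute[of M] intro!: mult_left_mono)
    then show "P x \<le> M" unfolding L_scale P_def using pos by (simp add: divide_le_eq)
    show "E * E \<le> 1" using E by (simp add: mult_le_one)
    then show "0 \<le> 1 - E * E" by simp
    show "0 \<le> H * V (\<gamma> ^ n * \<bar>x - y\<bar>)" using H0 \<gamma> V_nonneg by simp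
  qed
  also have "E * E = exp (- (2 * C * V \<bar>x - y\<bar>))" by (simp add: E_def flip: exp_add)
  finally show ?thesis by simp
qed

end

subsection \<open>Polynomial decay of oscillation\<close>

text \<open>\<open>P n M\<close> stands for: the oscillation at time \<open>n\<close> is at most
  \<open>M\<close>. Quantifying over \<open>P\<close> after \<open>c\<close> makes the constant the
  same for all functions to which the recursion is applied.\<close>

lemma poly_decay_recursion:
  fixes \<theta> K M0 s :: real
  assumes \<theta>: "0 \<le> \<theta>" "\<theta> < 1" and s: "0 < s" and K: "0 \<le> K" and M0: "0 \<le> M0"
  obtains c where "0 \<le> c"
    "\<And>P n. (\<And>n. P n M0) \<Longrightarrow> (\<And>n M M'. P n M \<Longrightarrow> M \<le> M' \<Longrightarrow> P n M') \<Longrightarrow>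
       (\<And>n m M. P n M \<Longrightarrow> 0 \<le> M \<Longrightarrow> 1 \<le> m \<Longrightarrow> P (n + m) (\<theta> * M + K / real m powr s)) \<Longrightarrow>
       1 \<le> n \<Longrightarrow> P n (c / real n powr s)"
proof -
  \<comment> \<open>\<open>e\<close> is taken so small that replacing \<open>n\<close> by
    \<open>(1 - 2 * e) * n\<close> spoils the power of \<open>n\<close> by less than the room
    between \<open>\<theta>\<close> and \<open>(1 + \<theta>) / 2\<close>.\<close>
  have "((\<lambda>e. (1 + \<theta>) / 2 * (1 - 2 * e) powr s) \<longlongrightarrow> (1 + \<theta>) / 2 * (1 - 2 * 0) powr s) (at_right 0)"
    by (intro tendsto_intros) auto
  moreover have "\<theta> < (1 + \<theta>) / 2 * (1 - 2 * 0) powr s" using \<theta> by simp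
  ultimately have "\<forall>\<^sub>F e in at_right 0. \<theta> < (1 + \<theta>) / 2 * (1 - 2 * e) powr s"
    by (rule order_tendstoD)
  moreover have "\<forall>\<^sub>F e in at_right (0::real). 0 < e \<and> e < 1 / 2"
    by (rule eventually_mono[OF eventually_at_right_real[of 0 "1/2::real"]]) auto
  ultimately have "\<forall>\<^sub>F e in at_right 0. \<theta> < (1 + \<theta>) / 2 * (1 - 2 * e) powr s \<and> 0 < e \<and> e < 1 / 2"
    by eventually_elim auto
  then obtain e where e: "\<theta> < (1 + \<theta>) / 2 * (1 - 2 * e) powr s" "0 < e" "e < 1 / 2"
    using eventually_happens[of _ "at_right (0::real)"] by auto
  \<comment> \<open>The first summand lets the trivial bound \<open>M0\<close> suffice for
    \<open>n < 1 / e\<close>; the second makes the error term fit into the share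
    \<open>(1 - \<theta>) / 2\<close> left over by the induction hypothesis.\<close>
  define c where "c = M0 * (1 / e) powr s + 2 * K / (e powr s * (1 - \<theta>))"
  have c0: "0 \<le> c" using \<theta> K M0 e by (simp add: c_def)
  have cM: "M0 * (1 / e) powr s \<le> c" using \<theta> K by (simp add: c_def)
  have cK: "K / e powr s \<le> c * (1 - \<theta>) / 2"
  proof -
    have "K / e powr s = (2 * K / (e powr s * (1 - \<theta>))) * (1 - \<theta>) / 2" using \<theta> by simp
    also have "\<dots> \<le> c * (1 - \<theta>) / 2"
      using \<theta> M0 by (intro divide_right_mono mult_right_mono) (auto simp: c_def)
    finally show ?thesis .
  qed
  show thesis
  proof (rule that[OF c0])
    fix P n
    assume base: "\<And>n. P n M0" and mono: "\<And>n M M'. P n M \<Longrightarrow> M \<le> M' \<Longrightarrow> P n M'"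
      and step: "\<And>n m M. P n M \<Longrightarrow> 0 \<le> M \<Longrightarrow> 1 \<le> m \<Longrightarrow> P (n + m) (\<theta> * M + K / real m powr s)"
    show "1 \<le> n \<Longrightarrow> P n (c / real n powr s)"
    proof (induction n rule: less_induct)
      case (less n)
      then have n: "0 < real n" by simp
      show ?case
      proof (cases "real n < 1 / e")
        case True
        have "M0 * real n powr s \<le> M0 * (1 / e) powr s"
          using True n s M0 by (intro mult_left_mono powr_mono2) auto
        then have "M0 \<le> c / real n powr s" using cM n by (simp add: le_divide_eq)
        then show ?thesis using base mono by blast
      next
        case False
        \<comment> \<open>Since \<open>e * n\<close> is at least \<open>1\<close> here, rounding up
          at most doubles it; this is the origin of \<open>2 * e\<close> in the choice of
          \<open>e\<close>.\<close>
        define m where "m = nat \<lceil>e * real n\<rceil>"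
        define k where "k = n - m"
        have en: "1 \<le> e * real n" using False e by (simp add: field_simps)
        have m1: "e * real n \<le> real m" unfolding m_def by linarith
        have m2: "real m \<le> 2 * (e * real n)"
          using en unfolding m_def by linarith
        have "1 * real n > 2 * e * real n" using e n by (intro mult_strict_right_mono) auto
        then have "real m < real n" using m2 by linarith
        then have mn: "m < n" by simp
        have m1': "1 \<le> m" using en m1 by linarith
        have k: "k < n" "1 \<le> k" "n = k + m" using mn m1' by (auto simp: k_def)
        have kn: "(1 - 2 * e) * real n \<le> real k" using m2 k(3) by (simp add: algebra_simps)
        have "P (k + m) (\<theta> * (c / real k powr s) + K / real m powr s)"
          using less.IH[OF k(1,2)] c0 m1' by (intro step) auto
        moreover have "\<theta> * (c / real k powr s) + K / real m powr s \<le> c / real n powr s"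
        proof -
          have "\<theta> * (c / real k powr s) \<le> (1 + \<theta>) / 2 * (c / real n powr s)"
          proof -
            have "((1 - 2 * e) * real n) powr s \<le> real k powr s"
              using kn e n s by (intro powr_mono2) auto
            then have "(1 - 2 * e) powr s * real n powr s \<le> real k powr s"
              using e n by (simp add: powr_mult)
            then have "(1 + \<theta>) / 2 * ((1 - 2 * e) powr s * real n powr s) \<le> (1 + \<theta>) / 2 * real k powr s"
              using \<theta> by (intro mult_left_mono) auto
            moreover have "\<theta> * real n powr s \<le> (1 + \<theta>) / 2 * (1 - 2 * e) powr s * real n powr s"
              using e by (intro mult_right_mono) auto
            ultimately have "\<theta> * real n powr s \<le> (1 + \<theta>) / 2 * real k powr s" by simp
            then have "c * (\<theta> * real n powr s) \<le> c * ((1 + \<theta>) / 2 * real k powr s)"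
              using c0 by (intro mult_left_mono)
            then show ?thesis using n k(2) by (simp add: field_simps)
          qed
          moreover have "K / real m powr s \<le> c * (1 - \<theta>) / 2 / real n powr s"
          proof -
            have "e powr s * real n powr s \<le> real m powr s"
              using powr_mono2[OF _ _ m1, of s] s e n by (simp add: powr_mult)
            then have "K / real m powr s \<le> K / (e powr s * real n powr s)"
              using K e n order.strict_trans2[OF _ m1, of 0] by (intro divide_left_mono mult_pos_pos) auto
            also have "\<dots> = K / e powr s / real n powr s" by simp
            also have "\<dots> \<le> c * (1 - \<theta>) / 2 / real n powr s" using cK by (intro divide_right_mono) auto
            finally show ?thesis .
          qed
          moreover have "(1 + \<theta>) / 2 * (c / real n powr s) + c * (1 - \<theta>) / 2 / real n powr s
              = c / real n powr s"
            using n by (simp add: field_simps)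
          ultimately show ?thesis by linarith
        qed
        ultimately have "P (k + m) (c / real n powr s)" by (rule mono)
        then show ?thesis by (simp flip: k(3))
      qed
    qed
  qed
qed

locale log_branches = two_branches +
  fixes s r0 :: real
  assumes s_pos: "0 < s" and r0: "1 < r0"
    and V_eq: "r \<in> {0<..1} \<Longrightarrow> V r = 1 / ln (r0 / r) powr s"
begin

definition holder :: "real \<Rightarrow> (real \<Rightarrow> real) \<Rightarrow> bool" where
  "holder H f \<longleftrightarrow> (\<forall>x\<in>{0..1}. \<forall>y\<in>{0..1}. \<bar>f x - f y\<bar> \<le> H * V \<bar>x - y\<bar>)"

definition normalized :: "(real \<Rightarrow> real) \<Rightarrow> (real \<Rightarrow> real) \<Rightarrow> nat \<Rightarrow> real \<Rightarrow> real" where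
  "normalized u f n x = (L ^^ n) (\<lambda>x. u x * f x) x / (L ^^ n) u x"

text \<open>The logarithm turns \<open>\<gamma> ^ m\<close> into
  \<open>m * ln (1 / \<gamma>)\<close>, up to the positive additive constant \<open>ln r0\<close>.
  Here geometric contraction becomes a power of \<open>m\<close>.\<close>

lemma V_geometric:
  assumes "1 \<le> m"
  shows "V (\<gamma> ^ m) \<le> 1 / ln (1 / \<gamma>) powr s / real m powr s"
proof -
  have g: "0 < \<gamma>" "\<gamma> < 1" using \<gamma> by auto
  then have l: "0 < ln (1 / \<gamma>)" by simp
  have m: "0 < real m" using assms by simp
  have "ln (r0 / \<gamma> ^ m) = ln r0 + real m * ln (1 / \<gamma>)"
    using g r0 by (simp add: ln_div ln_realpow algebra_simps)
  then have "(real m * ln (1 / \<gamma>)) powr s \<le> ln (r0 / \<gamma> ^ m) powr s"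
    using l m r0 s_pos by (intro powr_mono2) auto
  then have le: "real m powr s * ln (1 / \<gamma>) powr s \<le> ln (r0 / \<gamma> ^ m) powr s"
    using m l by (simp add: powr_mult)
  have "\<gamma> ^ m \<in> {0<..1}" using g by (simp add: power_le_one)
  then have "V (\<gamma> ^ m) = 1 / ln (r0 / \<gamma> ^ m) powr s" by (rule V_eq)
  also have "\<dots> \<le> 1 / (real m powr s * ln (1 / \<gamma>) powr s)"
    using le m l by (intro divide_left_mono) (auto intro!: mult_pos_pos order.strict_trans2[OF _ le])
  finally show ?thesis by (simp add: mult.commute)
qed

text \<open>The average fixes constants, so the infimum of \<open>f\<close> may be subtracted. The
  function then takes values in \<open>[0, M]\<close>, and the upper bound required by
  \<open>normalized_diff_le\<close> becomes a bound on oscillation.\<close>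

lemma normalized_osc_le:
  assumes u: "admissible u" and H: "holder H f" "0 \<le> H"
    and M: "\<And>x y. x \<in> {0..1} \<Longrightarrow> y \<in> {0..1} \<Longrightarrow> f x - f y \<le> M"
    and xy: "x \<in> {0..1}" "y \<in> {0..1}"
  shows "normalized u f n x - normalized u f n y
    \<le> (1 - exp (- (2 * C * V \<bar>x - y\<bar>))) * M + H * V (\<gamma> ^ n * \<bar>x - y\<bar>)"
proof -
  define m where "m = Inf (f ` {0..1})"
  have bdd: "bdd_below (f ` {0..1})"
  proof (rule bdd_belowI2)
    show "f 0 - M \<le> f x" if "x \<in> {0..1}" for x using M[of 0 x] that by auto
  qed
  have *: "normalized u (\<lambda>x. f x - m) n z = normalized u f n z - m" if "z \<in> {0..1}" for z
  proof -
    have "0 < (L ^^ n) u z" using admissible_pos[OF admissible_L[OF u] that] .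
    moreover have "(L ^^ n) (\<lambda>x. u x * (f x - m)) z = (L ^^ n) (\<lambda>x. u x * f x - m * u x) z"
      by (simp add: algebra_simps)
    ultimately show ?thesis
      by (simp add: normalized_def L_diff L_scale diff_divide_distrib)
  qed
  have "normalized u (\<lambda>x. f x - m) n x - normalized u (\<lambda>x. f x - m) n y
      \<le> (1 - exp (- (2 * C * V \<bar>x - y\<bar>))) * M + H * V (\<gamma> ^ n * \<bar>x - y\<bar>)"
    unfolding normalized_def
  proof (rule normalized_diff_le[OF u _ _ _ H(2) xy])
    fix x assume x: "x \<in> {0..1::real}"
    show "0 \<le> f x - m" unfolding m_def using cINF_lower[OF bdd x] by simp
    have "f x - M \<le> m" unfolding m_def
    proof (rule cINF_greatest)
      show "f x - M \<le> f y" if "y \<in> {0..1}" for y using M[OF x that] by simp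
    qed auto
    then show "f x - m \<le> M" by simp
    fix y assume y: "y \<in> {0..1::real}"
    show "\<bar>f x - m - (f y - m)\<bar> \<le> H * V \<bar>x - y\<bar>"
      using H(1) x y by (simp add: holder_def)
  qed
  then show ?thesis using * xy by simp
qed

text \<open>After \<open>n\<close> steps the weight function is \<open>(L ^^ n) u\<close>,
  admissible again; estimates uniform in the admissible function can therefore be restarted at any
  time.\<close>

lemma normalized_add:
  assumes "admissible u" "x \<in> {0..1}"
  shows "normalized u f (m + n) x = normalized ((L ^^ n) u) (normalized u f n) m x"
proof -
  have "(L ^^ m) ((L ^^ n) (\<lambda>x. u x * f x)) x = (L ^^ m) (\<lambda>x. (L ^^ n) u x * normalized u f n x) x"
  proof (rule L_cong)
    fix z :: real assume "z \<in> {0..1}"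
    then have "0 < (L ^^ n) u z" using admissible_pos[OF admissible_L[OF assms(1)]] by blast
    then show "(L ^^ n) (\<lambda>x. u x * f x) z = (L ^^ n) u z * normalized u f n z"
      by (simp add: normalized_def)
  qed (use assms in auto)
  then show ?thesis by (simp add: normalized_def funpow_add)
qed

lemma holder_osc:
  assumes "holder H f" "0 \<le> H" "x \<in> {0..1}" "y \<in> {0..1}"
  shows "\<bar>f x - f y\<bar> \<le> H * V 1"
proof -
  have "\<bar>f x - f y\<bar> \<le> H * V \<bar>x - y\<bar>" using assms by (auto simp: holder_def)
  also have "\<dots> \<le> H * V 1" using assms by (intro mult_left_mono V_le_1)
  finally show ?thesis .
qed

text \<open>By \<open>1 - exp (- z) \<le> z\<close> the distortion term is itself a multiple of
  \<open>V\<close>, so the new constant is independent of \<open>n\<close>.\<close>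

lemma holder_normalized:
  assumes u: "admissible u" and H: "holder H f" "0 \<le> H"
  shows "holder (H * (1 + 2 * C * V 1)) (normalized u f n)"
proof -
  have le: "normalized u f n x - normalized u f n y \<le> H * (1 + 2 * C * V 1) * V \<bar>x - y\<bar>"
    if xy: "x \<in> {0..1}" "y \<in> {0..1}" for x y
  proof -
    have "normalized u f n x - normalized u f n y
      \<le> (1 - exp (- (2 * C * V \<bar>x - y\<bar>))) * (H * V 1) + H * V (\<gamma> ^ n * \<bar>x - y\<bar>)"
    proof (rule normalized_osc_le[OF u H _ xy])
      show "f x - f y \<le> H * V 1" if "x \<in> {0..1}" "y \<in> {0..1}" for x y
        using holder_osc[OF H that] by linarith
    qed
    also have "\<dots> \<le> (2 * C * V \<bar>x - y\<bar>) * (H * V 1) + H * V \<bar>x - y\<bar>"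
    proof (intro add_mono mult_right_mono mult_left_mono V_le)
      show "1 - exp (- (2 * C * V \<bar>x - y\<bar>)) \<le> 2 * C * V \<bar>x - y\<bar>"
        using exp_ge_add_one_self[of "- (2 * C * V \<bar>x - y\<bar>)"] by linarith
      have "\<gamma> ^ n \<le> 1" using \<gamma> by (intro power_le_one) auto
      then show "\<gamma> ^ n * \<bar>x - y\<bar> \<le> \<bar>x - y\<bar>" by (intro mult_left_le_one_le) (use \<gamma> in auto)
    qed (use H V_nonneg \<gamma> in auto)
    finally show ?thesis by (simp add: algebra_simps)
  qed
  show ?thesis unfolding holder_def
  proof (intro ballI)
    fix x y :: real assume xy: "x \<in> {0..1}" "y \<in> {0..1}"
    show "\<bar>normalized u f n x - normalized u f n y\<bar> \<le> H * (1 + 2 * C * V 1) * V \<bar>x - y\<bar>"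
      using le[OF xy] le[OF xy(2,1)] by (simp add: abs_le_iff abs_minus_commute)
  qed
qed

text \<open>Splitting \<open>n + m\<close> steps, the oscillation satisfies
  \<open>osc (n + m) \<le> \<theta> * osc n + O(V (\<gamma> ^ m))\<close>; taking \<open>m\<close> a small proportion of \<open>n\<close> yields the
  optimal exponent even though \<open>\<theta>\<close> is close to \<open>1\<close>.\<close>

lemma normalized_decay:
  obtains c where "0 \<le> c"
    "\<And>u f H n x y. admissible u \<Longrightarrow> holder H f \<Longrightarrow> 0 \<le> H \<Longrightarrow> 1 \<le> n \<Longrightarrow> x \<in> {0..1} \<Longrightarrow> y \<in> {0..1} \<Longrightarrow>
      normalized u f n x - normalized u f n y \<le> H * (c / real n powr s)"
proof -
  \<comment> \<open>\<open>\<theta>\<close> is the distortion loss at the largest possible distance,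
    \<open>D\<close> the growth of the Hoelder constant under averaging, and \<open>K\<close>
    combines \<open>D\<close> with the constant of \<open>V_geometric\<close>.\<close>
  define \<theta> where "\<theta> = 1 - exp (- (2 * C * V 1))"
  define D where "D = 1 + 2 * C * V 1"
  define K where "K = D * (1 / ln (1 / \<gamma>) powr s)"
  have CV: "0 \<le> C * V 1" using C_nonneg V_nonneg by simp
  have \<theta>: "0 \<le> \<theta>" "\<theta> < 1" using CV by (auto simp: \<theta>_def mult.assoc)
  have D: "1 \<le> D" using CV by (simp add: D_def mult.assoc)
  have K: "0 \<le> K" using D by (simp add: K_def)
  have M0: "0 \<le> D * V 1" using D V_nonneg by simp
  show thesis
  proof (rule poly_decay_recursion[OF \<theta> s_pos K M0])
    fix c assume c: "0 \<le> c"
      "\<And>P n. (\<And>n. P n (D * V 1)) \<Longrightarrow> (\<And>n M M'. P n M \<Longrightarrow> M \<le> M' \<Longrightarrow> P n M') \<Longrightarrow>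
         (\<And>n m M. P n M \<Longrightarrow> 0 \<le> M \<Longrightarrow> 1 \<le> m \<Longrightarrow> P (n + m) (\<theta> * M + K / real m powr s)) \<Longrightarrow>
         1 \<le> n \<Longrightarrow> P n (c / real n powr s)"
    show thesis
    proof (rule that[OF c(1)])
      fix u f H and n :: nat and x y :: real
      assume u: "admissible u" and H: "holder H f" "0 \<le> H" and n: "1 \<le> n"
        and xy: "x \<in> {0..1}" "y \<in> {0..1}"
      \<comment> \<open>Oscillation is measured in multiples of \<open>H\<close>, as a product, so
        that \<open>H = 0\<close> is covered and \<open>c\<close> is independent of
        \<open>f\<close>.\<close>
      define P where "P n M \<longleftrightarrow> (\<forall>x\<in>{0..1}. \<forall>y\<in>{0..1}. normalized u f n x - normalized u f n y \<le> H * M)"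
        for n M
      have hn: "holder (H * D) (normalized u f n)" for n
        unfolding D_def by (rule holder_normalized[OF u H])
      have HD: "0 \<le> H * D" using H D by simp
      have "P n (c / real n powr s)"
      proof (rule c(2)[OF _ _ _ n])
        fix n
        show "P n (D * V 1)" unfolding P_def
        proof (intro ballI)
          fix x y :: real assume "x \<in> {0..1}" "y \<in> {0..1}"
          from holder_osc[OF hn HD this, of n] show "normalized u f n x - normalized u f n y \<le> H * (D * V 1)"
            by (simp add: mult.assoc)
        qed
      next
        fix n M M' assume PM: "P n M" "M \<le> (M'::real)"
        show "P n M'" unfolding P_def
        proof (intro ballI)
          fix x y :: real assume xy: "x \<in> {0..1}" "y \<in> {0..1}"
          have "normalized u f n x - normalized u f n y \<le> H * M" using PM(1) xy by (simp add: P_def)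
          also have "\<dots> \<le> H * M'" using PM H by (intro mult_left_mono)
          finally show "normalized u f n x - normalized u f n y \<le> H * M'" .
        qed
      next
        fix n m :: nat and M :: real assume PM: "P n M" "0 \<le> M" and m: "1 \<le> m"
        show "P (n + m) (\<theta> * M + K / real m powr s)" unfolding P_def
        proof (intro ballI)
          fix x y :: real assume xy: "x \<in> {0..1}" "y \<in> {0..1}"
          have "normalized u f (n + m) x - normalized u f (n + m) y
              = normalized ((L ^^ n) u) (normalized u f n) m x - normalized ((L ^^ n) u) (normalized u f n) m y"
            using normalized_add[OF u xy(1), of f m n] normalized_add[OF u xy(2), of f m n]
            by (simp add: add.commute)
          also have "\<dots> \<le> (1 - exp (- (2 * C * V \<bar>x - y\<bar>))) * (H * M) + H * D * V (\<gamma> ^ m * \<bar>x - y\<bar>)"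
            using PM(1) by (intro normalized_osc_le[OF admissible_L[OF u] hn HD _ xy]) (simp add: P_def)
          also have "\<dots> \<le> \<theta> * (H * M) + H * D * (1 / ln (1 / \<gamma>) powr s / real m powr s)"
          proof (intro add_mono mult_right_mono mult_left_mono)
            have "V \<bar>x - y\<bar> \<le> V 1" by (rule V_le_1[OF xy])
            then show "1 - exp (- (2 * C * V \<bar>x - y\<bar>)) \<le> \<theta>"
              using C_nonneg by (auto simp: \<theta>_def intro: mult_left_mono)
            have "\<gamma> ^ m * \<bar>x - y\<bar> \<le> \<gamma> ^ m * 1"
              using xy \<gamma> by (intro mult_left_mono) auto
            then have "V (\<gamma> ^ m * \<bar>x - y\<bar>) \<le> V (\<gamma> ^ m)"
              using \<gamma> by (intro V_le) auto
            then show "V (\<gamma> ^ m * \<bar>x - y\<bar>) \<le> 1 / ln (1 / \<gamma>) powr s / real m powr s"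
              using V_geometric[OF m] by linarith
          qed (use PM H HD in auto)
          also have "\<dots> = H * (\<theta> * M + K / real m powr s)"
            by (simp add: K_def algebra_simps)
          finally show "normalized u f (n + m) x - normalized u f (n + m) y
              \<le> H * (\<theta> * M + K / real m powr s)" .
        qed
      qed
      then show "normalized u f n x - normalized u f n y \<le> H * (c / real n powr s)"
        using xy by (simp add: P_def)
    qed
  qed
qed

end

subsection \<open>The inverse branches of the intermittent map\<close>

definition expand :: "real \<Rightarrow> real \<Rightarrow> real" where
  "expand q r = (1 + (2 * r) powr q) * r"

text \<open>\<open>True\<close> stands for the uniformly expanding branch. Arguments range over the
  closed interval, whose two endpoints represent the same circle point; there
  \<open>branch_False\<close> shows the definite description to be meaningful.\<close>

definition branch :: "real \<Rightarrow> bool \<Rightarrow> real \<Rightarrow> real" where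
  "branch q i x = (if i then (x + 1) / 2 else (THE r. r \<in> {0..1/2} \<and> expand q r = x))"

lemma branch_True: "branch q True x = (x + 1) / 2"
  by (simp add: branch_def)

text \<open>Superadditivity of \<open>expand q\<close>: the powers at \<open>t - r\<close> and at
  \<open>r\<close> are both at most the power at \<open>t\<close>. It yields strict monotonicity and
  the comparison of an arbitrary gap with a gap at the neutral point.\<close>

lemma expand_diff:
  assumes "0 < q" "0 \<le> r" "r \<le> t"
  shows "expand q (t - r) \<le> expand q t - expand q r"
proof -
  have "(2 * (t - r)) powr q * (t - r) + (2 * r) powr q * r \<le> (2 * t) powr q * (t - r) + (2 * t) powr q * r"
    using assms by (intro add_mono mult_right_mono powr_mono2) auto
  then show ?thesis by (simp add: expand_def algebra_simps)
qed

lemma expand_ge: "0 \<le> r \<Longrightarrow> r \<le> expand q r"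
  by (simp add: expand_def algebra_simps)

lemma expand_less:
  assumes "0 < q" "0 \<le> r" "r < t"
  shows "expand q r < expand q t"
  using expand_diff[of q r t] expand_ge[of "t - r" q] assms by simp

lemma expand_inj: "0 < q \<Longrightarrow> expand q r = expand q t \<Longrightarrow> 0 \<le> r \<Longrightarrow> 0 \<le> t \<Longrightarrow> r = t"
  using expand_less[of q r t] expand_less[of q t r] by (cases r t rule: linorder_cases) auto

lemma expand_half: "expand q (1/2) = 1"
  by (simp add: expand_def)

lemma branch_False:
  assumes q: "0 < q" and x: "x \<in> {0..1}"
  shows "branch q False x \<in> {0..1/2}" "expand q (branch q False x) = x"
proof -
  have "\<exists>r\<ge>0. r \<le> 1/2 \<and> expand q r = x"
  proof (rule IVT'[of "expand q"])
    show "continuous_on {0..1/2} (expand q)"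
      unfolding expand_def
      by (intro continuous_on_mult continuous_on_add continuous_on_powr' continuous_on_const continuous_on_id)
        (use q in auto)
    show "expand q 0 \<le> x" using x by (simp add: expand_def)
    show "x \<le> expand q (1/2)" using x by (simp add: expand_half)
  qed simp
  then obtain r where r: "r \<in> {0..1/2}" "expand q r = x" by auto
  have "branch q False x = r"
    unfolding branch_def if_False
  proof (rule the_equality)
    show "t = r" if "t \<in> {0..1/2} \<and> expand q t = x" for t
      by (rule expand_inj[OF q]) (use that r in simp_all)
  qed (use r in simp)
  then show "branch q False x \<in> {0..1/2}" "expand q (branch q False x) = x"
    using r by auto
qed

lemma branch_False_expand:
  assumes q: "0 < q" and r: "r \<in> {0..1/2}"
  shows "branch q False (expand q r) = r"
  unfolding branch_def if_False
proof (rule the_equality)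
  show "t = r" if "t \<in> {0..1/2} \<and> expand q t = expand q r" for t
    by (rule expand_inj[OF q]) (use that r in simp_all)
qed (use r in simp)

lemma expand_le_2: "0 < q \<Longrightarrow> r \<in> {0..1/2} \<Longrightarrow> expand q r \<le> 2 * r"
proof -
  assume "0 < q" "r \<in> {0..1/2}"
  then have "(2 * r) powr q \<le> 1" by (intro powr_le1) auto
  then have "(1 + (2 * r) powr q) * r \<le> 2 * r"
    using \<open>r \<in> _\<close> by (intro mult_right_mono) auto
  then show ?thesis by (simp add: expand_def)
qed

lemma branch_ends:
  assumes "0 < q"
  shows "branch q False 0 = 0" "branch q False 1 = 1/2"
  using branch_False_expand[OF assms, of 0] branch_False_expand[OF assms, of "1/2"]
  by (auto simp: expand_half) (simp add: expand_def)

text \<open>The neutral branch contracts two points no less than it contracts \<open>\<bar>x - y\<bar>\<close> and \<open>0\<close>, and the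
  other branch contracts more.\<close>

lemma expand_branch_le:
  assumes q: "0 < q" and x: "x \<in> {0..1}" and y: "y \<in> {0..1}"
  shows "expand q \<bar>branch q i x - branch q i y\<bar> \<le> \<bar>x - y\<bar>"
proof (cases i)
  case True
  have "\<bar>x - y\<bar> / 2 \<in> {0..1/2}" using x y by auto
  from expand_le_2[OF q this] show ?thesis
    using True by (simp add: branch_True diff_divide_distrib[symmetric])
next
  case False
  have *: "expand q \<bar>branch q False x - branch q False y\<bar> \<le> \<bar>x - y\<bar>"
    if "x \<in> {0..1}" "y \<in> {0..1}" "branch q False x \<le> branch q False y" for x y
  proof -
    have "expand q (branch q False y - branch q False x)
       \<le> expand q (branch q False y) - expand q (branch q False x)"
      using that branch_False(1)[OF q that(1)] by (intro expand_diff q) auto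
    then show ?thesis using branch_False(2)[OF q] that by simp
  qed
  show ?thesis
    using *[OF x y] *[OF y x] False by (cases "branch q False x \<le> branch q False y") (auto simp: abs_minus_commute)
qed

lemma branch_in:
  assumes q: "0 < q" and x: "x \<in> {0..1}"
  shows "branch q i x \<in> {0..1}"
  using branch_False(1)[OF q x] x by (cases i) (auto simp: branch_True)

section \<open>Gain of the logarithmic modulus along the neutral branch\<close>

text \<open>Mean value theorem for \<open>ln (r1 / r) powr (1 - \<beta>)\<close> between
  \<open>d\<close> and \<open>expand q d\<close>: the derivative
  \<open>(\<beta> - 1) * ln (r1 / r) powr (- \<beta>) / r\<close>, times a displacement of at least
  \<open>d * d powr q\<close>, leaves \<open>d powr q\<close> over the logarithm to the power
  \<open>\<beta>\<close>, up to constants.\<close>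

lemma log_modulus_gain:
  fixes q \<beta> r0 r1 :: real
  assumes q: "0 < q" and \<beta>: "1 < \<beta>" and r0: "1 < r0" and r1: "1 < r1"
  obtains K where "0 \<le> K"
    "\<And>d. 0 < d \<Longrightarrow> d \<le> 1/2 \<Longrightarrow> d powr q / ln (r0 / d) powr \<beta>
      \<le> K * (1 / ln (r1 / expand q d) powr (\<beta> - 1) - 1 / ln (r1 / d) powr (\<beta> - 1))"
proof -
  \<comment> \<open>\<open>k\<close> reconciles the two reference scales, giving
    \<open>ln (r1 / d) \<le> k * ln (r0 / d)\<close>; the maximum with \<open>1\<close> takes care
    of the common part \<open>- ln d\<close>.\<close>
  define k where "k = max 1 (ln r1 / ln r0)"
  have l0: "0 < ln r0" "0 < ln r1" using r0 r1 by auto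
  have k: "1 \<le> k" "ln r1 \<le> k * ln r0"
  proof -
    have "ln r1 / ln r0 * ln r0 \<le> k * ln r0"
      using l0 by (intro mult_right_mono) (auto simp: k_def)
    then show "ln r1 \<le> k * ln r0" using l0 by simp
  qed (simp add: k_def)
  \<comment> \<open>The \<open>2\<close> pays for \<open>\<xi> \<le> 2 * d\<close> in the
    denominator of the derivative.\<close>
  define K where "K = 2 * k powr \<beta> / (\<beta> - 1)"
  show thesis
  proof (rule that[of K])
    show "0 \<le> K" using \<beta> by (simp add: K_def)
    fix d :: real assume d: "0 < d" "d \<le> 1/2"
    let ?W = "\<lambda>r. (ln r1 - ln r) powr (1 - \<beta>)"
    let ?D = "\<lambda>r. (\<beta> - 1) * (ln r1 - ln r) powr (- \<beta>) / r"
    define d' where "d' = expand q d"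
    have d': "d < d'" "d' \<le> 2 * d"
      using d expand_le_2[OF q, of d] by (auto simp: d'_def expand_def mult_less_cancel_right1)
    have D: "(?W has_real_derivative ?D x) (at x)" if "d \<le> x" "x \<le> d'" for x
    proof -
      have x: "0 < x" "x < r1" using that d d' r1 by auto
      then have p: "0 < ln r1 - ln x" by simp
      have "((\<lambda>r. ln r1 - ln r) has_real_derivative - (1 / x)) (at x)"
        using DERIV_diff[OF DERIV_const DERIV_ln_divide[OF x(1)], of "ln r1"] by simp
      from DERIV_chain2[OF has_real_derivative_powr[OF p] this, of "1 - \<beta>"]
      show ?thesis by (rule DERIV_cong) (simp add: algebra_simps diff_divide_distrib)
    qed
    obtain \<xi> where \<xi>: "d < \<xi>" "\<xi> < d'" "?W d' - ?W d = (d' - d) * ?D \<xi>"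
      using MVT2[OF d'(1), of ?W ?D] D by blast
    have l: "ln (r1 / x) = ln r1 - ln x" "ln (r0 / x) = ln r0 - ln x" if "0 < x" for x
      using that r0 r1 by (auto simp: ln_div)
    have ln_d: "0 < ln (r0 / d)" "0 < ln (r1 / d)" using d r0 r1 by auto
    have "0 < ln (r1 / \<xi>)" using \<xi> d d' r1 by auto
    then have ln_\<xi>: "0 < ln r1 - ln \<xi>" using l[of \<xi>] \<xi> d by simp
    have "ln (r1 / d) = ln r1 - ln d" "ln (r0 / d) = ln r0 - ln d"
      using l d by auto
    moreover have "- ln d \<le> k * (- ln d)"
      using mult_right_mono[OF k(1), of "- ln d"] d by simp
    moreover have "k * ln (r0 / d) = k * ln r0 - k * ln d"
      using l d by (simp add: right_diff_distrib)
    ultimately have "ln (r1 / d) \<le> k * ln (r0 / d)" using k(2) by linarith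
    then have "ln (r1 / d) powr \<beta> \<le> (k * ln (r0 / d)) powr \<beta>"
      using ln_d \<beta> by (intro powr_mono2) auto
    then have kk: "ln (r1 / d) powr \<beta> \<le> k powr \<beta> * ln (r0 / d) powr \<beta>"
      using k ln_d by (simp add: powr_mult)
    have "d powr q / ln (r0 / d) powr \<beta> \<le> k powr \<beta> * (d powr q / ln (r1 / d) powr \<beta>)"
      using mult_left_mono[OF kk, of "d powr q"] ln_d by (simp add: field_simps)
    also have "\<dots> = K * (d * d powr q * ((\<beta> - 1) * ln (r1 / d) powr (- \<beta>) / (2 * d)))"
    proof -
      have "K * (d * d powr q * ((\<beta> - 1) * ln (r1 / d) powr (- \<beta>) / (2 * d)))
          = (K * (\<beta> - 1)) * (d powr q * ln (r1 / d) powr (- \<beta>) / 2)"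
        using d by simp
      also have "K * (\<beta> - 1) = 2 * k powr \<beta>" using \<beta> by (simp add: K_def)
      finally show ?thesis by (simp add: powr_minus_divide)
    qed
    also have "\<dots> \<le> K * ((d' - d) * ?D \<xi>)"
    proof (intro mult_left_mono mult_mono frac_le)
      have "d powr q \<le> (2 * d) powr q" using d q by (intro powr_mono2) auto
      then have "d * d powr q \<le> d * (2 * d) powr q" using d by (intro mult_left_mono) auto
      then show "d * d powr q \<le> d' - d" by (simp add: d'_def expand_def algebra_simps)
      have "ln r1 - ln \<xi> \<le> ln (r1 / d)" using \<xi> d l[of d] by simp
      then show "ln (r1 / d) powr - \<beta> \<le> (ln r1 - ln \<xi>) powr - \<beta>"
        using ln_\<xi> \<beta> by (intro powr_mono2') auto
    qed (use \<xi> d d' \<beta> \<open>0 \<le> K\<close> in auto)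
    also have "\<dots> = K * (?W d' - ?W d)" using \<xi> by simp
    also have "\<dots> = K * (1 / ln (r1 / d') powr (\<beta> - 1) - 1 / ln (r1 / d) powr (\<beta> - 1))"
      using powr_minus_divide[of _ "\<beta> - 1"] l[of d] l[of d'] d d' by simp
    finally show "d powr q / ln (r0 / d) powr \<beta>
      \<le> K * (1 / ln (r1 / expand q d) powr (\<beta> - 1) - 1 / ln (r1 / d) powr (\<beta> - 1))"
      by (simp add: d'_def)
  qed
qed

section \<open>The circle metric against the metric of the interval\<close>

lemma circle_of_add_int: "circle_of (r + of_int k) = circle_of r"
  by (simp add: circle_of_def frac_def)

text \<open>If the integer parts differ, \<open>\<bar>r - t\<bar>\<close> is at least
  \<open>1\<close> minus the gap of the fractional parts, which is the length of the arc through
  \<open>0\<close>.\<close>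

lemma dist_circle_of_le: "dist (circle_of r) (circle_of t) \<le> \<bar>r - t\<bar>"
proof -
  define n where "n = \<lfloor>r\<rfloor> - \<lfloor>t\<rfloor>"
  have e: "r - t = (frac r - frac t) + of_int n" by (simp add: n_def frac_def)
  have b: "\<bar>frac r - frac t\<bar> < 1"
    using frac_ge_0[of r] frac_ge_0[of t] frac_lt_1[of r] frac_lt_1[of t] by linarith
  consider "n = 0" | "of_int n \<ge> (1::real)" | "of_int n \<le> (-1::real)" by linarith
  then have "min \<bar>frac r - frac t\<bar> (1 - \<bar>frac r - frac t\<bar>) \<le> \<bar>r - t\<bar>"
  proof cases
    case 1
    then show ?thesis by (intro min.coboundedI1) (simp add: e)
  next
    case 2
    then have "1 - \<bar>frac r - frac t\<bar> \<le> \<bar>r - t\<bar>" using e b by linarith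
    then show ?thesis by (rule min.coboundedI2)
  next
    case 3
    then have "1 - \<bar>frac r - frac t\<bar> \<le> \<bar>r - t\<bar>" using e b by linarith
    then show ?thesis by (rule min.coboundedI2)
  qed
  then show ?thesis by (simp add: dist_circle_def circle_rep_circle_of)
qed

lemma dist_circle_of_le_int: "dist (circle_of r) (circle_of t) \<le> \<bar>r - t - of_int k\<bar>"
  using dist_circle_of_le[of r "t + of_int k"] circle_of_add_int[of t k] by (simp add: algebra_simps)

lemma circle_of_1: "circle_of 1 = circle_of 0"
  using circle_of_add_int[of 0 1] by simp

lemma circle_rep_of: "r \<in> {0..<1} \<Longrightarrow> circle_rep (circle_of r) = r"
  by (simp add: circle_rep_circle_of frac_eq)

lemma dist_circle_le_half: "dist x y \<le> 1 / 2" for x y :: circle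
  by (auto simp: dist_circle_def min_def)

lemma circle_dist_cases:
  fixes x y :: circle
  obtains "dist x y = \<bar>circle_rep x - circle_rep y\<bar>"
  | "circle_rep x < circle_rep y" "dist x y = circle_rep x + (1 - circle_rep y)"
  | "circle_rep y < circle_rep x" "dist x y = circle_rep y + (1 - circle_rep x)"
proof -
  consider "\<bar>circle_rep x - circle_rep y\<bar> \<le> 1/2"
    | "circle_rep x < circle_rep y" "circle_rep y - circle_rep x > 1/2"
    | "circle_rep y < circle_rep x" "circle_rep x - circle_rep y > 1/2"
    by linarith
  then show thesis
    by cases (auto simp: dist_circle_def min_def intro: that)
qed

text \<open>The factor \<open>2\<close> comes from splitting at \<open>0\<close> the pairs whose short arc crosses \<open>0\<close>.\<close>

lemma holder_circleI:
  assumes V: "\<And>r t. 0 \<le> r \<Longrightarrow> r \<le> t \<Longrightarrow> V r \<le> (V t :: real)" and V0: "0 \<le> V 0" and H: "0 \<le> H"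
    and f: "\<And>r t. r \<in> {0..1} \<Longrightarrow> t \<in> {0..1} \<Longrightarrow>
      \<bar>f (circle_of r) - f (circle_of t)\<bar> \<le> H * V (\<bar>r - t\<bar>)"
  shows "\<bar>f x - f y\<bar> \<le> 2 * H * V (dist x y)"
proof -
  have *: "\<bar>f x - f y\<bar> \<le> 2 * H * V (circle_rep x + (1 - circle_rep y))" for x y
  proof -
    let ?r = "circle_rep x" and ?t = "circle_rep y"
    note b = circle_rep_bounds[of x] circle_rep_bounds[of y]
    have "\<bar>f x - f y\<bar> \<le> \<bar>f (circle_of ?r) - f (circle_of 0)\<bar> + \<bar>f (circle_of 1) - f (circle_of ?t)\<bar>"
      by (simp add: circle_of_circle_rep circle_of_1)
    also have "\<dots> \<le> H * V \<bar>?r - 0\<bar> + H * V \<bar>1 - ?t\<bar>"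
      using b by (intro add_mono f) auto
    also have "\<dots> \<le> H * V (?r + (1 - ?t)) + H * V (?r + (1 - ?t))"
      using b H by (intro add_mono mult_left_mono V) auto
    finally show ?thesis by simp
  qed
  show ?thesis
  proof (cases rule: circle_dist_cases[of x y])
    case 1
    have "\<bar>f x - f y\<bar> \<le> H * V (dist x y)"
      using f[of "circle_rep x" "circle_rep y"] circle_rep_bounds[of x] circle_rep_bounds[of y] 1
      by (simp add: circle_of_circle_rep)
    also have "\<dots> \<le> 2 * H * V (dist x y)"
      using H V0 V[of 0 "dist x y"] by (intro mult_right_mono) auto
    finally show ?thesis .
  qed (use *[of x y] *[of y x] in \<open>auto simp: abs_minus_commute\<close>)
qed

section \<open>Lipschitz bound and fibres of the intermittent map\<close>

lemma T_map_circle_of: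
  assumes "r \<in> {0..1}"
  shows "T_map q (circle_of r) = circle_of (if r \<le> 1/2 then expand q r else 2 * r)"
proof (cases "r = 1")
  case True
  have "circle_rep (circle_of 0) = 0" using circle_rep_of[of 0] by simp
  then show ?thesis using True circle_of_add_int[of 0 2] circle_of_1 by (simp add: T_map_def)
next
  case False
  then have "circle_rep (circle_of r) = r" using assms by (intro circle_rep_of) auto
  then show ?thesis using circle_of_add_int[of "2 * r" "-1"] by (simp add: T_map_def expand_def)
qed

text \<open>One unit of the constant comes from the linear term, one from
  \<open>(2 * t) powr q \<le> 1\<close>, and one from the increment of the power, where
  \<open>(t / r) powr q \<le> t / r\<close>.\<close>

lemma expand_lipschitz:
  assumes q: "0 < q" "q < 1" and r: "0 \<le> r" "r \<le> t" "t \<le> 1/2"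
  shows "expand q t - expand q r \<le> 3 * (t - r)"
proof -
  have "r * ((2 * t) powr q - (2 * r) powr q) \<le> t - r"
  proof (cases "r = 0")
    case False
    then have r0: "0 < r" using r by simp
    have "(2 * t) powr q = (2 * r) powr q * (t / r) powr q"
      using r0 r by (simp add: powr_mult[symmetric])
    moreover have "(t / r) powr q \<le> t / r"
      using powr_mono[of q 1 "t / r"] q r0 r by simp
    then have "(2 * r) powr q * (t / r) powr q \<le> (2 * r) powr q * (t / r)"
      by (intro mult_left_mono) auto
    ultimately have "(2 * t) powr q - (2 * r) powr q \<le> (2 * r) powr q * (t / r - 1)"
      unfolding right_diff_distrib by linarith
    also have "\<dots> \<le> 1 * (t / r - 1)"
      using r r0 q by (intro mult_right_mono powr_le1) auto
    finally show ?thesis using r0 by (simp add: field_simps)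
  qed (use r in auto)
  moreover have "(2 * t) powr q * (t - r) \<le> 1 * (t - r)"
    using r q by (intro mult_right_mono powr_le1) auto
  ultimately show ?thesis by (simp add: expand_def algebra_simps)
qed

lemma dist_T_map_le:
  assumes q: "0 < q" "q < 1"
  shows "dist (T_map q x) (T_map q y) \<le> 3 * dist x y"
proof -
  \<comment> \<open>\<open>\<tau>\<close> is the continuous lift of this map of degree two, with
    \<open>\<tau> 0 = 0\<close> and \<open>\<tau> 1 = 2\<close>; across a short arc through
    \<open>0\<close> the values are therefore compared after a shift by \<open>2\<close>.\<close>
  define \<tau> where "\<tau> r = (if r \<le> 1/2 then expand q r else 2 * r)" for r
  have \<tau>: "\<tau> r \<le> \<tau> t" "\<tau> t - \<tau> r \<le> 3 * (t - r)" if "0 \<le> r" "r \<le> t" "t \<le> 1" for r t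
  proof -
    have m: "expand q r' \<le> expand q t'" if "0 \<le> r'" "r' \<le> t'" for r' t'
      using expand_less[OF q(1), of r' t'] that by (cases "r' = t'") auto
    show "\<tau> r \<le> \<tau> t"
      using m[of r t] m[of r "1/2"] that by (auto simp: \<tau>_def expand_half)
    show "\<tau> t - \<tau> r \<le> 3 * (t - r)"
      using expand_lipschitz[OF q, of r t] expand_lipschitz[OF q, of r "1/2"] that
      by (auto simp: \<tau>_def expand_half)
  qed
  have T: "T_map q x = circle_of (\<tau> (circle_rep x))" for x
    using T_map_circle_of[of "circle_rep x" q] circle_rep_bounds[of x]
    by (auto simp: \<tau>_def circle_of_circle_rep)
  have *: "dist (T_map q x) (T_map q y) \<le> 3 * (circle_rep x + (1 - circle_rep y))"
    if "circle_rep x < circle_rep y" for x y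
  proof -
    have "dist (T_map q x) (T_map q y) \<le> \<bar>\<tau> (circle_rep x) - \<tau> (circle_rep y) - of_int (-2)\<bar>"
      unfolding T by (rule dist_circle_of_le_int)
    also have "\<dots> \<le> \<bar>\<tau> 1 - \<tau> (circle_rep y)\<bar> + \<bar>\<tau> (circle_rep x) - \<tau> 0\<bar>"
      by (simp add: \<tau>_def[of 1] \<tau>_def[of 0] expand_def)
    also have "\<dots> \<le> 3 * (1 - circle_rep y) + 3 * (circle_rep x - 0)"
      using \<tau>[of "circle_rep y" 1] \<tau>[of 0 "circle_rep x"] circle_rep_bounds[of x] circle_rep_bounds[of y]
      by (intro add_mono) auto
    finally show ?thesis by simp
  qed
  show ?thesis
  proof (cases rule: circle_dist_cases[of x y])
    case 1
    have "dist (T_map q x) (T_map q y) \<le> \<bar>\<tau> (circle_rep x) - \<tau> (circle_rep y)\<bar>"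
      unfolding T by (rule dist_circle_of_le)
    also have "\<dots> \<le> 3 * \<bar>circle_rep x - circle_rep y\<bar>"
      using \<tau>[of "circle_rep x" "circle_rep y"] \<tau>[of "circle_rep y" "circle_rep x"]
        circle_rep_bounds[of x] circle_rep_bounds[of y]
      by (cases "circle_rep x \<le> circle_rep y") auto
    finally show ?thesis using 1 by simp
  qed (use *[of x y] *[of y x] in \<open>auto simp: dist_commute\<close>)
qed

lemma T_map_vimage:
  assumes q: "0 < q"
  shows "T_map q -` {x} = (\<lambda>i. circle_of (branch q i (circle_rep x))) ` UNIV"
    and "inj (\<lambda>i. circle_of (branch q i (circle_rep x)))"
proof -
  define t where "t = circle_rep x"
  have t: "0 \<le> t" "t < 1" "circle_of t = x"
    using circle_rep_bounds[of x] by (auto simp: t_def circle_of_circle_rep)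
  have F: "branch q False t \<in> {0..1/2}" "expand q (branch q False t) = t"
    using branch_False[OF q, of t] t by auto
  \<comment> \<open>Strict because \<open>t < 1\<close>; this separates the two preimages.\<close>
  have F': "branch q False t < 1/2"
    using F t expand_half[of q] by (cases "branch q False t = 1/2") auto
  have 1: "circle_rep (circle_of (branch q i t)) = branch q i t" for i
    using F F' t by (intro circle_rep_of) (cases i; auto simp: branch_True)
  have "branch q False t \<noteq> branch q True t" using F' t by (simp add: branch_True)
  then have ne: "circle_of (branch q False t) \<noteq> circle_of (branch q True t)"
    using 1[of False] 1[of True] by auto
  show "inj (\<lambda>i. circle_of (branch q i (circle_rep x)))"
  proof (rule injI)
    show "i = j" if "circle_of (branch q i (circle_rep x)) = circle_of (branch q j (circle_rep x))" for i j
      using that ne unfolding t_def[symmetric] by (cases i; cases j) simp_all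
  qed
  have "T_map q y = x \<longleftrightarrow> (\<exists>i. y = circle_of (branch q i t))" for y
  proof
    assume y: "T_map q y = x"
    define r where "r = circle_rep y"
    have r: "0 \<le> r" "r < 1" "y = circle_of r"
      using circle_rep_bounds[of y] by (auto simp: r_def circle_of_circle_rep)
    show "\<exists>i. y = circle_of (branch q i t)"
    proof (cases "r < 1/2")
      case True
      have "expand q r < 1" using expand_less[OF q, of r "1/2"] True r by (simp add: expand_half)
      moreover have "0 \<le> expand q r" using expand_ge[of r q] r by simp
      moreover have "x = circle_of (expand q r)" using y T_map_circle_of[of r q] r True by simp
      ultimately have "t = expand q r" unfolding t_def by (simp add: circle_rep_of)
      then have "r = branch q False t" using branch_False_expand[OF q, of r] True r by simp
      then show ?thesis using r by blast
    next
      case False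
      have "expand q r = 2 * r" if "r \<le> 1/2"
      proof -
        have r2: "r = 1/2" using that False by linarith
        show ?thesis unfolding r2 expand_half by simp
      qed
      then have "x = circle_of (2 * r)" using y T_map_circle_of[of r q] r by auto
      then have "x = circle_of (2 * r - 1)" using circle_of_add_int[of "2 * r" "-1"] by simp
      then have "t = 2 * r - 1" unfolding t_def using False r by (simp add: circle_rep_of)
      then have "r = branch q True t" by (simp add: branch_True)
      then show ?thesis using r by blast
    qed
  next
    assume "\<exists>i. y = circle_of (branch q i t)"
    then obtain i where i: "y = circle_of (branch q i t)" by blast
    show "T_map q y = x"
    proof (cases i)
      case False
      then show ?thesis using i F t T_map_circle_of[of "branch q False t" q] by simp
    next
      case True
      show ?thesis
      proof (cases "t = 0")
        \<comment> \<open>For \<open>t = 0\<close> the preimage \<open>1/2\<close> falls under the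
          first formula of the map, which gives \<open>1\<close>, the same circle point as
          \<open>0\<close>.\<close>
        case True
        then show ?thesis
          using i \<open>i\<close> t T_map_circle_of[of "1/2" q] by (simp add: branch_True expand_half circle_of_1)
      next
        case False
        then have "T_map q (circle_of ((t + 1) / 2)) = circle_of (2 * ((t + 1) / 2))"
          using t T_map_circle_of[of "(t + 1) / 2" q] by simp
        also have "2 * ((t + 1) / 2) = t + 1" by simp
        also have "circle_of (t + 1) = x" using circle_of_add_int[of t 1] t by simp
        finally show ?thesis using i True by (simp add: branch_True)
      qed
    qed
  qed
  then show "T_map q -` {x} = (\<lambda>i. circle_of (branch q i (circle_rep x))) ` UNIV"
    unfolding t_def[symmetric] by auto
qed

subsection \<open>Transfer operator on the circle\<close>

context two_branches begin

text \<open>Probabilistic form of the iterate: the first branch is drawn with a Bernoulli law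
  proportional to the two weights, then the remaining steps follow. It provides actual probability
  measures for a compactness argument.\<close>

lemma L_weights_pmf:
  assumes "x \<in> {0..1}"
  shows "\<exists>M :: real pmf. finite (set_pmf M) \<and> set_pmf M \<subseteq> {0..1} \<and>
    (\<forall>F. (L ^^ n) F x = (L ^^ n) (\<lambda>_. 1) x * measure_pmf.expectation M F)"
  using assms
proof (induction n arbitrary: x)
  case 0
  then show ?case by (intro exI[of _ "return_pmf x"]) auto
next
  case (Suc n)
  have b: "br i x \<in> {0..1}" for i using br_in Suc.prems .
  have "\<exists>M :: real pmf. finite (set_pmf M) \<and> set_pmf M \<subseteq> {0..1} \<and>
    (\<forall>F. (L ^^ n) F (br i x) = (L ^^ n) (\<lambda>_. 1) (br i x) * measure_pmf.expectation M F)" for i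
    using Suc.IH[OF b] .
  then obtain M :: "bool \<Rightarrow> real pmf" where M: "\<And>i. finite (set_pmf (M i))" "\<And>i. set_pmf (M i) \<subseteq> {0..1}"
    "\<And>i F. (L ^^ n) F (br i x) = (L ^^ n) (\<lambda>_. 1) (br i x) * measure_pmf.expectation (M i) F"
    by metis
  define w where "w i = exp (a (br i x)) * (L ^^ n) (\<lambda>_. 1) (br i x)" for i
  have w: "0 < w i" for i
    using admissible_pos[OF admissible_L[OF admissible_const[of 1]] b] by (simp add: w_def)
  define p where "p = w True / (w True + w False)"
  have p: "0 \<le> p" "p \<le> 1" using w[of True] w[of False] by (auto simp: p_def divide_le_eq)
  let ?M = "bind_pmf (bernoulli_pmf p) M"
  have one: "(L ^^ Suc n) (\<lambda>_. 1) x = w True + w False"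
    by (simp add: L_def[of "(L ^^ n) (\<lambda>_. 1)"] w_def UNIV_bool add.commute)
  have "(L ^^ Suc n) F x = (L ^^ Suc n) (\<lambda>_. 1) x * measure_pmf.expectation ?M F" for F
  proof -
    have "measure_pmf.expectation ?M F = (\<Sum>i\<in>UNIV. pmf (bernoulli_pmf p) i *\<^sub>R measure_pmf.expectation (M i) F)"
      using M by (intro pmf_expectation_bind) auto
    also have "\<dots> = p * measure_pmf.expectation (M True) F + (1 - p) * measure_pmf.expectation (M False) F"
      using p by (simp add: UNIV_bool)
    finally have "(w True + w False) * measure_pmf.expectation ?M F
       = ((w True + w False) * p) * measure_pmf.expectation (M True) F
       + ((w True + w False) * (1 - p)) * measure_pmf.expectation (M False) F"
      by (simp only: distrib_left mult.assoc)
    also have "(w True + w False) * p = w True"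
      using w[of True] w[of False] by (simp add: p_def)
    also have "(w True + w False) * (1 - p) = w False"
      using w[of True] w[of False] by (simp add: p_def field_simps)
    also have "w True * measure_pmf.expectation (M True) F + w False * measure_pmf.expectation (M False) F
       = (\<Sum>i\<in>UNIV. exp (a (br i x)) * (L ^^ n) F (br i x))"
      using M(3)[of F True] M(3)[of F False] by (simp add: UNIV_bool w_def mult.assoc)
    finally show ?thesis unfolding one by (simp add: L_def[of "(L ^^ n) F"])
  qed
  moreover have "finite (set_pmf ?M)" "set_pmf ?M \<subseteq> {0..1}" using M by auto
  ultimately show ?case by blast
qed

end

locale intermittent = log_branches "branch q" "\<lambda>t. A (circle_of t)" V C B s r0
  for q :: real and A :: "circle \<Rightarrow> real" and V C B s r0 +
  assumes q: "0 < q" "q < 1" and V_cont: "continuous_on {0..} V"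
begin

abbreviation LT :: "(circle \<Rightarrow> real) \<Rightarrow> circle \<Rightarrow> real" where
  "LT \<equiv> transfer_op (T_map q) A"

abbreviation lift :: "(circle \<Rightarrow> real) \<Rightarrow> real \<Rightarrow> real" where
  "lift f \<equiv> \<lambda>t. f (circle_of t)"

abbreviation X :: "(circle \<Rightarrow> real) set" where
  "X \<equiv> holder_space V"

text \<open>Passing from \<open>t = 0\<close> to \<open>t = 1\<close> exchanges the two branches and
  leaves the preimages on the circle unchanged, so the interval operator respects the identification
  of the endpoints.\<close>

lemma transfer_circle_of:
  assumes "t \<in> {0..1}"
  shows "LT f (circle_of t) = L (lift f) t"
proof -
  have rep: "LT f x = L (lift f) (circle_rep x)" for x
    unfolding transfer_op_def T_map_vimage(1)[OF q(1)] L_def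
    by (subst sum.reindex[OF T_map_vimage(2)[OF q(1)]]) simp
  show ?thesis
  proof (cases "t = 1")
    case True
    have "L (lift f) 1 = L (lift f) 0"
      by (simp add: L_def UNIV_bool branch_True branch_ends[OF q(1)] circle_of_1)
    then show ?thesis using True rep[of "circle_of 0"] by (simp add: circle_of_1 circle_rep_of)
  next
    case False
    then show ?thesis using assms rep[of "circle_of t"] by (simp add: circle_rep_of)
  qed
qed

lemma transfer_pow_circle_of:
  "t \<in> {0..1} \<Longrightarrow> (LT ^^ n) f (circle_of t) = (L ^^ n) (lift f) t"
proof (induction n arbitrary: t)
  case (Suc n)
  have "(LT ^^ Suc n) f (circle_of t) = L (lift ((LT ^^ n) f)) t"
    using transfer_circle_of[OF Suc.prems] by simp
  also have "\<dots> = L ((L ^^ n) (lift f)) t"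
    using Suc.IH branch_in[OF q(1) Suc.prems]
    by (simp add: L_def[of "lift ((LT ^^ n) f)"] L_def[of "(L ^^ n) (lift f)"])
  finally show ?case by simp
qed simp

lemma circle_rep_in: "circle_rep x \<in> {0..1}"
  using circle_rep_bounds[of x] by simp

lemma transfer_pow: "(LT ^^ n) f x = (L ^^ n) (lift f) (circle_rep x)"
  using transfer_pow_circle_of[OF circle_rep_in[of x], of n f] by (simp add: circle_of_circle_rep)

section \<open>Hoelder functions on the circle\<close>

lemma V_pos: "r \<in> {0<..1} \<Longrightarrow> 0 < V r"
  using r0 by (subst V_eq) (auto simp: divide_simps)

text \<open>Two points at distance \<open>1/2\<close>, where \<open>V\<close> is positive, exclude
  negative constants; hence \<open>holder_const\<close> is an infimum over a set bounded
  below.\<close>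

lemma holder_bound_nonneg:
  fixes f :: "circle \<Rightarrow> real"
  assumes "\<And>x y. \<bar>f x - f y\<bar> \<le> K * V (dist x y)"
  shows "0 \<le> K"
proof -
  have d: "dist (circle_of 0) (circle_of (1/2)) = 1/2"
    by (simp add: dist_circle_def circle_rep_of)
  have "0 \<le> K * V (1/2)"
    using order_trans[OF abs_ge_zero assms[of "circle_of 0" "circle_of (1/2)"]] unfolding d .
  then show "0 \<le> K" using V_pos[of "1/2"] by (simp add: zero_le_mult_iff)
qed

lemma holder_const_nonneg:
  fixes f :: "circle \<Rightarrow> real"
  assumes "f \<in> X"
  shows "0 \<le> holder_const V f"
  unfolding holder_const_def
proof (rule cInf_greatest)
  show "{K. \<forall>x y. \<bar>f x - f y\<bar> \<le> K * V (dist x y)} \<noteq> {}"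
    using assms by (auto simp: holder_space_def)
qed (use holder_bound_nonneg in blast)

lemma holder_constD:
  fixes f :: "circle \<Rightarrow> real"
  assumes "f \<in> X"
  shows "\<bar>f x - f y\<bar> \<le> holder_const V f * V (dist x y)"
proof (cases "V (dist x y) = 0")
  case True
  obtain K where "\<And>x y. \<bar>f x - f y\<bar> \<le> K * V (dist x y)"
    using assms by (auto simp: holder_space_def)
  from this[of x y] show ?thesis using True by simp
next
  case False
  then have V: "0 < V (dist x y)" using V_nonneg[of "dist x y"] by simp
  have "\<bar>f x - f y\<bar> / V (dist x y) \<le> holder_const V f"
    unfolding holder_const_def
  proof (rule cInf_greatest)
    show "{K. \<forall>x y. \<bar>f x - f y\<bar> \<le> K * V (dist x y)} \<noteq> {}"
      using assms by (auto simp: holder_space_def)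
    show "\<bar>f x - f y\<bar> / V (dist x y) \<le> K" if "K \<in> {K. \<forall>x y. \<bar>f x - f y\<bar> \<le> K * V (dist x y)}" for K
      using that V by (simp add: divide_le_eq)
  qed
  then show ?thesis using V by (simp add: divide_le_eq)
qed

lemma holder_const_le:
  fixes f :: "circle \<Rightarrow> real"
  assumes K: "\<And>x y. \<bar>f x - f y\<bar> \<le> K * V (dist x y)"
  shows "f \<in> X" "holder_const V f \<le> K"
proof -
  show "f \<in> X" using K by (auto simp: holder_space_def)
  have "bdd_below {K. \<forall>x y. \<bar>f x - f y\<bar> \<le> K * V (dist x y)}"
    by (rule bdd_belowI[of _ 0]) (use holder_bound_nonneg in blast)
  then show "holder_const V f \<le> K"
    unfolding holder_const_def using K by (intro cInf_lower) auto
qed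

lemma holder_lift:
  assumes "f \<in> X"
  shows "holder (holder_const V f) (lift f)"
  unfolding holder_def
proof (intro ballI)
  fix t t' :: real
  have "\<bar>f (circle_of t) - f (circle_of t')\<bar> \<le> holder_const V f * V (dist (circle_of t) (circle_of t'))"
    by (rule holder_constD[OF assms])
  also have "\<dots> \<le> holder_const V f * V \<bar>t - t'\<bar>"
    using holder_const_nonneg[OF assms] by (intro mult_left_mono V_le dist_circle_of_le) auto
  finally show "\<bar>f (circle_of t) - f (circle_of t')\<bar> \<le> holder_const V f * V \<bar>t - t'\<bar>" .
qed

lemma holder_liftD:
  assumes H: "0 \<le> H" and f: "holder H (lift f)"
  shows "f \<in> X" "holder_const V f \<le> 2 * H"
proof -
  have "\<bar>f x - f y\<bar> \<le> 2 * H * V (dist x y)" for x y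
    using f V_0 by (intro holder_circleI[where V = V] H V_le) (auto simp: holder_def)
  from holder_const_le[OF this] show "f \<in> X" "holder_const V f \<le> 2 * H" .
qed

lemma X_bounded:
  assumes "f \<in> X"
  shows "bdd_above (range (\<lambda>x. \<bar>f x\<bar>))" "\<bar>f x\<bar> \<le> (SUP x. \<bar>f x\<bar>)" "0 \<le> (SUP x. \<bar>f x\<bar>)"
proof -
  show bdd: "bdd_above (range (\<lambda>x. \<bar>f x\<bar>))"
  proof (rule bdd_aboveI2)
    fix x
    have "\<bar>f (circle_of (circle_rep x)) - f (circle_of 0)\<bar> \<le> holder_const V f * V 1"
      using holder_osc[OF holder_lift[OF assms] holder_const_nonneg[OF assms] circle_rep_in[of x], of 0] by simp
    then show "\<bar>f x\<bar> \<le> \<bar>f (circle_of 0)\<bar> + holder_const V f * V 1"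
      by (simp add: circle_of_circle_rep)
  qed
  show "\<bar>f x\<bar> \<le> (SUP x. \<bar>f x\<bar>)" for x by (rule cSUP_upper[OF _ bdd]) simp
  from order_trans[OF abs_ge_zero this[of undefined]] show "0 \<le> (SUP x. \<bar>f x\<bar>)" .
qed

lemma holder_prod:
  assumes F: "holder H F" "\<And>t. t \<in> {0..1} \<Longrightarrow> \<bar>F t\<bar> \<le> S" and G: "holder H' G" "\<And>t. t \<in> {0..1} \<Longrightarrow> \<bar>G t\<bar> \<le> S'"
    and "0 \<le> H" "0 \<le> H'"
  shows "holder (S * H' + S' * H) (\<lambda>t. F t * G t)"
  unfolding holder_def
proof (intro ballI)
  fix x y :: real assume xy: "x \<in> {0..1}" "y \<in> {0..1}"
  have V: "0 \<le> V \<bar>x - y\<bar>" by (simp add: V_nonneg)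
  have "F x * G x - F y * G y = F x * (G x - G y) + G y * (F x - F y)" by (simp add: algebra_simps)
  then have "\<bar>F x * G x - F y * G y\<bar> \<le> \<bar>F x\<bar> * \<bar>G x - G y\<bar> + \<bar>G y\<bar> * \<bar>F x - F y\<bar>"
    by (metis abs_mult abs_triangle_ineq)
  also have "\<dots> \<le> S * (H' * V \<bar>x - y\<bar>) + S' * (H * V \<bar>x - y\<bar>)"
    using xy F G assms(5,6) V order_trans[OF abs_ge_zero F(2)[OF xy(1)]] order_trans[OF abs_ge_zero G(2)[OF xy(1)]]
    by (intro add_mono mult_mono) (auto simp: holder_def)
  finally show "\<bar>F x * G x - F y * G y\<bar> \<le> (S * H' + S' * H) * V \<bar>x - y\<bar>"
    by (simp add: algebra_simps)
qed

lemma X_mult: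
  assumes "f \<in> X" "g \<in> X"
  shows "(\<lambda>x. f x * g x) \<in> X"
proof -
  have "holder ((SUP x. \<bar>f x\<bar>) * holder_const V g + (SUP x. \<bar>g x\<bar>) * holder_const V f) (\<lambda>t. lift f t * lift g t)"
    using assms by (intro holder_prod holder_lift X_bounded holder_const_nonneg)
  then show ?thesis
    using assms by (intro holder_liftD(1)) (auto intro!: X_bounded(3) holder_const_nonneg add_nonneg_nonneg mult_nonneg_nonneg)
qed

lemma X_add:
  assumes "f \<in> X" "g \<in> X"
  shows "(\<lambda>x. f x + g x) \<in> X"
proof (rule holder_const_le(1)[where K = "holder_const V f + holder_const V g"])
  show "\<bar>f x + g x - (f y + g y)\<bar> \<le> (holder_const V f + holder_const V g) * V (dist x y)" for x y
    using holder_constD[OF assms(1), of x y] holder_constD[OF assms(2), of x y] by (simp add: algebra_simps)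
qed

lemma X_const: "(\<lambda>_. c) \<in> X"
  by (rule holder_const_le(1)[where K = 0]) auto

lemma X_cmult: "f \<in> X \<Longrightarrow> (\<lambda>x. c * f x) \<in> X"
  using X_mult[OF X_const] .

text \<open>Concavity and \<open>V 0 = 0\<close> give \<open>d * V 1 \<le> V d\<close> on
  \<open>[0, 1]\<close>. This supplies enough test functions in \<open>X\<close> to determine a
  measure.\<close>

lemma X_lipschitz:
  assumes K: "0 \<le> K" "\<And>x y. \<bar>f x - f y\<bar> \<le> K * dist x y"
  shows "f \<in> X"
proof (rule holder_const_le(1)[where K = "K / V 1"])
  fix x y :: circle
  define d where "d = dist x y"
  have d: "0 \<le> d" "d \<le> 1" using dist_circle_le_half[of x y] by (auto simp: d_def)
  have "(1 - d) * V 0 + d * V 1 \<le> V ((1 - d) *\<^sub>R 0 + d *\<^sub>R 1)"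
    using d by (intro concave_onD[OF V_concave]) auto
  then have "d * V 1 \<le> V d" using V_0 by simp
  then have "K * (d * V 1) \<le> K * V d" using K by (intro mult_left_mono)
  then have "K * d \<le> K / V 1 * V d" using V_pos[of 1] by (simp add: field_simps)
  then show "\<bar>f x - f y\<bar> \<le> K / V 1 * V (dist x y)" using K(2)[of x y] by (simp add: d_def)
qed

lemma X_continuous:
  assumes "f \<in> X"
  shows "continuous_on UNIV f"
proof -
  have "(f \<longlongrightarrow> f x) (at x)" for x
  proof (rule LIM_zero_cancel, rule Lim_null_comparison)
    have "((\<lambda>y. V (dist y x)) \<longlongrightarrow> V 0) (at x)"
    proof (rule continuous_on_tendsto_compose[OF V_cont])
      show "((\<lambda>y. dist y x) \<longlongrightarrow> 0) (at x)"
        using tendsto_dist[OF tendsto_ident_at[of x UNIV] tendsto_const[of x]] by simp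
    qed auto
    then have "((\<lambda>y. holder_const V f * V (dist y x)) \<longlongrightarrow> holder_const V f * V 0) (at x)"
      by (intro tendsto_intros)
    then show "((\<lambda>y. holder_const V f * V (dist y x)) \<longlongrightarrow> 0) (at x)" using V_0 by simp
    show "\<forall>\<^sub>F y in at x. norm (f y - f x) \<le> holder_const V f * V (dist y x)"
      using holder_constD[OF assms] by (intro always_eventually) simp
  qed
  then show ?thesis by (simp add: continuous_on_def)
qed

lemma X_borel: "f \<in> X \<Longrightarrow> f \<in> borel_measurable borel"
  by (intro borel_measurable_continuous_onI X_continuous)

lemma X_integrable:
  assumes "f \<in> X" "finite_measure \<nu>" "sets \<nu> = sets borel"
  shows "integrable \<nu> f"
proof -
  interpret finite_measure \<nu> by fact
  have "f \<in> borel_measurable \<nu>"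
    using X_borel[OF assms(1)] measurable_cong_sets[OF assms(3) refl] by auto
  then show ?thesis
    using X_bounded(2)[OF assms(1)] by (intro integrable_const_bound[of _ "SUP x. \<bar>f x\<bar>"]) auto
qed

text \<open>Unlike the cone estimates, this concerns functions of arbitrary sign and a single step;
  it makes \<open>LT\<close> act continuously on \<open>X\<close>.\<close>

lemma holder_L:
  assumes F: "holder H F" "\<And>t. t \<in> {0..1} \<Longrightarrow> \<bar>F t\<bar> \<le> S" and "0 \<le> H" "0 \<le> S"
  shows "holder (2 * exp B * (H + S * C)) (L F)"
  unfolding holder_def
proof (intro ballI)
  fix x y :: real assume xy: "x \<in> {0..1}" "y \<in> {0..1}"
  let ?d = "V \<bar>x - y\<bar>"
  have V: "0 \<le> ?d" by (simp add: V_nonneg)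
  have "\<bar>L F x - L F y\<bar> \<le> (\<Sum>i\<in>UNIV. \<bar>exp (A (circle_of (branch q i x))) * F (branch q i x)
      - exp (A (circle_of (branch q i y))) * F (branch q i y)\<bar>)"
    unfolding L_def sum_subtractf[symmetric] by (rule sum_abs)
  also have "\<dots> \<le> (\<Sum>i\<in>(UNIV::bool set). exp B * (H + S * C) * ?d)"
  proof (rule sum_mono)
    fix i
    have b: "branch q i x \<in> {0..1}" "branch q i y \<in> {0..1}" using br_in xy by auto
    let ?a = "A (circle_of (branch q i x))" and ?b = "A (circle_of (branch q i y))"
    let ?F = "F (branch q i x)" and ?G = "F (branch q i y)"
    have ab: "\<bar>?a - ?b\<bar> \<le> C * ?d"
    proof -
      have "\<bar>?a - ?b\<bar> \<le> C * (?d - V (\<bar>branch q i x - branch q i y\<bar>))" by (rule flat[OF xy])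
      also have "\<dots> \<le> C * ?d" using C_nonneg V_nonneg by (intro mult_left_mono) auto
      finally show ?thesis .
    qed
    have e: "\<bar>exp ?a - exp ?b\<bar> \<le> exp B * \<bar>?a - ?b\<bar>"
    proof -
      have *: "exp a - exp b \<le> exp B * \<bar>a - b\<bar>" if "\<bar>a\<bar> \<le> B" for a b :: real
      proof -
        have "exp a - exp b = exp a * (1 - exp (b - a))" by (simp add: algebra_simps flip: exp_add)
        also have "\<dots> \<le> exp a * \<bar>a - b\<bar>"
        proof (rule mult_left_mono)
          show "1 - exp (b - a) \<le> \<bar>a - b\<bar>" using exp_ge_add_one_self[of "b - a"] by linarith
        qed simp
        also have "\<dots> \<le> exp B * \<bar>a - b\<bar>" using that by (intro mult_right_mono) auto
        finally show ?thesis .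
      qed
      show ?thesis
        using *[of ?a ?b] *[of ?b ?a] a_bound[OF b(1)] a_bound[OF b(2)] by (simp add: abs_minus_commute)
    qed
    have "exp ?a * ?F - exp ?b * ?G = exp ?a * (?F - ?G) + ?G * (exp ?a - exp ?b)"
      by (simp add: algebra_simps)
    then have "\<bar>exp ?a * ?F - exp ?b * ?G\<bar> \<le> exp ?a * \<bar>?F - ?G\<bar> + \<bar>?G\<bar> * \<bar>exp ?a - exp ?b\<bar>"
      by (metis abs_mult abs_triangle_ineq abs_exp_cancel)
    also have "\<dots> \<le> exp B * (H * ?d) + S * (exp B * (C * ?d))"
    proof (intro add_mono mult_mono)
      show "exp ?a \<le> exp B" using a_bound[OF b(1)] by simp
      have "\<bar>?F - ?G\<bar> \<le> H * V \<bar>branch q i x - branch q i y\<bar>" using F(1) b by (simp add: holder_def)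
      also have "\<dots> \<le> H * ?d" using assms(3) br_dist[OF xy, of i] by (intro mult_left_mono V_le) auto
      finally show "\<bar>?F - ?G\<bar> \<le> H * ?d" .
      show "\<bar>?G\<bar> \<le> S" by (rule F(2)[OF b(2)])
      have "exp B * \<bar>?a - ?b\<bar> \<le> exp B * (C * ?d)" using ab by (intro mult_left_mono) auto
      then show "\<bar>exp ?a - exp ?b\<bar> \<le> exp B * (C * ?d)" using e by linarith
    qed (use assms in auto)
    finally show "\<bar>exp ?a * ?F - exp ?b * ?G\<bar> \<le> exp B * (H + S * C) * ?d"
      by (simp add: algebra_simps)
  qed
  finally show "\<bar>L F x - L F y\<bar> \<le> 2 * exp B * (H + S * C) * ?d" by simp
qed

lemma X_transfer:
  assumes f: "f \<in> X"
  shows "LT f \<in> X" "holder_norm V (LT f) \<le> (2 * exp B + 4 * exp B * (1 + C)) * holder_norm V f"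
proof -
  define S where "S = (SUP x. \<bar>f x\<bar>)"
  define H where "H = holder_const V f"
  have S: "\<bar>f x\<bar> \<le> S" "0 \<le> S" for x using X_bounded[OF f] by (auto simp: S_def)
  have H: "0 \<le> H" "holder H (lift f)" using holder_const_nonneg[OF f] holder_lift[OF f] by (auto simp: H_def)
  have SH: "0 \<le> exp B * (H + S * C)" using S H C_nonneg by simp
  have "holder (2 * exp B * (H + S * C)) (L (lift f))" by (rule holder_L[OF H(2) S(1) H(1) S(2)])
  then have "holder (2 * exp B * (H + S * C)) (lift (LT f))"
    using transfer_circle_of by (simp add: holder_def)
  from holder_liftD[OF _ this] SH
  have 1: "LT f \<in> X" "holder_const V (LT f) \<le> 4 * exp B * (H + S * C)" by auto
  have "(SUP x. \<bar>LT f x\<bar>) \<le> 2 * exp B * S"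
  proof (rule cSUP_least)
    fix x
    have "\<bar>LT f x\<bar> \<le> (\<Sum>i\<in>UNIV. \<bar>exp (A (circle_of (branch q i (circle_rep x)))) * lift f (branch q i (circle_rep x))\<bar>)"
      using transfer_pow[of 1 f x] by (simp add: L_def sum_abs)
    also have "\<dots> \<le> (\<Sum>i\<in>(UNIV::bool set). exp B * S)"
      using a_bound[OF br_in[OF circle_rep_in]] S
      by (intro sum_mono) (auto simp: abs_mult abs_le_iff intro!: mult_mono)
    finally show "\<bar>LT f x\<bar> \<le> 2 * exp B * S" by simp
  qed simp
  then have "holder_norm V (LT f) \<le> 2 * exp B * S + 4 * exp B * (H + S * C)"
    using 1 by (simp add: holder_norm_def)
  also have "\<dots> \<le> (2 * exp B + 4 * exp B * (1 + C)) * (S + H)"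
  proof -
    have "0 \<le> exp B * S" "0 \<le> exp B * H" "0 \<le> exp B * (C * H)" using S H C_nonneg by auto
    then show ?thesis by (simp add: algebra_simps)
  qed
  finally show "holder_norm V (LT f) \<le> (2 * exp B + 4 * exp B * (1 + C)) * holder_norm V f"
    by (simp add: holder_norm_def S_def H_def)
  show "LT f \<in> X" by fact
qed

lemma transfer_acts_continuously: "acts_continuously LT X (holder_norm V)"
  unfolding acts_continuously_def using X_transfer by blast

lemma X_transfer_pow: "f \<in> X \<Longrightarrow> (LT ^^ n) f \<in> X"
  by (induction n) (auto intro: X_transfer)

lemma transfer_pow_pos:
  assumes "admissible (lift u)"
  shows "0 < (LT ^^ n) u x"
  unfolding transfer_pow using admissible_pos[OF admissible_L[OF assms] circle_rep_in] .

lemma transfer_pow_scale: "(LT ^^ n) (\<lambda>x. c * f x) x = c * (LT ^^ n) f x"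
  unfolding transfer_pow by (rule L_scale)

lemma transfer_pow_mono: "(\<And>x. f x \<le> g x) \<Longrightarrow> (LT ^^ n) f x \<le> (LT ^^ n) g x"
  unfolding transfer_pow by (rule L_mono) (use circle_rep_in in auto)

lemma transfer_decay:
  obtains c where "0 \<le> c"
    "\<And>u f n x y. admissible (lift u) \<Longrightarrow> f \<in> X \<Longrightarrow> 1 \<le> n \<Longrightarrow>
      \<bar>(LT ^^ n) (\<lambda>x. u x * f x) x / (LT ^^ n) u x - (LT ^^ n) (\<lambda>x. u x * f x) y / (LT ^^ n) u y\<bar>
      \<le> holder_const V f * (c / real n powr s)"
proof (rule normalized_decay)
  fix c assume c: "0 \<le> c" "\<And>u f H n x y. admissible u \<Longrightarrow> holder H f \<Longrightarrow> 0 \<le> H \<Longrightarrow> 1 \<le> n \<Longrightarrow>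
      x \<in> {0..1} \<Longrightarrow> y \<in> {0..1} \<Longrightarrow>
      normalized u f n x - normalized u f n y \<le> H * (c / real n powr s)"
  show thesis
  proof (rule that[OF c(1)])
    fix u f and n :: nat and x y
    assume *: "admissible (lift u)" "f \<in> X" "1 \<le> n"
    have "normalized (lift u) (lift f) n (circle_rep x) - normalized (lift u) (lift f) n (circle_rep y)
      \<le> holder_const V f * (c / real n powr s)" for x y
      using * by (intro c(2) holder_lift holder_const_nonneg circle_rep_in)
    from this[of x y] this[of y x]
    show "\<bar>(LT ^^ n) (\<lambda>x. u x * f x) x / (LT ^^ n) u x - (LT ^^ n) (\<lambda>x. u x * f x) y / (LT ^^ n) u y\<bar>
      \<le> holder_const V f * (c / real n powr s)"
      by (simp add: normalized_def transfer_pow)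
  qed
qed

end

subsection \<open>Eigenmeasure and eigenfunction\<close>

text \<open>Closed sets form an intersection-stable generator, and the indicator of a nonempty
  closed set is the limit of the Lipschitz functions
  \<open>max 0 (1 - real n * infdist x F)\<close>.\<close>

lemma finite_measure_eqI_lipschitz:
  fixes M N :: "'a::metric_space measure"
  assumes M: "finite_measure M" "sets M = sets borel" and N: "finite_measure N" "sets N = sets borel"
    and eq: "\<And>g K. 0 \<le> K \<Longrightarrow> (\<And>x y. \<bar>g x - g y\<bar> \<le> K * dist x y) \<Longrightarrow> (\<integral>x. g x \<partial>M) = (\<integral>x. g x \<partial>N)"
  shows "M = N"
proof -
  interpret M: finite_measure M by fact
  interpret N: finite_measure N by fact
  have lim: "(\<lambda>n. \<integral>x. max 0 (1 - real n * infdist x F) \<partial>P) \<longlonglongrightarrow> measure P F"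
    if F: "closed F" "F \<noteq> {}" and P: "finite_measure P" "sets P = sets borel" for F and P :: "'a measure"
  proof -
    interpret P: finite_measure P by fact
    have FP: "F \<in> sets P" using F P by simp
    have "(\<lambda>n. \<integral>x. max 0 (1 - real n * infdist x F) \<partial>P) \<longlonglongrightarrow> (\<integral>x. indicat_real F x \<partial>P)"
    proof (rule integral_dominated_convergence[where w = "\<lambda>_. 1"])
      show "(\<lambda>x. max 0 (1 - real n * infdist x F)) \<in> borel_measurable P" for n
        unfolding measurable_cong_sets[OF P(2) refl]
        by (intro borel_measurable_continuous_onI continuous_intros)
      show "AE x in P. (\<lambda>n. max 0 (1 - real n * infdist x F)) \<longlonglongrightarrow> indicat_real F x"
      proof (rule AE_I2)
        fix x
        show "(\<lambda>n. max 0 (1 - real n * infdist x F)) \<longlonglongrightarrow> indicat_real F x"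
        proof (cases "x \<in> F")
          case False
          then have "0 < infdist x F"
            using F in_closed_iff_infdist_zero[OF F] infdist_nonneg[of x F] by (simp add: less_le)
          then have "(\<lambda>n. max 0 (1 - real n * infdist x F)) \<longlonglongrightarrow> 0" by real_asymp
          then show ?thesis using False by simp
        qed simp
      qed
      show "AE x in P. norm (max 0 (1 - real n * infdist x F)) \<le> 1" for n
        by (intro AE_I2) (simp add: infdist_nonneg)
      show "indicat_real F \<in> borel_measurable P" using FP by simp
    qed simp
    then show ?thesis using FP by (simp add: P.emeasure_finite)
  qed
  \<comment> \<open>The empty set is treated apart because \<open>infdist\<close> to it is
    \<open>0\<close> by convention, so that the approximants would be constantly
    \<open>1\<close>.\<close>
  have meas: "measure M F = measure N F" if "closed F" for F
  proof (cases "F = {}")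
    case False
    have "(\<integral>x. max 0 (1 - real n * infdist x F) \<partial>M) = (\<integral>x. max 0 (1 - real n * infdist x F) \<partial>N)" for n
    proof (rule eq)
      fix x y
      have "\<bar>infdist x F - infdist y F\<bar> \<le> dist x y"
        using infdist_triangle[of x F y] infdist_triangle[of y F x] by (simp add: dist_commute abs_le_iff)
      then have "real n * \<bar>infdist x F - infdist y F\<bar> \<le> real n * dist x y" by (intro mult_left_mono) auto
      then have "\<bar>real n * infdist x F - real n * infdist y F\<bar> \<le> real n * dist x y"
        by (simp add: abs_mult flip: right_diff_distrib)
      then show "\<bar>max 0 (1 - real n * infdist x F) - max 0 (1 - real n * infdist y F)\<bar> \<le> real n * dist x y"
        by linarith
    qed simp
    then show ?thesis
      using LIMSEQ_unique[OF lim[OF that False M]] lim[OF that False N] by simp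
  qed simp
  show "M = N"
  proof (rule measure_eqI_generator_eq[where E = "Collect closed" and \<Omega> = UNIV and A = "\<lambda>_. UNIV"])
    show "Int_stable (Collect closed :: 'a set set)" by (auto intro: Int_stableI)
    show "sets M = sigma_sets UNIV (Collect closed)" "sets N = sigma_sets UNIV (Collect closed)"
      unfolding M N borel_eq_closed by simp_all
    show "emeasure M X = emeasure N X" if "X \<in> Collect closed" for X
      using meas[of X] that by (simp add: M.emeasure_eq_measure N.emeasure_eq_measure)
  qed auto
qed

lemma continuous_circle_of: "continuous_on UNIV circle_of"
  by (rule lipschitz_on_continuous_on[OF lipschitz_onI[of _ _ 1]])
     (use dist_circle_of_le in \<open>auto simp: dist_real_def\<close>)

context intermittent begin

lemma T_borel: "T_map q \<in> borel_measurable borel"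
  by (intro borel_measurable_continuous_onI lipschitz_on_continuous_on[OF lipschitz_onI[of _ _ 3]])
     (use dist_T_map_le[OF q] in auto)

text \<open>The normalized iterates at \<open>0\<close> are probability measures on
  \<open>[0, 1]\<close>, hence tight; a weak limit of a subsequence is pushed forward to the circle.
  The decay of oscillation later upgrades the convergence to the full sequence and to every base
  point.\<close>

lemma conformal_measure:
  obtains \<nu> r where "sets \<nu> = sets borel" "prob_space \<nu>" "strict_mono r"
    "\<And>f. f \<in> X \<Longrightarrow> (\<lambda>n. (LT ^^ r n) f (circle_of 0) / (LT ^^ r n) (\<lambda>_. 1) (circle_of 0))
      \<longlonglongrightarrow> (\<integral>x. f x \<partial>\<nu>)"
proof -
  have "\<exists>M :: real pmf. finite (set_pmf M) \<and> set_pmf M \<subseteq> {0..1} \<and>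
    (\<forall>F. (L ^^ n) F 0 = (L ^^ n) (\<lambda>_. 1) 0 * measure_pmf.expectation M F)" for n
    by (rule L_weights_pmf) simp
  then obtain M where M: "\<And>n. set_pmf (M n) \<subseteq> {0..1}"
    "\<And>n F. (L ^^ n) F 0 = (L ^^ n) (\<lambda>_. 1) 0 * measure_pmf.expectation (M n) F" by metis
  define \<mu> where "\<mu> n = distr (measure_pmf (M n)) borel (\<lambda>x. x)" for n
  have rd: "real_distribution (\<mu> n)" for n
    unfolding \<mu>_def by (rule prob_space.real_distribution_distr[OF prob_space_measure_pmf]) simp
  \<comment> \<open>Tightness speaks of intervals open on the left; starting at \<open>-1\<close>
    keeps a possible atom at \<open>0\<close> inside.\<close>
  have "measure (\<mu> n) {-1<..1} = 1" for n
  proof -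
    have "measure (\<mu> n) {-1<..1} = measure_pmf.prob (M n) {-1<..1}"
      by (simp add: \<mu>_def measure_distr)
    also have "\<dots> = 1" using M(1)[of n] by (auto simp: measure_pmf.prob_eq_1 AE_measure_pmf_iff)
    finally show ?thesis .
  qed
  then have "tight \<mu>"
    unfolding tight_def using rd
    by (intro conjI allI impI exI[of _ "-1"] exI[of _ 1]) auto
  from tight_imp_convergent_subsubsequence[OF this strict_mono_id]
  obtain r N where r: "strict_mono (r :: nat \<Rightarrow> nat)" and N: "real_distribution N"
    and conv: "weak_conv_m (\<mu> \<circ> r) N" by auto
  interpret N: real_distribution N by fact
  define \<nu> where "\<nu> = distr N borel circle_of"
  have cm: "circle_of \<in> borel_measurable N"
    using borel_measurable_continuous_onI[OF continuous_circle_of]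
      measurable_cong_sets[OF N.events_eq_borel refl] by auto
  show thesis
  proof (rule that[OF _ _ r])
    show "sets \<nu> = sets borel" by (simp add: \<nu>_def)
    show "prob_space \<nu>" unfolding \<nu>_def by (rule N.prob_space_distr[OF cm])
    fix f assume f: "f \<in> X"
    \<comment> \<open>\<open>circle_of\<close> is continuous on the whole line, so the lift is a
      bounded continuous test function without any cut-off at the ends of
      \<open>[0, 1]\<close>.\<close>
    have cont: "isCont (lift f) t" for t
      using continuous_on_compose2[OF X_continuous[OF f] continuous_circle_of]
      by (simp add: continuous_on_eq_continuous_at)
    have "(\<lambda>n. integral\<^sup>L ((\<mu> \<circ> r) n) (lift f)) \<longlonglongrightarrow> integral\<^sup>L N (lift f)"
      using X_bounded(2)[OF f] rd
      by (intro weak_conv_imp_integral_bdd_continuous_conv[OF _ N conv cont, of "SUP x. \<bar>f x\<bar>"]) auto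
    moreover have "integral\<^sup>L N (lift f) = (\<integral>x. f x \<partial>\<nu>)"
      unfolding \<nu>_def by (rule integral_distr[symmetric, OF cm X_borel[OF f]])
    moreover have "integral\<^sup>L ((\<mu> \<circ> r) n) (lift f)
        = (LT ^^ r n) f (circle_of 0) / (LT ^^ r n) (\<lambda>_. 1) (circle_of 0)" for n
    proof -
      have "lift f \<in> borel_measurable borel"
        using cont by (intro borel_measurable_continuous_onI continuous_at_imp_continuous_on) auto
      then have "integral\<^sup>L (\<mu> (r n)) (lift f) = measure_pmf.expectation (M (r n)) (lift f)"
        unfolding \<mu>_def by (subst integral_distr) auto
      moreover have "(LT ^^ r n) f (circle_of 0)
          = (LT ^^ r n) (\<lambda>_. 1) (circle_of 0) * measure_pmf.expectation (M (r n)) (lift f)"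
        using M(2)[of "r n" "lift f"] by (simp add: transfer_pow_circle_of)
      moreover have "0 < (LT ^^ r n) (\<lambda>_. 1) (circle_of 0)"
        by (rule transfer_pow_pos) (simp add: admissible_const)
      ultimately show ?thesis by simp
    qed
    ultimately show "(\<lambda>n. (LT ^^ r n) f (circle_of 0) / (LT ^^ r n) (\<lambda>_. 1) (circle_of 0))
      \<longlonglongrightarrow> (\<integral>x. f x \<partial>\<nu>)" by simp
  qed
qed

lemma admissible_transfer:
  assumes "admissible (lift u)"
  shows "admissible (lift ((LT ^^ n) u))"
  using admissible_L[OF assms, of n] by (simp add: admissible_def transfer_pow_circle_of)

lemma admissible_scale: "admissible u \<Longrightarrow> 0 < k \<Longrightarrow> admissible (\<lambda>t. k * u t)"
  by (simp add: admissible_def mult.left_commute)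

text \<open>A Harnack inequality whose constant is independent of the function; it will keep the
  normalized iterates of \<open>1\<close> away from zero and infinity.\<close>

lemma admissible_circle_le:
  assumes "admissible (lift u)"
  shows "u x \<le> exp (C * V 1) * u y" "0 < u x"
proof -
  have pos: "0 < u x" for x
    using admissible_pos[OF assms circle_rep_in[of x]] by (simp add: circle_of_circle_rep)
  then show "0 < u x" .
  have "u x \<le> exp (C * V (\<bar>circle_rep x - circle_rep y\<bar>)) * u y"
    using admissible_le[OF assms circle_rep_in[of x] circle_rep_in[of y]] by (simp add: circle_of_circle_rep)
  also have "\<dots> \<le> exp (C * V 1) * u y"
    using V_le_1[OF circle_rep_in[of x] circle_rep_in[of y]] C_nonneg pos[of y]
    by (intro mult_right_mono) (auto intro: mult_left_mono)
  finally show "u x \<le> exp (C * V 1) * u y" .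
qed

lemma admissible_X:
  assumes u: "admissible (lift u)" and S: "\<And>x. u x \<le> S"
  shows "u \<in> X" "holder_const V u \<le> 2 * (S * C)"
proof -
  have S0: "0 \<le> S" using admissible_circle_le(2)[OF u, of undefined] S[of undefined] by linarith
  have "holder (S * C) (lift u)"
  proof -
    have le: "lift u x - lift u y \<le> S * C * V \<bar>x - y\<bar>" if "x \<in> {0..1}" "y \<in> {0..1}" for x y
    proof -
      let ?z = "C * V \<bar>x - y\<bar>"
      have z: "0 \<le> ?z" using C_nonneg V_nonneg by simp
      have "lift u x \<le> exp ?z * lift u y" by (rule admissible_le[OF u that])
      then have "exp (- ?z) * lift u x \<le> lift u y" by (simp add: exp_minus field_simps)
      then have "lift u x - lift u y \<le> lift u x * (1 - exp (- ?z))" by (simp add: algebra_simps)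
      also have "\<dots> \<le> S * ?z"
        using exp_ge_add_one_self[of "- ?z"] S z S0 by (intro mult_mono) auto
      finally show ?thesis by (simp add: mult.assoc)
    qed
    show ?thesis unfolding holder_def
    proof (intro ballI)
      fix x y :: real assume "x \<in> {0..1}" "y \<in> {0..1}"
      then show "\<bar>lift u x - lift u y\<bar> \<le> S * C * V \<bar>x - y\<bar>"
        using le[of x y] le[of y x] by (simp add: abs_le_iff abs_minus_commute)
    qed
  qed
  from holder_liftD[OF _ this] show "u \<in> X" "holder_const V u \<le> 2 * (S * C)"
    using S0 C_nonneg by auto
qed

lemma RPF_exists: "\<exists>h \<rho> \<nu>. RPF_data (T_map q) A X h \<rho> \<nu>"
proof (rule transfer_decay, rule conformal_measure)
  fix c and \<nu> :: "circle measure" and r :: "nat \<Rightarrow> nat"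
  assume c: "0 \<le> c"
    and decay: "\<And>u f n x y. admissible (lift u) \<Longrightarrow> f \<in> X \<Longrightarrow> 1 \<le> n \<Longrightarrow>
      \<bar>(LT ^^ n) (\<lambda>x. u x * f x) x / (LT ^^ n) u x - (LT ^^ n) (\<lambda>x. u x * f x) y / (LT ^^ n) u y\<bar>
      \<le> holder_const V f * (c / real n powr s)"
    and \<nu>: "sets \<nu> = sets borel" "prob_space \<nu>" and r: "strict_mono r"
    and lim_r: "\<And>f. f \<in> X \<Longrightarrow>
      (\<lambda>n. (LT ^^ r n) f (circle_of 0) / (LT ^^ r n) (\<lambda>_. 1) (circle_of 0)) \<longlonglongrightarrow> (\<integral>x. f x \<partial>\<nu>)"
  interpret \<nu>: prob_space \<nu> by fact
  define u where "u n = (LT ^^ n) (\<lambda>_. 1)" for n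
  define R where "R n f x = (LT ^^ n) f x / u n x" for n f x
  define E where "E = exp (C * V 1)"
  define \<rho> where "\<rho> = (\<integral>x. LT (\<lambda>_. 1) x \<partial>\<nu>)"
  have E: "0 < E" by (simp add: E_def)
  have one: "admissible (lift (\<lambda>_. 1))" by (simp add: admissible_const)
  have u_adm: "admissible (lift (u n))" for n unfolding u_def by (rule admissible_transfer[OF one])
  have u_pos: "0 < u n x" for n x by (rule admissible_circle_le(2)[OF u_adm])
  have osc: "\<bar>R n f x - R n f y\<bar> \<le> holder_const V f * (c / real n powr s)"
    if "f \<in> X" "1 \<le> n" for n f x y
    using decay[OF one that] by (simp add: R_def u_def)
  \<comment> \<open>Positivity of \<open>LT\<close> makes upper and lower bounds of the ratio
    \<open>R n f\<close> persist in time. With the decay of oscillation this gives a Cauchy property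
    uniform over the circle.\<close>
  have "R (k + n) f z \<le> l" if "\<And>y. R n f y \<le> l" for k n f l z
  proof -
    have "(LT ^^ k) ((LT ^^ n) f) z \<le> (LT ^^ k) (\<lambda>y. l * u n y) z"
      using that u_pos by (intro transfer_pow_mono) (simp add: R_def divide_le_eq)
    then have "(LT ^^ (k + n)) f z \<le> l * u (k + n) z"
      by (simp add: transfer_pow_scale u_def funpow_add)
    then show ?thesis using u_pos by (simp add: R_def divide_le_eq)
  qed note R_upper = this
  have "l \<le> R (k + n) f z" if "\<And>y. l \<le> R n f y" for k n f l z
  proof -
    have "(LT ^^ k) (\<lambda>y. l * u n y) z \<le> (LT ^^ k) ((LT ^^ n) f) z"
      using that u_pos by (intro transfer_pow_mono) (simp add: R_def le_divide_eq)
    then have "l * u (k + n) z \<le> (LT ^^ (k + n)) f z"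
      by (simp add: transfer_pow_scale u_def funpow_add)
    then show ?thesis using u_pos by (simp add: R_def le_divide_eq)
  qed note R_lower = this
  have near: "\<bar>R (k + n) f z - R n f x\<bar> \<le> holder_const V f * (c / real n powr s)"
    if "f \<in> X" "1 \<le> n" for k n f z x
  proof -
    define e where "e = holder_const V f * (c / real n powr s)"
    have "R n f y \<le> R n f x + e" "R n f x - e \<le> R n f y" for y
      using osc[OF that, of y x] by (auto simp: e_def abs_le_iff)
    then have "R (k + n) f z \<le> R n f x + e" "R n f x - e \<le> R (k + n) f z"
      using R_upper R_lower by blast+
    then show ?thesis unfolding e_def[symmetric] by linarith
  qed
  have near_int: "\<bar>R n f x - (\<integral>x. f x \<partial>\<nu>)\<bar> \<le> holder_const V f * (c / real n powr s)"
    if "f \<in> X" "1 \<le> n" for n f x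
  proof (rule LIMSEQ_le_const2)
    show "(\<lambda>m. \<bar>R n f x - R (r m) f (circle_of 0)\<bar>) \<longlonglongrightarrow> \<bar>R n f x - (\<integral>x. f x \<partial>\<nu>)\<bar>"
      using lim_r[OF that(1)] unfolding R_def u_def by (intro tendsto_intros)
    show "\<exists>N. \<forall>m\<ge>N. \<bar>R n f x - R (r m) f (circle_of 0)\<bar> \<le> holder_const V f * (c / real n powr s)"
    proof (intro exI allI impI)
      fix m assume "n \<le> m"
      then have "n \<le> r m" using seq_suble[OF r, of m] by linarith
      then have "r m = (r m - n) + n" by simp
      then show "\<bar>R n f x - R (r m) f (circle_of 0)\<bar> \<le> holder_const V f * (c / real n powr s)"
        using near[OF that, of "r m - n" "circle_of 0" x] by (simp add: abs_minus_commute)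
    qed
  qed
  have to_0: "(\<lambda>n. K * (c / real n powr s)) \<longlonglongrightarrow> 0" for K
    using s_pos by real_asymp
  have lim: "(\<lambda>n. R n f x) \<longlonglongrightarrow> (\<integral>x. f x \<partial>\<nu>)" if "f \<in> X" for f x
  proof (rule LIM_zero_cancel, rule Lim_null_comparison[OF _ to_0[of "holder_const V f"]])
    show "\<forall>\<^sub>F n in sequentially. norm (R n f x - (\<integral>x. f x \<partial>\<nu>)) \<le> holder_const V f * (c / real n powr s)"
      using eventually_ge_at_top[of 1] by eventually_elim (use near_int[OF that] in simp)
  qed
  have conformal: "(\<integral>x. LT f x \<partial>\<nu>) = \<rho> * (\<integral>x. f x \<partial>\<nu>)" if f: "f \<in> X" for f
  proof (rule LIMSEQ_unique)
    show "(\<lambda>n. R n (LT f) (circle_of 0)) \<longlonglongrightarrow> (\<integral>x. LT f x \<partial>\<nu>)"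
      by (rule lim[OF X_transfer(1)[OF f]])
    \<comment> \<open>The ratio for \<open>LT f\<close> factors through the one for
      \<open>LT 1\<close>, whose limit is \<open>\<rho>\<close>; the other factor is the ratio for
      \<open>f\<close> one step later.\<close>
    have "R n (LT f) (circle_of 0) = R n (LT (\<lambda>_. 1)) (circle_of 0) * R (Suc n) f (circle_of 0)" for n
      using u_pos[of n "circle_of 0"] u_pos[of "Suc n" "circle_of 0"]
      by (simp add: R_def u_def funpow_swap1)
    then show "(\<lambda>n. R n (LT f) (circle_of 0)) \<longlonglongrightarrow> \<rho> * (\<integral>x. f x \<partial>\<nu>)"
      unfolding \<rho>_def using LIMSEQ_Suc[OF lim[OF f, of "circle_of 0"]]
      by (simp only:) (intro tendsto_mult lim X_transfer(1) X_const)
  qed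
  have int_bounds: "f x \<le> E * (\<integral>x. f x \<partial>\<nu>)" "(\<integral>x. f x \<partial>\<nu>) \<le> E * f x"
    if f: "admissible (lift f)" for f x
  proof -
    note le = admissible_circle_le(1)[OF f, folded E_def]
    have fi: "integrable \<nu> f"
      by (rule X_integrable[OF admissible_X(1)[OF f, of "E * f x"]])
         (use le \<nu> \<nu>.finite_measure_axioms in auto)
    have "(\<integral>y. f x \<partial>\<nu>) \<le> (\<integral>y. E * f y \<partial>\<nu>)" using fi le by (intro integral_mono) auto
    then show "f x \<le> E * (\<integral>x. f x \<partial>\<nu>)" by (simp add: \<nu>.prob_space)
    have "(\<integral>y. f y \<partial>\<nu>) \<le> (\<integral>y. E * f x \<partial>\<nu>)" using fi le by (intro integral_mono) auto
    then show "(\<integral>x. f x \<partial>\<nu>) \<le> E * f x" by (simp add: \<nu>.prob_space)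
  qed
  have "0 < E * \<rho>"
    using int_bounds(1)[OF u_adm[of 1], of undefined] u_pos[of 1 undefined] by (simp add: \<rho>_def u_def)
  then have \<rho>: "0 < \<rho>" using E by (simp add: zero_less_mult_iff)
  have u_X: "u n \<in> X" for n unfolding u_def by (intro X_transfer_pow X_const)
  have int_u: "(\<integral>x. u n x \<partial>\<nu>) = \<rho> ^ n" for n
  proof (induction n)
    case (Suc n)
    then show ?case using conformal[OF u_X[of n]] by (simp add: u_def)
  qed (simp add: u_def \<nu>.prob_space)
  \<comment> \<open>Division by \<open>\<rho> ^ n\<close> gives every \<open>h' n\<close> mean
    \<open>1\<close>, and the Harnack bound then confines its values between \<open>1 / E\<close>
    and \<open>E\<close>.\<close>
  define h' where "h' n x = inverse (\<rho> ^ n) * u n x" for n x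
  have h'_adm: "admissible (lift (h' n))" for n
    unfolding h'_def using \<rho> by (intro admissible_scale u_adm) simp
  have h'_int: "(\<integral>x. h' n x \<partial>\<nu>) = 1" for n
    using int_u[of n] \<rho> by (simp add: h'_def)
  have h'_le: "h' n x \<le> E" "1 \<le> E * h' n x" for n x
    using int_bounds[OF h'_adm, of n x] by (simp_all add: h'_int)
  have h'_X: "h' n \<in> X" "holder_const V (h' n) \<le> 2 * (E * C)" for n
    using admissible_X[OF h'_adm h'_le(1)] by auto
  have h'_near: "\<bar>h' (n + m) x - h' n x\<bar> \<le> E * (2 * (E * C)) * (c / real n powr s)"
    if "1 \<le> n" for n m x
  proof -
    have pos: "0 < h' n x" by (rule admissible_circle_le(2)[OF h'_adm])
    have eq: "(LT ^^ n) (h' m) x = inverse (\<rho> ^ m) * u (n + m) x"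
      unfolding h'_def by (simp add: transfer_pow_scale u_def funpow_add)
    \<comment> \<open>The quotient of \<open>h' (n + m)\<close> by \<open>h' n\<close> is the Markov
      average over \<open>n\<close> steps of \<open>h' m\<close>, which has mean \<open>1\<close>
      and a Hoelder constant bounded independently of \<open>m\<close>. It is thus close to
      \<open>1\<close> at a rate in \<open>n\<close> alone, which makes the sequence Cauchy.\<close>
    have R_eq: "R n (h' m) x = h' (n + m) x / h' n x"
      unfolding R_def eq h'_def power_add using \<rho> u_pos[of n x] by (simp add: field_simps)
    have "\<bar>h' (n + m) x / h' n x - 1\<bar> \<le> holder_const V (h' m) * (c / real n powr s)"
      using near_int[OF h'_X(1) that, of m x] by (simp add: R_eq h'_int)
    also have "\<dots> \<le> 2 * (E * C) * (c / real n powr s)"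
      using h'_X(2) c by (intro mult_right_mono) auto
    finally have "h' n x * \<bar>h' (n + m) x / h' n x - 1\<bar> \<le> E * (2 * (E * C) * (c / real n powr s))"
      using h'_le pos E by (intro mult_mono) auto
    moreover have "h' n x * \<bar>h' (n + m) x / h' n x - 1\<bar> = \<bar>h' (n + m) x - h' n x\<bar>"
      using pos by (simp add: abs_if field_simps)
    ultimately show ?thesis by (simp add: mult.assoc)
  qed
  have "convergent (\<lambda>n. h' n x)" for x
  proof (rule Cauchy_convergent, unfold Cauchy_altdef, intro allI impI)
    fix e :: real assume "0 < e"
    with to_0[of "E * (2 * (E * C))"] have "\<forall>\<^sub>F n in sequentially. E * (2 * (E * C)) * (c / real n powr s) < e"
      by (rule order_tendstoD(2))
    then obtain N where N: "\<And>n. n \<ge> N \<Longrightarrow> E * (2 * (E * C)) * (c / real n powr s) < e"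
      by (auto simp: eventually_sequentially)
    have "dist (h' m x) (h' n x) < e" if mn: "max N 1 \<le> m" "m < n" for m n
    proof -
      obtain k where k: "n = m + k" using less_imp_add_positive[OF mn(2)] by blast
      have "1 \<le> m" "N \<le> m" using mn by auto
      then have "\<bar>h' (m + k) x - h' m x\<bar> < e" using h'_near[of m k x] N[of m] by linarith
      then show ?thesis unfolding k dist_real_def by (simp add: abs_minus_commute)
    qed
    then show "\<exists>M. \<forall>m\<ge>M. \<forall>n>m. dist (h' m x) (h' n x) < e" by blast
  qed
  then obtain h where h: "\<And>x. (\<lambda>n. h' n x) \<longlonglongrightarrow> h x"
    unfolding convergent_def by metis
  have h_le: "h x \<le> E" for x by (rule LIMSEQ_le_const2[OF h]) (use h'_le in auto)
  have "1 \<le> E * h x" for x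
    by (rule LIMSEQ_le_const[OF tendsto_mult[OF tendsto_const h]]) (use h'_le in auto)
  then have "0 < E * h x" for x by (rule order.strict_trans2[OF zero_less_one])
  then have h_pos: "0 < h x" for x using E by (simp add: zero_less_mult_iff)
  have h_adm: "admissible (lift h)"
    unfolding admissible_def
  proof (intro conjI ballI)
    fix x y :: real assume "x \<in> {0..1}" "y \<in> {0..1}"
    then show "lift h x \<le> exp (C * V \<bar>x - y\<bar>) * lift h y"
      by (intro LIMSEQ_le[OF h tendsto_mult[OF tendsto_const h]]) (use admissible_le[OF h'_adm] in auto)
  qed (use h_pos in auto)
  have "LT h x = \<rho> * h x" for x
  proof (rule LIMSEQ_unique)
    have LT: "LT f x = L (lift f) (circle_rep x)" for f using transfer_pow[of 1] by simp
    show "(\<lambda>n. LT (h' n) x) \<longlonglongrightarrow> LT h x"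
      unfolding LT L_def by (intro tendsto_intros h)
    have "LT (h' n) x = \<rho> * h' (Suc n) x" for n
      using transfer_pow_scale[of 1 "inverse (\<rho> ^ n)" "u n" x] \<rho>
      by (simp add: h'_def[abs_def] u_def)
    then show "(\<lambda>n. LT (h' n) x) \<longlonglongrightarrow> \<rho> * h x"
      using LIMSEQ_Suc[OF h[of x]] by (simp add: tendsto_mult)
  qed
  then have "RPF_data (T_map q) A X h \<rho> \<nu>"
    unfolding RPF_data_def
    using admissible_X(1)[OF h_adm h_le] h_pos \<rho> \<nu> conformal \<nu>.finite_measure_axioms \<nu>.emeasure_space_1
    by auto
  then show ?thesis by blast
qed

end

subsection \<open>Decay of correlations\<close>

context intermittent begin

lemma transfer_mult_comp: "LT (\<lambda>x. F x * g (T_map q x)) x = g x * LT F x"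
  unfolding transfer_op_def sum_distrib_left by (intro sum.cong) auto

text \<open>Conformality is known only against \<open>X\<close>, while observables will be merely
  integrable. Lipschitz \<open>g\<close> can be tested inside \<open>X\<close>, since
  \<open>g\<close> composed with the map is again Lipschitz; equality of the two measures then
  reaches every Borel function.\<close>

lemma distr_density_T:
  assumes \<nu>: "finite_measure \<nu>" "sets \<nu> = sets borel" and \<rho>: "0 < \<rho>"
    and conformal: "\<And>f. f \<in> X \<Longrightarrow> (\<integral>x. LT f x \<partial>\<nu>) = \<rho> * (\<integral>x. f x \<partial>\<nu>)"
    and F: "F \<in> X" "\<And>x. 0 \<le> F x"
  shows "distr (density \<nu> (\<lambda>x. ennreal (F x))) borel (T_map q) = density \<nu> (\<lambda>x. ennreal (LT F x / \<rho>))"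
    (is "?M = ?N")
proof (rule finite_measure_eqI_lipschitz)
  interpret \<nu>: finite_measure \<nu> by fact
  have borel: "f \<in> borel_measurable \<nu>" if "f \<in> X" for f
    using X_borel[OF that] measurable_cong_sets[OF \<nu>(2) refl] by auto
  have T: "T_map q \<in> borel_measurable \<nu>"
    using T_borel measurable_cong_sets[OF \<nu>(2) refl] by auto
  have G: "LT F \<in> X" "0 \<le> LT F x" for x
    using X_transfer(1) F by (auto simp: transfer_op_def intro!: sum_nonneg)
  have fin: "finite_measure (density \<nu> (\<lambda>x. ennreal (f x)))" if "f \<in> X" "\<And>x. 0 \<le> f x" for f
  proof (rule finite_measureI)
    have "emeasure (density \<nu> (\<lambda>x. ennreal (f x))) (space \<nu>) = (\<integral>\<^sup>+x. ennreal (f x) \<partial>\<nu>)"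
      using borel[OF that(1)] by (simp add: emeasure_density cong: nn_integral_cong)
    also have "\<dots> = ennreal (\<integral>x. f x \<partial>\<nu>)"
      using X_integrable[OF that(1) \<nu>] that(2) by (intro nn_integral_eq_integral) auto
    finally show "emeasure (density \<nu> (\<lambda>x. ennreal (f x))) (space (density \<nu> (\<lambda>x. ennreal (f x)))) \<noteq> \<infinity>"
      by simp
  qed
  have G\<rho>: "(\<lambda>x. LT F x / \<rho>) \<in> X" using X_cmult[OF G(1), of "1 / \<rho>"] by simp
  show "finite_measure ?M"
    by (rule finite_measure.finite_measure_distr[OF fin[OF F]]) (use T in simp)
  show "finite_measure ?N" using G \<rho> G\<rho> by (intro fin) auto
  show "sets ?M = sets borel" "sets ?N = sets borel" using \<nu> by simp_all
  fix g :: "circle \<Rightarrow> real" and K :: real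
  assume K: "0 \<le> K" "\<And>x y. \<bar>g x - g y\<bar> \<le> K * dist x y"
  have g: "g \<in> X" by (rule X_lipschitz[OF K])
  have gT: "(\<lambda>x. g (T_map q x)) \<in> X"
  proof (rule X_lipschitz)
    show "0 \<le> K * 3" using K by simp
    fix x y
    have "\<bar>g (T_map q x) - g (T_map q y)\<bar> \<le> K * dist (T_map q x) (T_map q y)" by (rule K(2))
    also have "\<dots> \<le> K * (3 * dist x y)" using K(1) dist_T_map_le[OF q] by (intro mult_left_mono)
    finally show "\<bar>g (T_map q x) - g (T_map q y)\<bar> \<le> K * 3 * dist x y" by simp
  qed
  have "(\<integral>x. g x \<partial>?M) = (\<integral>x. g (T_map q x) \<partial>density \<nu> (\<lambda>x. ennreal (F x)))"
    using T X_borel[OF g] by (intro integral_distr) auto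
  also have "\<dots> = (\<integral>x. F x * g (T_map q x) \<partial>\<nu>)"
    using F borel[OF F(1)] borel[OF gT] by (subst integral_density) auto
  also have "\<dots> = (\<integral>x. LT (\<lambda>x. F x * g (T_map q x)) x \<partial>\<nu>) / \<rho>"
    using conformal[OF X_mult[OF F(1) gT]] \<rho> by simp
  also have "\<dots> = (\<integral>x. LT F x / \<rho> * g x \<partial>\<nu>)"
    by (simp add: transfer_mult_comp mult.commute flip: integral_divide_zero)
  also have "\<dots> = (\<integral>x. g x \<partial>?N)"
    using G \<rho> borel[OF G\<rho>] borel[OF g] by (subst integral_density) auto
  finally show "(\<integral>x. g x \<partial>?M) = (\<integral>x. g x \<partial>?N)" .
qed

lemma T_pow_borel: "T_map q ^^ n \<in> borel_measurable borel"
proof (induction n)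
  case (Suc n)
  have "T_map q \<circ> (T_map q ^^ n) \<in> borel_measurable borel"
    by (rule measurable_comp[OF Suc T_borel])
  then show ?case by (simp only: funpow.simps)
qed simp

text \<open>Duality turns the correlation into an integral of \<open>R * g\<close>, where
  \<open>R\<close> is the Markov average of the observable with weight \<open>h\<close>. By
  \<open>transfer_decay\<close> the function \<open>R\<close> is uniformly close to its mean, and a
  uniform bound pairs with the \<open>L^1\<close> norm of \<open>g\<close>.\<close>

lemma RPF_decay:
  assumes RPF: "RPF_data (T_map q) A X h \<rho> \<nu>" and h: "admissible (lift h)"
    and \<mu>: "\<mu> = density \<nu> (\<lambda>x. ennreal (h x))" "prob_space \<mu>"
  shows "polynomial_decay (T_map q) \<mu> V s"
proof (rule transfer_decay)
  fix c
  assume c: "0 \<le> c"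
    and decay: "\<And>u f n x y. admissible (lift u) \<Longrightarrow> f \<in> X \<Longrightarrow> 1 \<le> n \<Longrightarrow>
      \<bar>(LT ^^ n) (\<lambda>x. u x * f x) x / (LT ^^ n) u x - (LT ^^ n) (\<lambda>x. u x * f x) y / (LT ^^ n) u y\<bar>
      \<le> holder_const V f * (c / real n powr s)"
  interpret \<mu>: prob_space \<mu> by fact
  have \<nu>: "finite_measure \<nu>" "sets \<nu> = sets borel" and \<rho>: "0 < \<rho>" and hX: "h \<in> X"
    and h_pos: "\<And>x. 0 < h x" and eig: "\<And>x. LT h x = \<rho> * h x"
    and conformal: "\<And>f. f \<in> X \<Longrightarrow> (\<integral>x. LT f x \<partial>\<nu>) = \<rho> * (\<integral>x. f x \<partial>\<nu>)"
    using RPF by (auto simp: RPF_data_def)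
  have sets_\<mu>: "sets \<mu> = sets borel" using \<mu>(1) \<nu>(2) by simp
  have borel_\<nu>: "f \<in> borel_measurable borel \<Longrightarrow> f \<in> borel_measurable \<nu>" for f :: "circle \<Rightarrow> real"
    using measurable_cong_sets[OF \<nu>(2) refl] by auto
  have borel_\<mu>: "f \<in> borel_measurable borel \<longleftrightarrow> f \<in> borel_measurable \<mu>" for f :: "circle \<Rightarrow> real"
    using measurable_cong_sets[OF sets_\<mu> refl] by auto
  have int_\<mu>: "(\<integral>x. f x \<partial>\<mu>) = (\<integral>x. h x * f x \<partial>\<nu>)" if "f \<in> borel_measurable borel" for f
    unfolding \<mu>(1) using that X_borel[OF hX] less_imp_le[OF h_pos]
    by (subst integral_density) (auto intro: borel_\<nu>)
  have eig_pow: "(LT ^^ n) h x = \<rho> ^ n * h x" for n x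
  proof (induction n)
    case (Suc n)
    have "(LT ^^ Suc n) h x = (LT ^^ n) (\<lambda>x. \<rho> * h x) x"
      using ext[of "LT h" "\<lambda>x. \<rho> * h x", OF eig] by (simp add: funpow_swap1)
    then show ?case using Suc by (simp add: transfer_pow_scale)
  qed simp
  have invariant: "distr \<mu> borel (T_map q) = \<mu>"
    using distr_density_T[OF \<nu> \<rho> conformal hX less_imp_le[OF h_pos]] \<rho> eig by (simp add: \<mu>(1))
  have T_\<mu>: "T_map q \<in> measurable \<mu> borel" "T_map q ^^ n \<in> measurable \<mu> borel" for n
    unfolding measurable_cong_sets[OF sets_\<mu> refl] by (rule T_borel, rule T_pow_borel)
  have inv_pow: "distr \<mu> borel (T_map q ^^ n) = \<mu>" for n
  proof (induction n)
    case 0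
    have "distr \<mu> borel (\<lambda>x. x) = distr \<mu> \<mu> (\<lambda>x. x)" by (rule distr_cong) (use sets_\<mu> in auto)
    then show ?case by (simp add: distr_id id_def)
  next
    case (Suc n)
    have "distr \<mu> borel (T_map q \<circ> T_map q ^^ n) = distr (distr \<mu> borel (T_map q ^^ n)) borel (T_map q)"
      by (rule distr_distr[OF T_borel T_\<mu>(2), symmetric])
    then show ?case by (simp only: funpow.simps Suc invariant)
  qed
  \<comment> \<open>Each step is a change of variables through \<open>distr_density_T\<close>, valid
    for the Bochner integral whether or not the integrand is integrable.\<close>
  have dual: "(\<integral>x. F x * g ((T_map q ^^ n) x) \<partial>\<nu>) = (\<integral>x. (LT ^^ n) F x / \<rho> ^ n * g x \<partial>\<nu>)"
    if "F \<in> X" "\<And>x. 0 \<le> F x" and g: "g \<in> borel_measurable borel" for F n and g :: "circle \<Rightarrow> real"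
    using that(1,2)
  proof (induction n arbitrary: F)
    case (Suc n)
    let ?g = "\<lambda>x. g ((T_map q ^^ n) x)"
    have g': "?g \<in> borel_measurable borel" using measurable_compose[OF T_pow_borel g] .
    have G: "LT F \<in> X" "0 \<le> LT F x" for x
      using X_transfer(1) Suc.prems by (auto simp: transfer_op_def intro!: sum_nonneg)
    have "(\<integral>x. F x * g ((T_map q ^^ Suc n) x) \<partial>\<nu>) = (\<integral>x. F x * ?g (T_map q x) \<partial>\<nu>)"
      by (simp add: funpow_swap1)
    also have "\<dots> = (\<integral>x. ?g (T_map q x) \<partial>density \<nu> (\<lambda>x. ennreal (F x)))"
      using Suc.prems measurable_compose[OF T_borel g'] X_borel
      by (subst integral_density) (auto intro: borel_\<nu>)
    also have "\<dots> = (\<integral>x. ?g x \<partial>distr (density \<nu> (\<lambda>x. ennreal (F x))) borel (T_map q))"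
      using g' T_borel measurable_cong_sets[OF \<nu>(2) refl] by (intro integral_distr[symmetric]) auto
    also have "\<dots> = (\<integral>x. ?g x \<partial>density \<nu> (\<lambda>x. ennreal (LT F x / \<rho>)))"
      by (subst distr_density_T[OF \<nu> \<rho> conformal Suc.prems]) auto
    also have "\<dots> = (\<integral>x. LT F x / \<rho> * ?g x \<partial>\<nu>)"
      using G g' \<rho> X_borel[OF G(1)] by (subst integral_density) (auto intro: borel_\<nu>)
    also have "\<dots> = (\<integral>x. LT F x * ?g x \<partial>\<nu>) / \<rho>"
      by (simp flip: integral_divide_zero)
    also have "\<dots> = (\<integral>x. (LT ^^ n) (LT F) x / \<rho> ^ n * g x \<partial>\<nu>) / \<rho>"
      by (simp add: Suc.IH[OF G])
    also have "\<dots> = (\<integral>x. (LT ^^ Suc n) F x / \<rho> ^ Suc n * g x \<partial>\<nu>)"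
      by (simp add: funpow_swap1 mult.commute flip: integral_divide_zero)
    finally show ?case .
  qed simp
  show "polynomial_decay (T_map q) \<mu> V s"
    unfolding polynomial_decay_def
  proof (intro exI ballI allI impI)
    fix f g :: "circle \<Rightarrow> real" and t :: nat
    assume f: "f \<in> X" and g: "integrable \<mu> g" and t: "1 \<le> t"
    have gb: "g \<in> borel_measurable borel" using g borel_\<mu> by auto
    \<comment> \<open>Shifting by the sup norm makes the observable nonnegative, as a density has to
      be; Hoelder constant and covariance are unchanged.\<close>
    define k where "k = (SUP x. \<bar>f x\<bar>)"
    define F where "F x = f x + k" for x
    have F0: "0 \<le> F x" for x using X_bounded(2)[OF f, of x] by (simp add: F_def k_def)
    have FX: "F \<in> X" unfolding F_def by (rule X_add[OF f X_const])
    have F_const: "holder_const V F = holder_const V f" by (simp add: holder_const_def F_def)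
    define R where "R x = (LT ^^ t) (\<lambda>x. h x * F x) x / (LT ^^ t) h x" for x
    have hF: "(\<lambda>x. h x * F x) \<in> X" by (rule X_mult[OF hX FX])
    have Rb: "R \<in> borel_measurable borel"
      unfolding R_def by (intro borel_measurable_divide X_borel X_transfer_pow hF hX)
    have gt: "integrable \<mu> (\<lambda>x. g ((T_map q ^^ t) x))" "(\<integral>x. g ((T_map q ^^ t) x) \<partial>\<mu>) = (\<integral>x. g x \<partial>\<mu>)"
      using integrable_distr_eq[OF T_\<mu>(2)[of t] gb] integral_distr[OF T_\<mu>(2)[of t] gb] g
      by (simp_all add: inv_pow)
    have f\<mu>: "integrable \<mu> f" "f \<in> borel_measurable \<mu>"
      using X_integrable[OF f \<mu>.finite_measure_axioms sets_\<mu>] by auto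
    have fg: "integrable \<mu> (\<lambda>x. f x * g ((T_map q ^^ t) x))"
    proof (rule Bochner_Integration.integrable_bound[OF integrable_mult_right[OF gt(1), of k]])
      show "(\<lambda>x. f x * g ((T_map q ^^ t) x)) \<in> borel_measurable \<mu>"
        using f\<mu> gt by (intro borel_measurable_times) auto
      show "AE x in \<mu>. norm (f x * g ((T_map q ^^ t) x)) \<le> norm (k * g ((T_map q ^^ t) x))"
        using X_bounded[OF f]
        by (intro AE_I2) (auto simp: abs_mult k_def intro!: mult_right_mono)
    qed
    have "(\<integral>x. F x * g ((T_map q ^^ t) x) \<partial>\<mu>) = (\<integral>x. h x * (F x * g ((T_map q ^^ t) x)) \<partial>\<nu>)"
      using X_borel[OF FX] measurable_compose[OF T_pow_borel gb]
      by (intro int_\<mu> borel_measurable_times) auto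
    also have "\<dots> = (\<integral>x. (LT ^^ t) (\<lambda>x. h x * F x) x / \<rho> ^ t * g x \<partial>\<nu>)"
      using dual[OF hF _ gb, of t] F0 less_imp_le[OF h_pos] by (simp add: mult.assoc)
    also have "\<dots> = (\<integral>x. h x * (R x * g x) \<partial>\<nu>)"
    proof -
      have "(LT ^^ t) (\<lambda>x. h x * F x) x / \<rho> ^ t * g x = h x * (R x * g x)" for x
        using h_pos[of x] \<rho> by (simp add: R_def eig_pow)
      then show ?thesis by simp
    qed
    also have "\<dots> = (\<integral>x. R x * g x \<partial>\<mu>)"
      using Rb gb by (intro int_\<mu>[symmetric] borel_measurable_times) auto
    finally have corr: "(\<integral>x. F x * g ((T_map q ^^ t) x) \<partial>\<mu>) = (\<integral>x. R x * g x \<partial>\<mu>)" .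
    have "(\<integral>x. F x \<partial>\<mu>) = (\<integral>x. h x * F x \<partial>\<nu>)" by (rule int_\<mu>[OF X_borel[OF FX]])
    also have "\<dots> = (\<integral>x. (LT ^^ t) (\<lambda>x. h x * F x) x / \<rho> ^ t \<partial>\<nu>)"
      using dual[OF hF, of "\<lambda>_. 1" t] F0 less_imp_le[OF h_pos] by simp
    also have "\<dots> = (\<integral>x. h x * R x \<partial>\<nu>)"
    proof -
      have "(LT ^^ t) (\<lambda>x. h x * F x) x / \<rho> ^ t = h x * R x" for x
        using h_pos[of x] \<rho> by (simp add: R_def eig_pow)
      then show ?thesis by simp
    qed
    also have "\<dots> = (\<integral>x. R x \<partial>\<mu>)" by (rule int_\<mu>[symmetric, OF Rb])
    finally have mean: "(\<integral>x. F x \<partial>\<mu>) = (\<integral>x. R x \<partial>\<mu>)" .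
    define e where "e = holder_const V f * (c / real t powr s)"
    have osc: "\<bar>R x - R y\<bar> \<le> e" for x y
      using decay[OF h FX t, of x y] by (simp add: R_def e_def F_const)
    have R_int: "integrable \<mu> R"
    proof (rule \<mu>.integrable_const_bound[of _ "\<bar>R undefined\<bar> + e"])
      show "AE x in \<mu>. norm (R x) \<le> \<bar>R undefined\<bar> + e"
      proof (rule AE_I2)
        fix x show "norm (R x) \<le> \<bar>R undefined\<bar> + e"
          using osc[of x undefined] by simp
      qed
    qed (use Rb borel_\<mu> in auto)
    \<comment> \<open>\<open>F\<close> and \<open>R\<close> have the same mean, and a function of
      oscillation at most \<open>e\<close> stays within \<open>e\<close> of its mean.\<close>
    have near: "\<bar>R x - (\<integral>x. F x \<partial>\<mu>)\<bar> \<le> e" for x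
    proof -
      have lo: "R x - e \<le> R y" "R y \<le> R x + e" for y using osc[of x y] by linarith+
      have "(\<integral>y. R x - e \<partial>\<mu>) \<le> (\<integral>y. R y \<partial>\<mu>)" "(\<integral>y. R y \<partial>\<mu>) \<le> (\<integral>y. R x + e \<partial>\<mu>)"
        using R_int lo by (intro integral_mono; simp)+
      then show ?thesis by (simp add: mean \<mu>.prob_space abs_le_iff)
    qed
    have Rg: "integrable \<mu> (\<lambda>x. R x * g x)"
    proof (rule Bochner_Integration.integrable_bound[OF integrable_mult_right[OF g, of "\<bar>R undefined\<bar> + e"]])
      show "(\<lambda>x. R x * g x) \<in> borel_measurable \<mu>"
        using R_int g by (intro borel_measurable_times) auto
      have "\<bar>R x\<bar> \<le> \<bar>\<bar>R undefined\<bar> + e\<bar>" for x using osc[of x undefined] by linarith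
      then show "AE x in \<mu>. norm (R x * g x) \<le> norm ((\<bar>R undefined\<bar> + e) * g x)"
        by (intro AE_I2) (auto simp: abs_mult intro!: mult_right_mono)
    qed
    have "(\<integral>x. F x * g ((T_map q ^^ t) x) \<partial>\<mu>)
        = (\<integral>x. f x * g ((T_map q ^^ t) x) \<partial>\<mu>) + k * (\<integral>x. g x \<partial>\<mu>)"
      using fg gt by (simp add: F_def distrib_right)
    moreover have "(\<integral>x. F x \<partial>\<mu>) = (\<integral>x. f x \<partial>\<mu>) + k"
      using f\<mu> by (simp add: F_def \<mu>.prob_space)
    ultimately have "(\<integral>x. f x * g ((T_map q ^^ t) x) \<partial>\<mu>) - (\<integral>x. f x \<partial>\<mu>) * (\<integral>x. g x \<partial>\<mu>)
        = (\<integral>x. R x * g x \<partial>\<mu>) - (\<integral>x. F x \<partial>\<mu>) * (\<integral>x. g x \<partial>\<mu>)"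
      by (simp add: corr[symmetric] algebra_simps)
    also have "\<dots> = (\<integral>x. R x * g x - (\<integral>x. F x \<partial>\<mu>) * g x \<partial>\<mu>)"
      using Rg g by simp
    finally have "\<bar>(\<integral>x. f x * g ((T_map q ^^ t) x) \<partial>\<mu>) - (\<integral>x. f x \<partial>\<mu>) * (\<integral>x. g x \<partial>\<mu>)\<bar>
        \<le> (\<integral>x. \<bar>R x * g x - (\<integral>x. F x \<partial>\<mu>) * g x\<bar> \<partial>\<mu>)"
      by (simp add: integral_abs_bound)
    also have "\<dots> \<le> (\<integral>x. e * \<bar>g x\<bar> \<partial>\<mu>)"
    proof (rule integral_mono)
      show "integrable \<mu> (\<lambda>x. \<bar>R x * g x - (\<integral>x. F x \<partial>\<mu>) * g x\<bar>)"
        using Rg g by (intro integrable_abs Bochner_Integration.integrable_diff) auto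
      show "integrable \<mu> (\<lambda>x. e * \<bar>g x\<bar>)" using g by simp
      fix x
      have "\<bar>R x - (\<integral>x. F x \<partial>\<mu>)\<bar> * \<bar>g x\<bar> \<le> e * \<bar>g x\<bar>"
        by (intro mult_right_mono near) simp
      then show "\<bar>R x * g x - (\<integral>x. F x \<partial>\<mu>) * g x\<bar> \<le> e * \<bar>g x\<bar>"
        by (simp add: abs_mult flip: left_diff_distrib)
    qed
    also have "\<dots> = c * holder_const V f * (\<integral>x. \<bar>g x\<bar> \<partial>\<mu>) / real t powr s"
      by (simp add: e_def)
    finally show "\<bar>(\<integral>x. f x * g ((T_map q ^^ t) x) \<partial>\<mu>) - (\<integral>x. f x \<partial>\<mu>) * (\<integral>x. g x \<partial>\<mu>)\<bar>
        \<le> c * holder_const V f * (\<integral>x. \<bar>g x\<bar> \<partial>\<mu>) / real t powr s" .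
  qed
qed

section \<open>Arbitrary eigenfunctions and the choice of constants\<close>

text \<open>On the compact interval \<open>h\<close> has a positive minimum, and
  \<open>1 + z \<le> exp z\<close> turns the additive Hoelder bound into a multiplicative one.
  Stating it for all large \<open>C'\<close> lets the constant be merged with the one required by
  the potential.\<close>

lemma positive_holder_ratio:
  assumes h: "h \<in> X" "\<And>x. 0 < h x"
  shows "\<exists>K. \<forall>C'\<ge>K. \<forall>x\<in>{0..1}. \<forall>y\<in>{0..1}. lift h x \<le> exp (C' * V \<bar>x - y\<bar>) * lift h y"
proof -
  have "continuous_on {0..1} (lift h)"
    by (rule continuous_on_compose2[OF X_continuous[OF h(1)] continuous_on_subset[OF continuous_circle_of]]) auto
  then have "\<exists>m\<in>{0..1}. \<forall>y\<in>{0..1}. lift h m \<le> lift h y"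
    by (intro continuous_attains_inf) auto
  then obtain m where m: "\<forall>y\<in>{0..1}. lift h m \<le> lift h y" by blast
  define H where "H = holder_const V h"
  have H: "0 \<le> H" "holder H (lift h)" using holder_const_nonneg[OF h(1)] holder_lift[OF h(1)] by (auto simp: H_def)
  have m0: "0 < lift h m" by (rule h(2))
  have "lift h x \<le> exp (C' * V \<bar>x - y\<bar>) * lift h y"
    if C': "H / lift h m \<le> C'" and xy: "x \<in> {0..1}" "y \<in> {0..1}" for C' x y
  proof -
    have V: "0 \<le> V \<bar>x - y\<bar>" by (simp add: V_nonneg)
    have C'0: "0 \<le> C'" using C' H m0 by (meson divide_nonneg_pos order_trans)
    have "H \<le> C' * lift h m" using C' m0 by (simp add: divide_le_eq)
    also have "\<dots> \<le> C' * lift h y" using bspec[OF m xy(2)] C'0 by (intro mult_left_mono)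
    finally have "H * V \<bar>x - y\<bar> \<le> C' * lift h y * V \<bar>x - y\<bar>" using V by (intro mult_right_mono)
    moreover have "lift h x \<le> lift h y + H * V \<bar>x - y\<bar>"
    proof -
      have "\<bar>lift h x - lift h y\<bar> \<le> H * V \<bar>x - y\<bar>" using H(2) xy by (simp add: holder_def)
      then show ?thesis by linarith
    qed
    ultimately have "lift h x \<le> (1 + C' * V \<bar>x - y\<bar>) * lift h y" by (simp add: algebra_simps)
    also have "\<dots> \<le> exp (C' * V \<bar>x - y\<bar>) * lift h y"
      using h(2) exp_ge_add_one_self by (intro mult_right_mono) (auto simp: less_imp_le)
    finally show ?thesis .
  qed
  then show ?thesis by blast
qed

end

text \<open>The chain behind \<open>flat\<close>: the modulus of \<open>A\<close> at the gap
  \<open>d\<close> of the preimages is at most a multiple of \<open>V (expand q d) - V d\<close>,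
  and \<open>expand q d\<close> is at most the original gap. Larger \<open>C\<close> remain possible
  because the difference of values of \<open>V\<close> is nonnegative.\<close>

lemma intermittent_exists:
  fixes q \<beta> :: real and \<omega> V :: "real \<Rightarrow> real" and A :: "circle \<Rightarrow> real"
  assumes q: "0 < q" "q < 1" and \<beta>: "1 < \<beta>"
    and \<omega>: "log_modulus q \<beta> \<omega>" and V: "log_modulus 0 (\<beta> - 1) V" and A: "A \<in> holder_space \<omega>"
  obtains C0 B r1 where "\<And>C. C0 \<le> C \<Longrightarrow> intermittent q A V C B (\<beta> - 1) r1"
proof -
  obtain r0 where r0: "1 < r0" "\<And>r. r \<in> {0<..1} \<Longrightarrow> \<omega> r = r powr q / (ln (r0 / r)) powr \<beta>"
    and \<omega>_mono: "mono_on {0..} \<omega>" and \<omega>0: "\<omega> 0 = 0"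
    using \<omega> by (auto simp: log_modulus_def modulus_of_continuity_def)
  obtain r1 where r1: "1 < r1" "\<And>r. r \<in> {0<..1} \<Longrightarrow> V r = 1 / (ln (r1 / r)) powr (\<beta> - 1)"
    and V': "continuous_on {0..} V" "mono_on {0..} V" "concave_on {0..} V" "V 0 = 0"
    using V by (auto simp: log_modulus_def modulus_of_continuity_def)
  have V_mono: "V r \<le> V t" if "0 \<le> r" "r \<le> t" for r t
    using V'(2) that by (auto simp: mono_on_def)
  obtain K where K: "0 \<le> K" "\<And>d. 0 < d \<Longrightarrow> d \<le> 1/2 \<Longrightarrow> d powr q / ln (r0 / d) powr \<beta>
      \<le> K * (1 / ln (r1 / expand q d) powr (\<beta> - 1) - 1 / ln (r1 / d) powr (\<beta> - 1))"
    using log_modulus_gain[OF q(1) \<beta> r0(1) r1(1)] by blast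
  have gain: "\<omega> d \<le> K * (V (expand q d) - V d)" if d: "0 \<le> d" "d \<le> 1/2" for d
  proof (cases "d = 0")
    case True
    then show ?thesis using \<omega>0 V' by (simp add: expand_def)
  next
    case False
    then have "0 < d" using d by simp
    moreover have "expand q d \<in> {0<..1}"
      using expand_ge[of d q] expand_le_2[OF q(1), of d] d \<open>0 < d\<close> by auto
    ultimately show ?thesis using K(2)[of d] r0(2)[of d] r1(2)[of d] r1(2)[of "expand q d"] d by simp
  qed
  obtain H' where H': "\<And>x y. \<bar>A x - A y\<bar> \<le> H' * \<omega> (dist x y)"
    using A by (auto simp: holder_space_def)
  define H where "H = max 0 H'"
  have \<omega>_nonneg: "0 \<le> \<omega> r" if "0 \<le> r" for r
    using mono_onD[OF \<omega>_mono, of 0 r] that \<omega>0 by simp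
  have A_le: "\<bar>A (circle_of x) - A (circle_of y)\<bar> \<le> H * \<omega> \<bar>x - y\<bar>" for x y
  proof -
    have "\<bar>A (circle_of x) - A (circle_of y)\<bar> \<le> H' * \<omega> (dist (circle_of x) (circle_of y))" by (rule H')
    also have "\<dots> \<le> H * \<omega> \<bar>x - y\<bar>"
      using \<omega>_nonneg dist_circle_of_le[of x y]
      by (intro mult_mono mono_onD[OF \<omega>_mono]) (auto simp: H_def)
    finally show ?thesis .
  qed
  define B where "B = \<bar>A (circle_of 0)\<bar> + H * \<omega> 1"
  show thesis
  proof (rule that)
    fix C assume C: "H * K \<le> C"
    have HK: "0 \<le> H * K" using K by (simp add: H_def)
    show "intermittent q A V C B (\<beta> - 1) r1"
    proof unfold_locales
      fix x y :: real and i assume x: "x \<in> {0..1}" and y: "y \<in> {0..1}"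
      show "branch q i x \<in> {0..1}" by (rule branch_in[OF q(1) x])
      show "\<bar>branch q False x - branch q False y\<bar> \<le> \<bar>x - y\<bar>"
        using expand_ge[of "\<bar>branch q False x - branch q False y\<bar>" q] expand_branch_le[OF q(1) x y, of False]
        by simp
      show "\<bar>branch q True x - branch q True y\<bar> \<le> \<bar>x - y\<bar> / 2"
        by (simp add: branch_True flip: diff_divide_distrib)
      let ?d = "\<bar>branch q i x - branch q i y\<bar>"
      have d: "?d \<le> 1/2"
        using branch_False(1)[OF q(1) x] branch_False(1)[OF q(1) y] x y
        by (cases i) (simp_all add: branch_True abs_if field_simps)
      have e: "expand q ?d \<le> \<bar>x - y\<bar>" by (rule expand_branch_le[OF q(1) x y])
      have "\<bar>A (circle_of (branch q i x)) - A (circle_of (branch q i y))\<bar> \<le> H * \<omega> ?d" by (rule A_le)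
      also have "\<dots> \<le> H * (K * (V (expand q ?d) - V ?d))"
        using gain[of ?d] d by (intro mult_left_mono) (auto simp: H_def)
      also have "\<dots> \<le> H * K * (V \<bar>x - y\<bar> - V ?d)"
        unfolding mult.assoc[symmetric] using HK V_mono[OF _ e] expand_ge[of ?d q]
        by (intro mult_left_mono) auto
      also have "\<dots> \<le> C * (V \<bar>x - y\<bar> - V ?d)"
      proof (rule mult_right_mono[OF C])
        have "?d \<le> \<bar>x - y\<bar>" using e expand_ge[of ?d q] by simp
        then show "0 \<le> V \<bar>x - y\<bar> - V ?d" using V_mono[of ?d "\<bar>x - y\<bar>"] by simp
      qed
      finally show "\<bar>A (circle_of (branch q i x)) - A (circle_of (branch q i y))\<bar>
        \<le> C * (V \<bar>x - y\<bar> - V ?d)" .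
      have "\<omega> \<bar>x - 0\<bar> \<le> \<omega> 1" by (rule mono_onD[OF \<omega>_mono]) (use x in auto)
      then have "H * \<omega> \<bar>x - 0\<bar> \<le> H * \<omega> 1" by (intro mult_left_mono) (auto simp: H_def)
      then show "\<bar>A (circle_of x)\<bar> \<le> B" using A_le[of x 0] unfolding B_def by linarith
    next
      show "0 \<le> C" using HK C by linarith
      show "V r = 1 / ln (r1 / r) powr (\<beta> - 1)" if "r \<in> {0<..1}" for r by (rule r1(2)[OF that])
    qed (use q \<beta> V' r1 in auto)
  qed
qed

theorem theorem7:
  fixes q \<beta> :: real and \<omega> \<omega>' :: "real \<Rightarrow> real" and A :: "circle \<Rightarrow> real"
  assumes "0 < q" and "q < 1" and "\<beta> > 1"
    and "log_modulus q \<beta> \<omega>"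
    and "log_modulus 0 (\<beta> - 1) \<omega>'"
    and "A \<in> holder_space \<omega>"
  shows "satisfies_RPF (T_map q) A (holder_space \<omega>') (holder_norm \<omega>') \<and>
    (\<forall>\<mu>. RPF_measure (T_map q) A (holder_space \<omega>') \<mu> \<longrightarrow>
       polynomial_decay (T_map q) \<mu> \<omega>' (\<beta> - 1))"
proof -
  obtain C0 B r1 where loc: "\<And>C. C0 \<le> C \<Longrightarrow> intermittent q A \<omega>' C B (\<beta> - 1) r1"
    using intermittent_exists[OF assms] by blast
  interpret base: intermittent q A \<omega>' C0 B "\<beta> - 1" r1 by (rule loc) simp
  show ?thesis
  proof (intro conjI allI impI)
    show "satisfies_RPF (T_map q) A (holder_space \<omega>') (holder_norm \<omega>')"
      unfolding satisfies_RPF_def using base.transfer_acts_continuously base.RPF_exists by blast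
    fix \<mu> assume "RPF_measure (T_map q) A (holder_space \<omega>') \<mu>"
    then obtain h \<rho> \<nu> where RPF: "RPF_data (T_map q) A (holder_space \<omega>') h \<rho> \<nu>"
      and \<mu>: "\<mu> = density \<nu> (\<lambda>x. ennreal (h x))" "prob_space \<mu>"
      by (auto simp: RPF_measure_def)
    then have h: "h \<in> holder_space \<omega>'" "\<And>x. 0 < h x" by (auto simp: RPF_data_def)
    from base.positive_holder_ratio[OF h]
    obtain K where K: "\<And>C'. K \<le> C' \<Longrightarrow> \<forall>x\<in>{0..1}. \<forall>y\<in>{0..1}.
        h (circle_of x) \<le> exp (C' * \<omega>' \<bar>x - y\<bar>) * h (circle_of y)" by blast
    \<comment> \<open>The measure may come from any eigenfunction in the space, so the cone is
      widened once \<open>h\<close> is known. Neither the operator nor the space depends on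
      \<open>C\<close>; the decay constant obtained may depend on \<open>h\<close>.\<close>
    interpret large: intermittent q A \<omega>' "max C0 K" B "\<beta> - 1" r1 by (rule loc) simp
    have "large.admissible (\<lambda>t. h (circle_of t))"
      unfolding large.admissible_def using h(2) K[of "max C0 K"] by simp
    then show "polynomial_decay (T_map q) \<mu> \<omega>' (\<beta> - 1)"
      by (rule large.RPF_decay[OF RPF _ \<mu>])
  qed
qed

end
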